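(* Let $A$ be a normal graded algebra over a field $k$, $G$ a finite group of graded $k$-algebra automorphisms of $A$, and $M$ a finite dimensional $kG$-module. Let $W$ be the reflection subgroup of $G$ acting on $A$, and let $K$ be a subgroup such that $W\leq K\leq G$. Suppose that $A^G(M)$ is free over $A^G$. Then multiplication induces an isomorphism of graded $A^K$-modules $$\mu:A^K\otimes_{A^G}A^G(M)\simeq A^K(M).$$ In particular, $A^K(M)$ is free over $A^K$, and $A^G(M)$ and $A^K(M)$ share bases.
   Context: $k$ is a field of arbitrary characteristic. A graded algebra is a finitely generated graded $k$-algebra $A=\bigoplus_{i\ge 0}A_i$ without zero-divisors with $A_0=k$; it is normal if it is integrally closed in its quotient field. For a subgroup $H\leq G$, $A^H$ is the ring of $H$-invariants and $A^H(M):=(A\otimes_k M)^H$ (diagonal action) is the module of covariants of type $M$, a graded $A^H$-module. The multiplication map is $a\otimes\omega\mapsto a\omega$. The inertia subgroup of a prime ideal $\mathfrak P\subset A$ is $G_i(\mathfrak P)=\{\sigma\in G:\ \sigma(a)-a\in\mathfrak P \text{ for all } a\in A\}$. An element $\sigma \in G$ is a reflection on $A$ if it lies in the inertia subgroup of some prime ideal of height one; $W$ is the subgroup of $G$ generated by all reflections on $A$. "$A^G(M)$ and $A^K(M)$ share bases" means that an $A^G$-basis of $A^G(M)$ is also an $A^K$-basis of $A^K(M)\supseteq A^G(M)$. *)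

theory Defs
  imports
    "HOL-Algebra.Algebra"
    "HOL-Library.Extended_Nat"
    "Jordan_Normal_Form.Missing_VectorSpace"
begin

section \<open>Quotient field and normality\<close>

definition fraction :: "('a, 'm) ring_scheme \<Rightarrow> 'a \<Rightarrow> 'a \<Rightarrow> ('a \<times> 'a) set" where
  "fraction R a b =
     {(c, d). c \<in> carrier R \<and> d \<in> carrier R - {\<zero>\<^bsub>R\<^esub>} \<and> a \<otimes>\<^bsub>R\<^esub> d = c \<otimes>\<^bsub>R\<^esub> b}"

text \<open>The union over all representatives of a class is the class itself, because the
  operations are compatible with equality of fractions when the ring is a domain.\<close>

definition quotient_field :: "('a, 'm) ring_scheme \<Rightarrow> ('a \<times> 'a) set ring" where
  "quotient_field R =
     \<lparr>carrier = {fraction R a b | a b. a \<in> carrier R \<and> b \<in> carrier R - {\<zero>\<^bsub>R\<^esub>}},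
      monoid.mult = (\<lambda>U V. \<Union>(a, b)\<in>U. \<Union>(c, d)\<in>V. fraction R (a \<otimes>\<^bsub>R\<^esub> c) (b \<otimes>\<^bsub>R\<^esub> d)),
      one = fraction R \<one>\<^bsub>R\<^esub> \<one>\<^bsub>R\<^esub>,
      ring.zero = fraction R \<zero>\<^bsub>R\<^esub> \<one>\<^bsub>R\<^esub>,
      ring.add = (\<lambda>U V. \<Union>(a, b)\<in>U. \<Union>(c, d)\<in>V.
               fraction R (a \<otimes>\<^bsub>R\<^esub> d \<oplus>\<^bsub>R\<^esub> c \<otimes>\<^bsub>R\<^esub> b) (b \<otimes>\<^bsub>R\<^esub> d))\<rparr>"

text \<open>Polynomials are coefficient lists with the leading coefficient first.\<close>

definition integral_over :: "('a, 'm) ring_scheme \<Rightarrow> 'a set \<Rightarrow> 'a \<Rightarrow> bool" where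
  "integral_over L S x \<longleftrightarrow>
     (\<exists>p. polynomial\<^bsub>L\<^esub> S p \<and> p \<noteq> [] \<and> hd p = \<one>\<^bsub>L\<^esub> \<and> ring.eval L p x = \<zero>\<^bsub>L\<^esub>)"

definition integrally_closed_in_quotient_field :: "('a, 'm) ring_scheme \<Rightarrow> bool" where
  "integrally_closed_in_quotient_field R \<longleftrightarrow>
     (let A = (\<lambda>a. fraction R a \<one>\<^bsub>R\<^esub>) ` carrier R in
      \<forall>x \<in> carrier (quotient_field R). integral_over (quotient_field R) A x \<longrightarrow> x \<in> A)"


section \<open>Gradings\<close>

definition is_grading :: "('a, 'm) ring_scheme \<Rightarrow> (nat \<Rightarrow> 'a set) \<Rightarrow> bool" where
  "is_grading M gr \<longleftrightarrow>
     (\<forall>i. additive_subgroup (gr i) M) \<and>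
     (\<forall>x \<in> carrier M. \<exists>!c. (\<forall>i. c i \<in> gr i) \<and> finite {i. c i \<noteq> \<zero>\<^bsub>M\<^esub>} \<and>
        x = (\<Oplus>\<^bsub>M\<^esub>i\<in>{i. c i \<noteq> \<zero>\<^bsub>M\<^esub>}. c i))"

definition graded_ring :: "('a, 'm) ring_scheme \<Rightarrow> (nat \<Rightarrow> 'a set) \<Rightarrow> bool" where
  "graded_ring R gr \<longleftrightarrow> ring R \<and> is_grading R gr \<and>
     (\<forall>i j. \<forall>a \<in> gr i. \<forall>b \<in> gr j. a \<otimes>\<^bsub>R\<^esub> b \<in> gr (i + j))"

definition graded_module ::
  "('r, 'm) ring_scheme \<Rightarrow> (nat \<Rightarrow> 'r set) \<Rightarrow> ('r, 'a, 'n) module_scheme \<Rightarrow> (nat \<Rightarrow> 'a set) \<Rightarrow> bool"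
where
  "graded_module R grR M grM \<longleftrightarrow> graded_ring R grR \<and> module R M \<and> is_grading M grM \<and>
     (\<forall>i j. \<forall>r \<in> grR i. \<forall>x \<in> grM j. r \<odot>\<^bsub>M\<^esub> x \<in> grM (i + j))"

definition graded_module_iso ::
  "('r, 'm) ring_scheme \<Rightarrow> (nat \<Rightarrow> 'r set) \<Rightarrow>
   ('r, 'a, 'n) module_scheme \<Rightarrow> (nat \<Rightarrow> 'a set) \<Rightarrow>
   ('r, 'b, 'o) module_scheme \<Rightarrow> (nat \<Rightarrow> 'b set) \<Rightarrow> ('a \<Rightarrow> 'b) set"
where
  "graded_module_iso R grR M grM N grN =
     {f \<in> module_hom R M N.
        graded_module R grR M grM \<and> graded_module R grR N grN \<and>
        bij_betw f (carrier M) (carrier N) \<and> (\<forall>n. f ` grM n = grN n)}"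

definition trivial_grading :: "('a, 'm) ring_scheme \<Rightarrow> nat \<Rightarrow> 'a set" where
  "trivial_grading M n = (if n = 0 then carrier M else {\<zero>\<^bsub>M\<^esub>})"

text \<open>Since \<open>gr 0\<close> is the image of \<open>k\<close>, the ring generated by \<open>gr 0 \<union> S\<close> is the
  \<open>k\<close>-subalgebra generated by \<open>S\<close>.\<close>

definition normal_graded_algebra ::
  "('k, 'm) ring_scheme \<Rightarrow> ('k, 'a, 'n) module_scheme \<Rightarrow> (nat \<Rightarrow> 'a set) \<Rightarrow> bool"
where
  "normal_graded_algebra k A gr \<longleftrightarrow>
     field k \<and> algebra k A \<and> domain A \<and> graded_ring A gr \<and>
     gr 0 = (\<lambda>c. c \<odot>\<^bsub>A\<^esub> \<one>\<^bsub>A\<^esub>) ` carrier k \<and>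
     (\<exists>S \<subseteq> carrier A. finite S \<and> generate_ring A (gr 0 \<union> S) = carrier A) \<and>
     integrally_closed_in_quotient_field A"

definition graded_algebra_auts ::
  "('k, 'm) ring_scheme \<Rightarrow> ('k, 'a, 'n) module_scheme \<Rightarrow> (nat \<Rightarrow> 'a set) \<Rightarrow> ('a \<Rightarrow> 'a) set"
where
  "graded_algebra_auts k A gr =
     {\<sigma> \<in> Bij (carrier A). \<sigma> \<in> ring_hom A A \<and> \<sigma> \<in> module_hom k A A \<and> (\<forall>i. \<sigma> ` gr i \<subseteq> gr i)}"


section \<open>Bases of modules\<close>

definition module_basis ::
  "('r, 'm) ring_scheme \<Rightarrow> ('r, 'a, 'n) module_scheme \<Rightarrow> 'a set \<Rightarrow> bool"
where
  "module_basis R M B \<longleftrightarrow>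
     B \<subseteq> carrier M \<and> \<not> module.lin_dep R M B \<and> module.span R M B = carrier M"

definition free_module :: "('r, 'm) ring_scheme \<Rightarrow> ('r, 'a, 'n) module_scheme \<Rightarrow> bool" where
  "free_module R M \<longleftrightarrow> (\<exists>B. module_basis R M B)"


section \<open>Tensor products\<close>

text \<open>For an \<open>R\<close>-algebra \<open>S\<close> (a ring that carries an \<open>R\<close>-module structure) and an \<open>R\<close>-module
  \<open>N\<close>, the tensor product of \<open>S\<close> and \<open>N\<close> over \<open>R\<close> is the free abelian group on the pairs in
  \<open>S \<times> N\<close> modulo the subgroup generated by the bilinearity relations.\<close>

definition tensor_relations ::
  "('r, 'l) ring_scheme \<Rightarrow> ('r, 's, 'm) module_scheme \<Rightarrow> ('r, 'n, 'p) module_scheme \<Rightarrow>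
   ('s \<times> 'n \<Rightarrow>\<^sub>0 int) set"
where
  "tensor_relations R S N = generate (free_Abelian_group (carrier S \<times> carrier N))
     ({frag_of (a \<oplus>\<^bsub>S\<^esub> b, x) - frag_of (a, x) - frag_of (b, x) | a b x.
         a \<in> carrier S \<and> b \<in> carrier S \<and> x \<in> carrier N} \<union>
      {frag_of (a, x \<oplus>\<^bsub>N\<^esub> y) - frag_of (a, x) - frag_of (a, y) | a x y.
         a \<in> carrier S \<and> x \<in> carrier N \<and> y \<in> carrier N} \<union>
      {frag_of (r \<odot>\<^bsub>S\<^esub> a, x) - frag_of (a, r \<odot>\<^bsub>N\<^esub> x) | r a x.
         r \<in> carrier R \<and> a \<in> carrier S \<and> x \<in> carrier N})"

definition tensor_coset ::
  "('r, 'l) ring_scheme \<Rightarrow> ('r, 's, 'm) module_scheme \<Rightarrow> ('r, 'n, 'p) module_scheme \<Rightarrow>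
   ('s \<times> 'n \<Rightarrow>\<^sub>0 int) \<Rightarrow> ('s \<times> 'n \<Rightarrow>\<^sub>0 int) set"
where
  "tensor_coset R S N z =
     tensor_relations R S N #>\<^bsub>free_Abelian_group (carrier S \<times> carrier N)\<^esub> z"

definition pure_tensor ::
  "('r, 'l) ring_scheme \<Rightarrow> ('r, 's, 'm) module_scheme \<Rightarrow> ('r, 'n, 'p) module_scheme \<Rightarrow>
   's \<Rightarrow> 'n \<Rightarrow> ('s \<times> 'n \<Rightarrow>\<^sub>0 int) set"
where
  "pure_tensor R S N a x = tensor_coset R S N (frag_of (a, x))"

text \<open>The endomorphism sending \<open>a \<otimes> x\<close> to \<open>f a \<otimes> g x\<close>; it is well defined whenever \<open>f\<close> and
  \<open>g\<close> are \<open>R\<close>-linear, and then the union below is over equal cosets.\<close>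

definition tensor_map ::
  "('r, 'l) ring_scheme \<Rightarrow> ('r, 's, 'm) module_scheme \<Rightarrow> ('r, 'n, 'p) module_scheme \<Rightarrow>
   ('s \<Rightarrow> 's) \<Rightarrow> ('n \<Rightarrow> 'n) \<Rightarrow> ('s \<times> 'n \<Rightarrow>\<^sub>0 int) set \<Rightarrow> ('s \<times> 'n \<Rightarrow>\<^sub>0 int) set"
where
  "tensor_map R S N f g U =
     (\<Union>z\<in>U. tensor_coset R S N (frag_extend (\<lambda>(a, x). frag_of (f a, g x)) z))"

text \<open>The tensor product as an \<open>S\<close>-module, with \<open>s (a \<otimes> x) = s a \<otimes> x\<close>. The ring
  multiplication fields of the record play no role for modules.\<close>

definition tensor_product ::
  "('r, 'l) ring_scheme \<Rightarrow> ('r, 's, 'm) module_scheme \<Rightarrow> ('r, 'n, 'p) module_scheme \<Rightarrow>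
   ('s, ('s \<times> 'n \<Rightarrow>\<^sub>0 int) set) module"
where
  "tensor_product R S N =
     (let T = free_Abelian_group (carrier S \<times> carrier N) Mod tensor_relations R S N in
      \<lparr>carrier = carrier T, monoid.mult = undefined, one = undefined,
       ring.zero = \<one>\<^bsub>T\<^esub>, ring.add = (\<lambda>U V. U \<otimes>\<^bsub>T\<^esub> V),
       module.smult = (\<lambda>s. tensor_map R S N (\<lambda>a. s \<otimes>\<^bsub>S\<^esub> a) (\<lambda>x. x))\<rparr>)"

definition tensor_grading ::
  "('r, 'l) ring_scheme \<Rightarrow> ('r, 's, 'm) module_scheme \<Rightarrow> (nat \<Rightarrow> 's set) \<Rightarrow>
   ('r, 'n, 'p) module_scheme \<Rightarrow> (nat \<Rightarrow> 'n set) \<Rightarrow> nat \<Rightarrow> ('s \<times> 'n \<Rightarrow>\<^sub>0 int) set set"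
where
  "tensor_grading R S grS N grN n =
     generate (add_monoid (tensor_product R S N))
       {pure_tensor R S N a x | a x i j. a \<in> grS i \<and> x \<in> grN j \<and> i + j = n}"


section \<open>Reflections\<close>

definition prime_height :: "('a, 'm) ring_scheme \<Rightarrow> 'a set \<Rightarrow> enat" where
  "prime_height R P =
     Sup {enat n | n Q. (\<forall>i \<le> n. primeideal (Q i) R) \<and> (\<forall>i < n. Q i \<subset> Q (Suc i)) \<and> Q n = P}"

definition inertia_subgroup ::
  "('a, 'm) ring_scheme \<Rightarrow> ('a \<Rightarrow> 'a) set \<Rightarrow> 'a set \<Rightarrow> ('a \<Rightarrow> 'a) set"
where
  "inertia_subgroup A G P = {\<sigma> \<in> G. \<forall>a \<in> carrier A. \<sigma> a \<ominus>\<^bsub>A\<^esub> a \<in> P}"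

definition reflections :: "('a, 'm) ring_scheme \<Rightarrow> ('a \<Rightarrow> 'a) set \<Rightarrow> ('a \<Rightarrow> 'a) set" where
  "reflections A G =
     {\<sigma>. \<exists>P. primeideal P A \<and> prime_height A P = 1 \<and> \<sigma> \<in> inertia_subgroup A G P}"

definition reflection_subgroup ::
  "('a, 'm) ring_scheme \<Rightarrow> ('a \<Rightarrow> 'a) set \<Rightarrow> ('a \<Rightarrow> 'a) set"
where
  "reflection_subgroup A G = generate (BijGroup (carrier A)) (reflections A G)"


section \<open>Invariants and covariants\<close>

text \<open>The scalar multiplication of the record is the multiplication of \<open>A\<close>, so that it serves
  both as the ring \<open>A\<^sup>H\<close> and as an algebra over any of its subrings.\<close>

definition invariant_ring ::
  "('a, 'm) ring_scheme \<Rightarrow> ('a \<Rightarrow> 'a) set \<Rightarrow> ('a, 'a) module"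
where
  "invariant_ring A H =
     \<lparr>carrier = {a \<in> carrier A. \<forall>\<sigma> \<in> H. \<sigma> a = a},
      monoid.mult = monoid.mult A, one = one A, ring.zero = ring.zero A, ring.add = ring.add A, module.smult = monoid.mult A\<rparr>"

definition invariant_grading ::
  "(nat \<Rightarrow> 'a set) \<Rightarrow> ('a \<Rightarrow> 'a) set \<Rightarrow> nat \<Rightarrow> 'a set"
where
  "invariant_grading gr H n = {a \<in> gr n. \<forall>\<sigma> \<in> H. \<sigma> a = a}"

definition linear_representation ::
  "('k, 'l) ring_scheme \<Rightarrow> ('g, 'h) monoid_scheme \<Rightarrow> ('k, 'm, 'n) module_scheme \<Rightarrow>
   ('g \<Rightarrow> 'm \<Rightarrow> 'm) \<Rightarrow> bool"
where
  "linear_representation k G M \<rho> \<longleftrightarrow>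
     vectorspace k M \<and> group_action G (carrier M) \<rho> \<and>
     (\<forall>\<sigma> \<in> carrier G. \<rho> \<sigma> \<in> module_hom k M M)"

definition covariants ::
  "('k, 'l) ring_scheme \<Rightarrow> ('k, 'a, 'n) module_scheme \<Rightarrow> ('k, 'm, 'p) module_scheme \<Rightarrow>
   (('a \<Rightarrow> 'a) \<Rightarrow> 'm \<Rightarrow> 'm) \<Rightarrow> ('a \<Rightarrow> 'a) set \<Rightarrow> ('a, ('a \<times> 'm \<Rightarrow>\<^sub>0 int) set) module"
where
  "covariants k A M \<rho> H = (tensor_product k A M)
     \<lparr>carrier := {U \<in> carrier (tensor_product k A M). \<forall>\<sigma> \<in> H. tensor_map k A M \<sigma> (\<rho> \<sigma>) U = U}\<rparr>"

text \<open>The module \<open>M\<close> is placed in degree \<open>0\<close>.\<close>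

definition covariant_grading ::
  "('k, 'l) ring_scheme \<Rightarrow> ('k, 'a, 'n) module_scheme \<Rightarrow> (nat \<Rightarrow> 'a set) \<Rightarrow>
   ('k, 'm, 'p) module_scheme \<Rightarrow> (('a \<Rightarrow> 'a) \<Rightarrow> 'm \<Rightarrow> 'm) \<Rightarrow> ('a \<Rightarrow> 'a) set \<Rightarrow>
   nat \<Rightarrow> ('a \<times> 'm \<Rightarrow>\<^sub>0 int) set set"
where
  "covariant_grading k A gr M \<rho> H n =
     carrier (covariants k A M \<rho> H) \<inter> tensor_grading k A gr M (trivial_grading M) n"

end

theory Submission
  imports Defs
begin

text \<open>The modules \<open>A\<^sup>H(M)\<close> all lie in the one torsion-free \<open>A\<close>-module \<open>V = A \<otimes> M\<close>, on which \<open>G\<close>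
  acts semilinearly. The heart of the proof is that an \<open>A\<^sup>G\<close>-basis \<open>B\<close> of \<open>A\<^sup>G(M)\<close> is an
  \<open>A\<^sup>K\<close>-basis of \<open>A\<^sup>K(M)\<close> (\<open>fixed_basis_descends\<close>).

  By the argument of Artin, \<open>B\<close> is linearly independent even over \<open>A\<close> (\<open>independent_over_ring\<close>).
  The question is whether an \<open>\<eta>\<close> in \<open>A\<^sup>K(M)\<close> lies in the \<open>A\<close>-span of \<open>B\<close>; its coefficients are then
  unique, hence \<open>K\<close>-invariant. This is first answered locally. Let \<open>P\<close> be a prime ideal with
  inertia group \<open>I\<close>. For every \<open>g\<close> outside \<open>I\<close> some invariant \<open>b\<close> of \<open>I\<close> satisfies
  \<open>g b - b \<notin> P\<close> (\<open>exists_separating_invariant\<close>): otherwise the polynomial \<open>\<Prod>(X - \<kappa> a)\<close> over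
  \<open>\<kappa> \<in> I\<close>, whose coefficients are invariants of \<open>I\<close>, would show that \<open>g a\<close> is congruent modulo \<open>P\<close> to
  some \<open>\<kappa> a\<close> and thus to \<open>a\<close>. With such elements all terms but one of a relative trace from \<open>I\<close>
  to \<open>G\<close> can be eliminated, and for \<open>\<eta>\<close> fixed by \<open>I\<close> there results some \<open>s \<notin> P\<close> with \<open>s \<eta>\<close> in the
  \<open>A\<close>-span of \<open>A\<^sup>G(M)\<close> (\<open>exists_localized_multiple\<close>).

  This applies to the zero ideal, whose inertia group is trivial, and gives \<open>s\<^sub>0 \<eta> = \<Sum> x\<^sub>v v\<close> with
  \<open>s\<^sub>0 \<noteq> 0\<close>. It also applies to every prime \<open>P\<close> of height one: by definition its inertia group
  consists of reflections, so it is contained in \<open>W \<subseteq> K\<close> and fixes \<open>\<eta>\<close>. Comparing coefficients,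
  \<open>s\<^sub>0\<close> divides each \<open>x\<^sub>v\<close> up to a factor outside \<open>P\<close>. In a Noetherian normal domain
  divisibility can be tested at the primes of height one (\<open>divides_if_locally_divides\<close>), and \<open>A\<close> is
  Noetherian by the basis theorem of Hilbert. So \<open>s\<^sub>0\<close> divides \<open>x\<^sub>v\<close>, and \<open>\<eta>\<close> is in the span of \<open>B\<close>.

  Every element of \<open>A\<^sup>K \<otimes> A\<^sup>G(M)\<close> can be written as \<open>\<Sum> c\<^sub>v \<otimes> v\<close> with \<open>v \<in> B\<close>
  (\<open>tensor_basis_form\<close>), and \<open>\<mu>\<close> sends it to \<open>\<Sum> c\<^sub>v v\<close>; so \<open>\<mu>\<close> is bijective because \<open>B\<close> is a basis of
  \<open>A\<^sup>K(M)\<close>. The gradings of \<open>A\<^sup>H\<close> and \<open>A\<^sup>H(M)\<close> are inherited from \<open>A\<close> and from coordinates on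
  \<open>A \<otimes> M\<close>, and the sum of the homogeneous parts of the tensor product is direct because \<open>\<mu>\<close> is
  injective and respects degrees.\<close>

section \<open>Finitely generated algebras are Noetherian\<close>

text \<open>Coefficients and ambient ring are kept apart: the coefficients run through a subset \<open>C\<close> of \<open>R\<close>, so
  that a chain of subrings of \<open>R\<close> can be treated without forming a new ring for each of them.\<close>

inductive_set lin_span :: "('a, 'm) ring_scheme \<Rightarrow> 'a set \<Rightarrow> 'a set \<Rightarrow> 'a set"
  for R (structure) and C F where
  zero: "\<zero> \<in> lin_span R C F"
| add: "x \<in> lin_span R C F \<Longrightarrow> c \<in> C \<Longrightarrow> f \<in> F \<Longrightarrow> x \<oplus> c \<otimes> f \<in> lin_span R C F"

text \<open>In an ideal of \<open>C\<close> that is not finitely generated one can choose elements successively outside the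
  span of the previous ones. The condition that there is no such sequence is therefore the
  Noetherian property of a subring \<open>C\<close>, in the form in which it is applied below.\<close>

definition noetherian_on :: "('a, 'm) ring_scheme \<Rightarrow> 'a set \<Rightarrow> bool" where
  "noetherian_on R C \<longleftrightarrow>
     (\<forall>f :: nat \<Rightarrow> 'a. (\<forall>n. f n \<in> C) \<longrightarrow> (\<exists>m. f m \<in> lin_span R C (f ` {..<m})))"

lemma lin_span_mono: "F \<subseteq> F' \<Longrightarrow> x \<in> lin_span R C F \<Longrightarrow> x \<in> lin_span R C F'"
  by (erule lin_span.induct) (auto intro: lin_span.intros)

context cring
begin

lemma lin_span_closed:
  assumes "C \<subseteq> carrier R" "F \<subseteq> carrier R" "x \<in> lin_span R C F"
  shows "x \<in> carrier R"
  using assms(3) by induction (use assms(1,2) in auto)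

lemma lin_span_incl:
  assumes "subring C R" "F \<subseteq> carrier R" "x \<in> F"
  shows "x \<in> lin_span R C F"
proof -
  have "\<zero> \<oplus> \<one> \<otimes> x \<in> lin_span R C F"
    using assms subringE(3)[OF assms(1)] by (intro lin_span.intros) auto
  then show ?thesis using assms by (auto simp: subset_iff)
qed

lemma lin_span_add:
  assumes C: "C \<subseteq> carrier R" and F: "F \<subseteq> carrier R"
    and x: "x \<in> lin_span R C F" and y: "y \<in> lin_span R C F"
  shows "x \<oplus> y \<in> lin_span R C F"
  using y
proof induction
  case zero
  then show ?case using lin_span_closed[OF C F x] x by simp
next
  case (add z c f)
  have "x \<oplus> (z \<oplus> c \<otimes> f) = (x \<oplus> z) \<oplus> c \<otimes> f"
    using add C F lin_span_closed[OF C F] x by (subst a_assoc) auto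
  then show ?case using add by (auto intro: lin_span.add)
qed

lemma lin_span_smult:
  assumes C: "subring C R" and F: "F \<subseteq> carrier R"
    and d: "d \<in> C" and y: "y \<in> lin_span R C F"
  shows "d \<otimes> y \<in> lin_span R C F"
  using y
proof induction
  case zero
  then show ?case using d subringE(1)[OF C] lin_span.zero by (auto simp: subset_iff)
next
  case (add z c f)
  have car: "C \<subseteq> carrier R" using subringE(1)[OF C] .
  have "d \<in> carrier R" "z \<in> carrier R" "c \<in> carrier R" "f \<in> carrier R"
    using add d car F lin_span_closed[OF car F] by auto
  then have "d \<otimes> (z \<oplus> c \<otimes> f) = d \<otimes> z \<oplus> (d \<otimes> c) \<otimes> f"
    by algebra
  moreover have "d \<otimes> c \<in> C" using subringE(6)[OF C] d add by auto
  ultimately show ?case using add by (auto intro: lin_span.add)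
qed

lemma lin_span_least:
  assumes C: "subring C R" and F: "F \<subseteq> carrier R" "F' \<subseteq> lin_span R C F"
    and x: "x \<in> lin_span R C F'"
  shows "x \<in> lin_span R C F"
  using x
proof induction
  case zero
  then show ?case by (rule lin_span.zero)
next
  case (add z c f)
  then show ?case
    using lin_span_add[OF subringE(1)[OF C] F(1)] lin_span_smult[OF C F(1)] F(2) by blast
qed

lemma lin_span_minus:
  assumes C: "subring C R" and F: "F \<subseteq> carrier R"
    and x: "x \<in> lin_span R C F" and y: "y \<in> lin_span R C F"
  shows "x \<ominus> y \<in> lin_span R C F"
proof -
  have car: "C \<subseteq> carrier R" using subringE(1)[OF C] .
  have "\<ominus> \<one> \<in> C" using subringE(3,5)[OF C] by auto
  then have "(\<ominus> \<one>) \<otimes> y \<in> lin_span R C F" by (rule lin_span_smult[OF C F _ y])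
  then have "x \<oplus> (\<ominus> \<one>) \<otimes> y \<in> lin_span R C F" by (rule lin_span_add[OF car F x])
  moreover have "x \<oplus> (\<ominus> \<one>) \<otimes> y = x \<ominus> y"
    using lin_span_closed[OF car F] x y by algebra
  ultimately show ?thesis by simp
qed

text \<open>Values at \<open>x\<close> of the polynomials over \<open>C\<close> of degree less than \<open>d\<close>. The generator \<open>x\<close> may be
  algebraic over \<open>C\<close>, so an element can have many such expressions and its degree is the least
  possible one.\<close>

primrec low_degree :: "'a set \<Rightarrow> 'a \<Rightarrow> nat \<Rightarrow> 'a set" where
  "low_degree C x 0 = {\<zero>}"
| "low_degree C x (Suc d) = {p \<oplus> c \<otimes> x [^] d | p c. p \<in> low_degree C x d \<and> c \<in> C}"

context
  fixes C x assumes C: "subring C R" and x: "x \<in> carrier R"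
begin

lemma Cc: "c \<in> C \<Longrightarrow> c \<in> carrier R"
  using subringE(1)[OF C] by auto

lemma low_degree_closed: "p \<in> low_degree C x d \<Longrightarrow> p \<in> carrier R"
  by (induction d arbitrary: p) (use Cc x in auto)

lemma low_degree_Suc: "p \<in> low_degree C x d \<Longrightarrow> p \<in> low_degree C x (Suc d)"
proof -
  assume p: "p \<in> low_degree C x d"
  have "p = p \<oplus> \<zero> \<otimes> x [^] d" using low_degree_closed[OF p] x by simp
  then show ?thesis using p subringE(2)[OF C] by auto
qed

lemma low_degree_mono: "d \<le> e \<Longrightarrow> p \<in> low_degree C x d \<Longrightarrow> p \<in> low_degree C x e"
  by (induction rule: dec_induct) (use low_degree_Suc in blast)+

lemma low_degree_add:
  "p \<in> low_degree C x d \<Longrightarrow> q \<in> low_degree C x d \<Longrightarrow> p \<oplus> q \<in> low_degree C x d"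
proof (induction d arbitrary: p q)
  case (Suc d)
  then obtain p' c q' e where *: "p = p' \<oplus> c \<otimes> x [^] d" "p' \<in> low_degree C x d" "c \<in> C"
    "q = q' \<oplus> e \<otimes> x [^] d" "q' \<in> low_degree C x d" "e \<in> C"
    by auto
  have car: "p' \<in> carrier R" "q' \<in> carrier R" "c \<in> carrier R" "e \<in> carrier R" "x [^] d \<in> carrier R"
    using * low_degree_closed Cc x by auto
  have "p \<oplus> q = (p' \<oplus> q') \<oplus> (c \<oplus> e) \<otimes> x [^] d"
    unfolding * using car by algebra
  moreover have "c \<oplus> e \<in> C" using * subringE(7)[OF C] by auto
  ultimately show ?case using Suc.IH[OF *(2,5)] by auto
qed simp

lemma low_degree_smult: "e \<in> C \<Longrightarrow> p \<in> low_degree C x d \<Longrightarrow> e \<otimes> p \<in> low_degree C x d"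
proof (induction d arbitrary: p)
  case (Suc d)
  then obtain p' c where *: "p = p' \<oplus> c \<otimes> x [^] d" "p' \<in> low_degree C x d" "c \<in> C"
    by auto
  have car: "p' \<in> carrier R" "c \<in> carrier R" "e \<in> carrier R" "x [^] d \<in> carrier R"
    using * Suc.prems low_degree_closed Cc x by auto
  have "e \<otimes> p = e \<otimes> p' \<oplus> (e \<otimes> c) \<otimes> x [^] d"
    unfolding * using car by algebra
  moreover have "e \<otimes> c \<in> C" using * Suc.prems subringE(6)[OF C] by auto
  ultimately show ?case using Suc.IH[OF _ *(2)] Suc.prems by auto
qed (use Cc in auto)

lemma low_degree_shift: "p \<in> low_degree C x d \<Longrightarrow> x [^] j \<otimes> p \<in> low_degree C x (j + d)"
proof (induction d arbitrary: p)
  case 0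
  have "\<zero> \<in> low_degree C x j" by (rule low_degree_mono[of 0]) auto
  then show ?case using 0 x by auto
next
  case (Suc d)
  then obtain p' c where *: "p = p' \<oplus> c \<otimes> x [^] d" "p' \<in> low_degree C x d" "c \<in> C"
    by auto
  have car: "p' \<in> carrier R" "c \<in> carrier R" "x [^] d \<in> carrier R" "x [^] j \<in> carrier R"
    using * low_degree_closed Cc x by auto
  have "x [^] j \<otimes> p = x [^] j \<otimes> p' \<oplus> c \<otimes> (x [^] j \<otimes> x [^] d)"
    unfolding * using car by algebra
  also have "x [^] j \<otimes> x [^] d = x [^] (j + d)" using x by (simp add: nat_pow_mult)
  finally show ?case using Suc.IH[OF *(2)] * by auto
qed

definition adjoin :: "'a set" where "adjoin = (\<Union>d. low_degree C x d)"

lemma adjoin_closed: "p \<in> adjoin \<Longrightarrow> p \<in> carrier R"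
  unfolding adjoin_def using low_degree_closed by auto

lemma adjoin_obtain_common:
  assumes "p \<in> adjoin" "q \<in> adjoin"
  obtains d where "p \<in> low_degree C x d" "q \<in> low_degree C x d"
proof -
  obtain d e where "p \<in> low_degree C x d" "q \<in> low_degree C x e"
    using assms unfolding adjoin_def by auto
  then show thesis using low_degree_mono[of d "max d e"] low_degree_mono[of e "max d e"] that by auto
qed

lemma adjoin_add: "p \<in> adjoin \<Longrightarrow> q \<in> adjoin \<Longrightarrow> p \<oplus> q \<in> adjoin"
  by (erule (1) adjoin_obtain_common) (auto simp: adjoin_def intro: low_degree_add)

lemma adjoin_smult: "c \<in> C \<Longrightarrow> p \<in> adjoin \<Longrightarrow> c \<otimes> p \<in> adjoin"
  unfolding adjoin_def using low_degree_smult by auto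

lemma adjoin_shift: "p \<in> adjoin \<Longrightarrow> x [^] (j::nat) \<otimes> p \<in> adjoin"
  unfolding adjoin_def using low_degree_shift by blast

lemma coeff_in_adjoin: "c \<in> C \<Longrightarrow> c \<in> adjoin"
proof -
  assume c: "c \<in> C"
  have "c = \<zero> \<oplus> c \<otimes> x [^] (0::nat)" using c Cc by simp
  then have "c \<in> low_degree C x (Suc 0)" using c by auto
  then show ?thesis unfolding adjoin_def by blast
qed

lemma adjoin_mult: "p \<in> adjoin \<Longrightarrow> q \<in> adjoin \<Longrightarrow> p \<otimes> q \<in> adjoin"
proof -
  assume p: "p \<in> adjoin" and q: "q \<in> adjoin"
  obtain d where "p \<in> low_degree C x d" using p unfolding adjoin_def by auto
  then show ?thesis
  proof (induction d arbitrary: p)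
    case 0
    then show ?case using q adjoin_closed coeff_in_adjoin subringE(2)[OF C] by auto
  next
    case (Suc d)
    then obtain p' c where *: "p = p' \<oplus> c \<otimes> x [^] d" "p' \<in> low_degree C x d" "c \<in> C"
      by auto
    have car: "p' \<in> carrier R" "c \<in> carrier R" "x [^] d \<in> carrier R" "q \<in> carrier R"
      using * low_degree_closed Cc x adjoin_closed q by auto
    have "p \<otimes> q = p' \<otimes> q \<oplus> c \<otimes> (x [^] d \<otimes> q)"
      unfolding * using car by algebra
    then show ?case
      using adjoin_add[OF Suc.IH[OF *(2)] adjoin_smult[OF *(3) adjoin_shift[OF q]]] by simp
  qed
qed

lemma gen_in_adjoin: "x \<in> adjoin"
proof -
  have "x [^] (1::nat) \<otimes> \<one> \<in> adjoin"
    using adjoin_shift coeff_in_adjoin subringE(3)[OF C] by blast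
  then show ?thesis using x by simp
qed

lemma adjoin_subring: "subring adjoin R"
proof (rule subringI)
  show "adjoin \<subseteq> carrier R" using adjoin_closed by auto
  show "\<one> \<in> adjoin" using coeff_in_adjoin subringE(3)[OF C] by blast
  show "\<ominus> h \<in> adjoin" if "h \<in> adjoin" for h
  proof -
    have "(\<ominus> \<one>) \<otimes> h \<in> adjoin" using adjoin_smult that subringE(3,5)[OF C] by blast
    moreover have "(\<ominus> \<one>) \<otimes> h = \<ominus> h" using adjoin_closed[OF that] by algebra
    ultimately show ?thesis by simp
  qed
qed (use adjoin_mult adjoin_add in auto)

text \<open>Hilbert's argument. From an ideal that is not finitely generated one chooses \<open>g 0, g 1, \<dots>\<close>, each
  of least degree among the elements of the ideal outside the span of its predecessors. Some
  leading coefficient \<open>a m\<close> is a combination of the earlier ones; the corresponding combination of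
  the \<open>g i\<close>, multiplied by suitable powers of \<open>x\<close>, cancels the leading term of \<open>g m\<close> and leaves an
  element of smaller degree that is still outside the span.\<close>

theorem noetherian_on_adjoin:
  assumes N: "noetherian_on R C"
  shows "noetherian_on R adjoin"
proof (rule ccontr)
  assume "\<not> noetherian_on R adjoin"
  then obtain f :: "nat \<Rightarrow> 'a" where fD: "\<And>n. f n \<in> adjoin"
    and f: "\<And>m. f m \<notin> lin_span R adjoin (f ` {..<m})"
    unfolding noetherian_on_def by auto
  let ?S = "lin_span R adjoin"
  note D = adjoin_subring
  have Dc: "adjoin \<subseteq> carrier R" using subringE(1)[OF D] .
  have fc: "f ` J \<subseteq> carrier R" for J :: "nat set" using fD adjoin_closed by auto
  define I where "I = (\<Union>m. ?S (f ` {..<m}))"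
  have Icar: "y \<in> carrier R" if "y \<in> I" for y
    using that lin_span_closed[OF Dc fc] unfolding I_def by auto
  have I_D: "y \<in> adjoin" if "y \<in> I" for y
  proof -
    obtain m where "y \<in> ?S (f ` {..<m})" using \<open>y \<in> I\<close> unfolding I_def by auto
    then show ?thesis
      by induction (use subringE(2)[OF D] adjoin_add adjoin_mult fD in auto)
  qed
  have I_common: "\<exists>m. Y \<subseteq> ?S (f ` {..<m})" if "finite Y" "Y \<subseteq> I" for Y
    using that
  proof induction
    case (insert y Y)
    then obtain m n where m: "Y \<subseteq> ?S (f ` {..<m})" "y \<in> ?S (f ` {..<n})"
      unfolding I_def by auto
    have "f ` {..<m} \<subseteq> f ` {..<max m n}" "f ` {..<n} \<subseteq> f ` {..<max m n}" by auto
    then have "insert y Y \<subseteq> ?S (f ` {..<max m n})"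
      using m lin_span_mono by (metis insert_subset subset_iff)
    then show ?case by blast
  qed auto
  have I_span: "y \<in> I" if "y \<in> ?S Y" "finite Y" "Y \<subseteq> I" for y Y
    using I_common[OF that(2,3)] lin_span_least[OF D fc _ that(1)] unfolding I_def by auto
  have f_I: "f n \<in> I" for n
    using lin_span_incl[OF D fc, of "f n" "{..<Suc n}"] unfolding I_def by auto
  have not_fg: "\<exists>y. y \<in> I \<and> y \<notin> ?S Y" if Y: "finite Y" "Y \<subseteq> I" for Y
  proof -
    obtain m where "Y \<subseteq> ?S (f ` {..<m})" using I_common[OF Y] by auto
    then have "f m \<notin> ?S Y" using lin_span_least[OF D fc] f by blast
    then show ?thesis using f_I by auto
  qed
  \<comment> \<open>the number of coefficients, that is the degree plus one, so that zero has \<open>deg = 0\<close>\<close>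
  define deg where "deg y = (LEAST d. y \<in> low_degree C x d)" for y
  have deg: "y \<in> low_degree C x (deg y)" if "y \<in> adjoin" for y
    using that unfolding adjoin_def deg_def by (auto intro: LeastI)
  have deg_le: "deg y \<le> d" if "y \<in> low_degree C x d" for y d
    using that unfolding deg_def by (rule Least_le)
  define best where "best h n r \<longleftrightarrow> r \<in> I \<and> r \<notin> ?S (h ` {..<n}) \<and>
      (\<forall>y. y \<in> I \<and> y \<notin> ?S (h ` {..<n}) \<longrightarrow> deg r \<le> deg y)" for h :: "nat \<Rightarrow> 'a" and n r
  have "\<exists>g. \<forall>n :: nat. best g n (g n)"
  proof (rule dependent_wellorder_choice[where P = best])
    fix r and h h' :: "nat \<Rightarrow> 'a" and n :: nat assume "\<And>y. y < n \<Longrightarrow> h y = h' y"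
    then have "h ` {..<n} = h' ` {..<n}" by auto
    then show "best h n r = best h' n r" unfolding best_def by simp
  next
    fix n :: nat and h assume h: "\<And>y. y < n \<Longrightarrow> best h y (h y)"
    let ?Q = "\<lambda>y. y \<in> I \<and> y \<notin> ?S (h ` {..<n})"
    obtain y where y: "?Q y"
    proof -
      have "finite (h ` {..<n})" "h ` {..<n} \<subseteq> I" using h unfolding best_def by auto
      then show thesis using not_fg that by meson
    qed
    have "?Q (arg_min deg ?Q) \<and> (\<forall>y. ?Q y \<longrightarrow> deg (arg_min deg ?Q) \<le> deg y)"
      using arg_min_nat_lemma[of ?Q, OF y] .
    then show "\<exists>r. best h n r" unfolding best_def by blast
  qed
  then obtain g :: "nat \<Rightarrow> 'a" where best_g: "best g n (g n)" for n by blast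
  have g: "g n \<in> I" "g n \<notin> ?S (g ` {..<n})"
    "y \<in> I \<Longrightarrow> y \<notin> ?S (g ` {..<n}) \<Longrightarrow> deg (g n) \<le> deg y" for n y
    using best_g[of n] unfolding best_def by simp_all
  have gc: "g ` J \<subseteq> carrier R" for J :: "nat set" using g(1) Icar by auto
  have deg_mono: "deg (g i) \<le> deg (g n)" if "i \<le> n" for i n
  proof (rule g(3)[OF g(1)])
    have "g ` {..<i} \<subseteq> g ` {..<n}" using that by auto
    then show "g n \<notin> ?S (g ` {..<i})" using g(2) lin_span_mono by metis
  qed
  have "\<exists>e p a. deg (g n) = Suc e \<and> p \<in> low_degree C x e \<and> a \<in> C \<and> g n = p \<oplus> a \<otimes> x [^] e" for n
  proof (cases "deg (g n)")
    case 0
    then have "g n = \<zero>" using deg[OF I_D[OF g(1)[of n]]] by simp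
    then show ?thesis using g(2)[of n] lin_span.zero[of R adjoin] by simp
  next
    case (Suc e)
    then show ?thesis using deg[OF I_D[OF g(1)[of n]]] by auto
  qed
  then obtain e p a where epa: "\<And>n. deg (g n) = Suc (e n)" "\<And>n. p n \<in> low_degree C x (e n)"
    "\<And>n. a n \<in> C" "\<And>n. g n = p n \<oplus> a n \<otimes> x [^] e n"
    by metis
  obtain m where m: "a m \<in> lin_span R C (a ` {..<m})"
    using N epa(3) unfolding noetherian_on_def by blast
  \<comment> \<open>every combination of the earlier leading coefficients is the leading coefficient of a
    combination of the earlier \<open>g i\<close>\<close>
  have "\<exists>h \<in> ?S (g ` {..<m}). h \<ominus> z \<otimes> x [^] e m \<in> low_degree C x (e m)"
    if "z \<in> lin_span R C (a ` {..<m})" for z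
    using that
  proof induction
    case zero
    have "\<zero> \<ominus> \<zero> \<otimes> x [^] e m = \<zero>" using x by (simp add: minus_eq)
    moreover have "\<zero> \<in> low_degree C x (e m)" by (rule low_degree_mono[of 0]) auto
    ultimately show ?case using lin_span.zero[of R adjoin] by metis
  next
    case (add z c b)
    then obtain h i where h: "h \<in> ?S (g ` {..<m})" "h \<ominus> z \<otimes> x [^] e m \<in> low_degree C x (e m)"
      and i: "i < m" "b = a i" by auto
    have le: "e i \<le> e m" using deg_mono[of i m] i epa(1) by simp
    let ?j = "e m - e i"
    have car1: "h \<in> carrier R" using lin_span_closed[OF Dc gc h(1)] .
    have "a ` {..<m} \<subseteq> carrier R" using epa(3) Cc by auto
    then have car2: "z \<in> carrier R"
      using lin_span_closed[of C "a ` {..<m}" z] add.hyps(1) subringE(1)[OF C] by auto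
    have car3: "c \<in> carrier R" "a i \<in> carrier R" "p i \<in> carrier R" "x [^] e i \<in> carrier R"
      "x [^] ?j \<in> carrier R" "x [^] e m \<in> carrier R" "g i \<in> carrier R"
      using add.hyps epa(2,3) low_degree_closed Cc x gc[of UNIV] by auto
    have xm: "x [^] e m = x [^] ?j \<otimes> x [^] e i" using x le by (simp add: nat_pow_mult)
    have cxD: "c \<otimes> x [^] ?j \<in> adjoin"
    proof -
      have "c \<otimes> (x [^] ?j \<otimes> \<one>) \<in> adjoin"
        using adjoin_smult[OF add.hyps(2)] adjoin_shift coeff_in_adjoin subringE(3)[OF C] by blast
      then show ?thesis using x car3 by simp
    qed
    let ?h = "h \<oplus> (c \<otimes> x [^] ?j) \<otimes> g i"
    have "?h \<in> ?S (g ` {..<m})" using h(1) cxD i by (intro lin_span.add) auto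
    moreover have "?h \<ominus> (z \<oplus> c \<otimes> b) \<otimes> x [^] e m
        = (h \<ominus> z \<otimes> x [^] e m) \<oplus> c \<otimes> (x [^] ?j \<otimes> p i)"
      unfolding i xm epa(4)[of i] using car1 car2 car3 by algebra
    moreover have "c \<otimes> (x [^] ?j \<otimes> p i) \<in> low_degree C x (e m)"
      using low_degree_smult[OF add.hyps(2) low_degree_shift[OF epa(2)[of i], of ?j]] le by simp
    ultimately show ?case using low_degree_add[OF h(2)] by metis
  qed
  then obtain h where h: "h \<in> ?S (g ` {..<m})" "h \<ominus> a m \<otimes> x [^] e m \<in> low_degree C x (e m)"
    using m by blast
  have car1: "h \<in> carrier R" using lin_span_closed[OF Dc gc h(1)] .
  have car3: "a m \<in> carrier R" "p m \<in> carrier R" "x [^] e m \<in> carrier R" "g m \<in> carrier R"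
    using epa(2,3) low_degree_closed Cc x gc[of UNIV] by auto
  have "p m \<oplus> (\<ominus> \<one>) \<otimes> (h \<ominus> a m \<otimes> x [^] e m) \<in> low_degree C x (e m)"
    using low_degree_add[OF epa(2) low_degree_smult[OF _ h(2)]] subringE(3,5)[OF C] by blast
  moreover have "p m \<oplus> (\<ominus> \<one>) \<otimes> (h \<ominus> a m \<otimes> x [^] e m) = g m \<ominus> h"
    unfolding epa(4)[of m] using car1 car3(1-3) by algebra
  ultimately have small: "g m \<ominus> h \<in> low_degree C x (e m)" by simp
  have h_I: "h \<in> I" using I_span[OF h(1)] g(1) by auto
  have "g m \<ominus> h \<in> I"
  proof -
    have "g m \<in> ?S {g m, h}" "h \<in> ?S {g m, h}" using car1 car3 by (auto intro!: lin_span_incl[OF D])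
    then have "g m \<ominus> h \<in> ?S {g m, h}" using car1 car3 by (intro lin_span_minus[OF D]) auto
    then show ?thesis using I_span[of "g m \<ominus> h" "{g m, h}"] g(1) h_I by auto
  qed
  moreover have "g m \<ominus> h \<notin> ?S (g ` {..<m})"
  proof
    assume "g m \<ominus> h \<in> ?S (g ` {..<m})"
    then have "(g m \<ominus> h) \<oplus> h \<in> ?S (g ` {..<m})" using h(1) by (rule lin_span_add[OF Dc gc])
    moreover have "(g m \<ominus> h) \<oplus> h = g m"
      using \<open>h \<in> carrier R\<close> \<open>g m \<in> carrier R\<close> by algebra
    ultimately show False using g(2) by simp
  qed
  ultimately have "deg (g m) \<le> deg (g m \<ominus> h)" by (rule g(3))
  also have "\<dots> \<le> e m" using small by (rule deg_le)
  finally show False using epa(1)[of m] by simp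
qed

end

text \<open>The generators are adjoined one at a time. A subring that contains \<open>C\<close> and the generators is all of
  the ring when they generate it.\<close>

theorem noetherian_on_generate_ring:
  assumes C: "subring C R" "noetherian_on R C" and S: "finite S" "S \<subseteq> carrier R"
  shows "\<exists>D. subring D R \<and> noetherian_on R D \<and> C \<union> S \<subseteq> D"
  using S
proof induction
  case empty
  then show ?case using C by auto
next
  case (insert s S)
  then obtain D where D: "subring D R" "noetherian_on R D" "C \<union> S \<subseteq> D" by auto
  have s: "s \<in> carrier R" using insert by auto
  show ?case
    using adjoin_subring[OF D(1) s] noetherian_on_adjoin[OF D(1) s D(2)] D(3)
      coeff_in_adjoin[OF D(1) s] gen_in_adjoin[OF D(1) s] by blast
qed

text \<open>In a field a single nonzero element already spans everything, so a sequence fails to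
  be independent at its second term at the latest.\<close>

lemma noetherian_on_field:
  assumes C: "subring C R" and inv: "\<And>c. c \<in> C \<Longrightarrow> c \<noteq> \<zero> \<Longrightarrow> \<exists>d \<in> C. d \<otimes> c = \<one>"
  shows "noetherian_on R C"
  unfolding noetherian_on_def
proof safe
  fix f :: "nat \<Rightarrow> 'a" assume f: "\<forall>n. f n \<in> C"
  have car: "C \<subseteq> carrier R" using subringE(1)[OF C] .
  show "\<exists>m. f m \<in> lin_span R C (f ` {..<m})"
  proof (cases "f 0 = \<zero>")
    case True
    then show ?thesis using lin_span.zero by metis
  next
    case False
    then obtain d where d: "d \<in> C" "d \<otimes> f 0 = \<one>" using inv f by blast
    have "\<zero> \<oplus> (f 1 \<otimes> d) \<otimes> f 0 \<in> lin_span R C (f ` {..<1})"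
      using d f subringE(6)[OF C] by (intro lin_span.intros) auto
    moreover have "f 0 \<in> carrier R" "f 1 \<in> carrier R" "d \<in> carrier R" using d f car by auto
    then have "\<zero> \<oplus> (f 1 \<otimes> d) \<otimes> f 0 = f 1" by (simp add: m_assoc d)
    ultimately show ?thesis by metis
  qed
qed

end

section \<open>Divisibility in a Noetherian normal domain\<close>

text \<open>The operations of the quotient field are unions over all pairs of representatives. Such a union
  collapses as soon as the result does not depend on the representatives.\<close>

lemma UN_UN_constant:
  assumes "(a0, b0) \<in> U" "(c0, d0) \<in> V"
    "\<And>a b c d. (a, b) \<in> U \<Longrightarrow> (c, d) \<in> V \<Longrightarrow> F a b c d = Z"
  shows "(\<Union>(a, b)\<in>U. \<Union>(c, d)\<in>V. F a b c d) = Z"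
  using assms by fast

context domain
begin

lemma mem_fraction:
  "(c, d) \<in> fraction R a b \<longleftrightarrow> c \<in> carrier R \<and> d \<in> carrier R \<and> d \<noteq> \<zero> \<and> a \<otimes> d = c \<otimes> b"
  unfolding fraction_def by auto

lemma cross_mult_trans:
  assumes "a \<in> carrier R" "b \<in> carrier R" "c \<in> carrier R" "d \<in> carrier R" "e \<in> carrier R"
    "f \<in> carrier R" "d \<noteq> \<zero>" "a \<otimes> d = c \<otimes> b" "c \<otimes> f = e \<otimes> d"
  shows "a \<otimes> f = e \<otimes> b"
proof -
  have "d \<otimes> (a \<otimes> f) = (a \<otimes> d) \<otimes> f" using assms(1-6) by algebra
  also have "\<dots> = (c \<otimes> f) \<otimes> b" unfolding assms(8) using assms(1-6) by algebra
  also have "\<dots> = d \<otimes> (e \<otimes> b)" unfolding assms(9) using assms(1-6) by algebra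
  finally show ?thesis using assms(1-7) m_lcancel[of d] by simp
qed

lemma fraction_eq_iff:
  assumes "a \<in> carrier R" "b \<in> carrier R" "b \<noteq> \<zero>" "c \<in> carrier R" "d \<in> carrier R" "d \<noteq> \<zero>"
  shows "fraction R a b = fraction R c d \<longleftrightarrow> a \<otimes> d = c \<otimes> b"
proof
  assume "fraction R a b = fraction R c d"
  moreover have "(c, d) \<in> fraction R c d" using assms by (simp add: mem_fraction)
  ultimately show "a \<otimes> d = c \<otimes> b" using assms by (metis mem_fraction)
next
  assume eq: "a \<otimes> d = c \<otimes> b"
  have "x \<in> carrier R \<Longrightarrow> y \<in> carrier R \<Longrightarrow> a \<otimes> y = x \<otimes> b \<longleftrightarrow> c \<otimes> y = x \<otimes> d" for x y
    using cross_mult_trans[OF assms(4,5,1,2) _ _ assms(3) eq[symmetric], of x y]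
      cross_mult_trans[OF assms(1,2,4,5) _ _ assms(6) eq, of x y] by blast
  then have "(x, y) \<in> fraction R a b \<longleftrightarrow> (x, y) \<in> fraction R c d" for x y
    unfolding mem_fraction by blast
  then show "fraction R a b = fraction R c d" by auto
qed

lemma fraction_mult:
  assumes "a \<in> carrier R" "b \<in> carrier R" "b \<noteq> \<zero>" "c \<in> carrier R" "d \<in> carrier R" "d \<noteq> \<zero>"
  shows "fraction R a b \<otimes>\<^bsub>quotient_field R\<^esub> fraction R c d = fraction R (a \<otimes> c) (b \<otimes> d)"
proof -
  have *: "fraction R (a' \<otimes> c') (b' \<otimes> d') = fraction R (a \<otimes> c) (b \<otimes> d)"
    if h: "(a', b') \<in> fraction R a b" "(c', d') \<in> fraction R c d" for a' b' c' d'
  proof -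
    have c: "a' \<in> carrier R" "b' \<in> carrier R" "c' \<in> carrier R" "d' \<in> carrier R"
      and n: "b' \<noteq> \<zero>" "d' \<noteq> \<zero>" and e: "a \<otimes> b' = a' \<otimes> b" "c \<otimes> d' = c' \<otimes> d"
      using h by (auto simp: mem_fraction)
    have "(a' \<otimes> c') \<otimes> (b \<otimes> d) = (a' \<otimes> b) \<otimes> (c' \<otimes> d)" using c assms(1,2,4,5) by algebra
    also have "\<dots> = (a \<otimes> c) \<otimes> (b' \<otimes> d')" unfolding e[symmetric] using c assms(1,2,4,5) by algebra
    finally have eq: "(a' \<otimes> c') \<otimes> (b \<otimes> d) = (a \<otimes> c) \<otimes> (b' \<otimes> d')" .
    have nz: "b' \<otimes> d' \<noteq> \<zero>" "b \<otimes> d \<noteq> \<zero>" using c n assms by (simp_all add: integral_iff)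
    show ?thesis
      by (subst fraction_eq_iff) (intro m_closed a_closed c assms(1,2,4,5) nz eq)+
  qed
  have mem: "(a, b) \<in> fraction R a b" "(c, d) \<in> fraction R c d"
    using assms by (simp_all add: mem_fraction)
  show ?thesis unfolding quotient_field_def monoid.select_convs ring.select_convs
  proof (rule UN_UN_constant)
    show "(a, b) \<in> fraction R a b" "(c, d) \<in> fraction R c d" by (fact mem)+
    fix a' b' c' d' assume "(a', b') \<in> fraction R a b" "(c', d') \<in> fraction R c d"
    then show "fraction R (a' \<otimes> c') (b' \<otimes> d') = fraction R (a \<otimes> c) (b \<otimes> d)" by (fact *)
  qed
qed

lemma fraction_add:
  assumes "a \<in> carrier R" "b \<in> carrier R" "b \<noteq> \<zero>" "c \<in> carrier R" "d \<in> carrier R" "d \<noteq> \<zero>"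
  shows "fraction R a b \<oplus>\<^bsub>quotient_field R\<^esub> fraction R c d
    = fraction R (a \<otimes> d \<oplus> c \<otimes> b) (b \<otimes> d)"
proof -
  have *: "fraction R (a' \<otimes> d' \<oplus> c' \<otimes> b') (b' \<otimes> d') = fraction R (a \<otimes> d \<oplus> c \<otimes> b) (b \<otimes> d)"
    if h: "(a', b') \<in> fraction R a b" "(c', d') \<in> fraction R c d" for a' b' c' d'
  proof -
    have c: "a' \<in> carrier R" "b' \<in> carrier R" "c' \<in> carrier R" "d' \<in> carrier R"
      and n: "b' \<noteq> \<zero>" "d' \<noteq> \<zero>" and e: "a \<otimes> b' = a' \<otimes> b" "c \<otimes> d' = c' \<otimes> d"
      using h by (auto simp: mem_fraction)
    have "(a' \<otimes> d' \<oplus> c' \<otimes> b') \<otimes> (b \<otimes> d) = (a' \<otimes> b) \<otimes> (d \<otimes> d') \<oplus> (c' \<otimes> d) \<otimes> (b \<otimes> b')"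
      using c assms(1,2,4,5) by algebra
    also have "\<dots> = (a \<otimes> d \<oplus> c \<otimes> b) \<otimes> (b' \<otimes> d')"
      unfolding e[symmetric] using c assms(1,2,4,5) by algebra
    finally have eq: "(a' \<otimes> d' \<oplus> c' \<otimes> b') \<otimes> (b \<otimes> d) = (a \<otimes> d \<oplus> c \<otimes> b) \<otimes> (b' \<otimes> d')" .
    have nz: "b' \<otimes> d' \<noteq> \<zero>" "b \<otimes> d \<noteq> \<zero>" using c n assms by (simp_all add: integral_iff)
    show ?thesis
      by (subst fraction_eq_iff) (intro m_closed a_closed c assms(1,2,4,5) nz eq)+
  qed
  have mem: "(a, b) \<in> fraction R a b" "(c, d) \<in> fraction R c d"
    using assms by (simp_all add: mem_fraction)
  show ?thesis unfolding quotient_field_def monoid.select_convs ring.select_convs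
  proof (rule UN_UN_constant)
    show "(a, b) \<in> fraction R a b" "(c, d) \<in> fraction R c d" by (fact mem)+
    fix a' b' c' d' assume "(a', b') \<in> fraction R a b" "(c', d') \<in> fraction R c d"
    then show "fraction R (a' \<otimes> d' \<oplus> c' \<otimes> b') (b' \<otimes> d') = fraction R (a \<otimes> d \<oplus> c \<otimes> b) (b \<otimes> d)"
      by (fact *)
  qed
qed

lemma fraction_in_quotient_field:
  "a \<in> carrier R \<Longrightarrow> b \<in> carrier R \<Longrightarrow> b \<noteq> \<zero> \<Longrightarrow> fraction R a b \<in> carrier (quotient_field R)"
  unfolding quotient_field_def by auto

lemma quotient_fieldE:
  assumes "x \<in> carrier (quotient_field R)"
  obtains a b where "x = fraction R a b" "a \<in> carrier R" "b \<in> carrier R" "b \<noteq> \<zero>"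
  using assms unfolding quotient_field_def by auto

lemma quotient_field_consts:
  "\<zero>\<^bsub>quotient_field R\<^esub> = fraction R \<zero> \<one>" "\<one>\<^bsub>quotient_field R\<^esub> = fraction R \<one> \<one>"
  unfolding quotient_field_def by auto

text \<open>Evaluating a polynomial at a fraction is arithmetic in the quotient field and rests on its ring
  laws.\<close>

lemma quotient_field_cring: "cring (quotient_field R)"
proof (rule cringI)
  note simps = fraction_mult fraction_add fraction_in_quotient_field integral_iff
    fraction_eq_iff quotient_field_consts
  show "abelian_group (quotient_field R)"
  proof (rule abelian_groupI)
    fix x y z assume x: "x \<in> carrier (quotient_field R)" and y: "y \<in> carrier (quotient_field R)"
      and z: "z \<in> carrier (quotient_field R)"
    obtain a b c d e f where r: "x = fraction R a b" "y = fraction R c d" "z = fraction R e f"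
      and c: "a \<in> carrier R" "b \<in> carrier R" "c \<in> carrier R" "d \<in> carrier R" "e \<in> carrier R"
        "f \<in> carrier R"
      and n: "b \<noteq> \<zero>" "d \<noteq> \<zero>" "f \<noteq> \<zero>"
      using x y z by (elim quotient_fieldE) blast
    have "((a \<otimes> d \<oplus> c \<otimes> b) \<otimes> f \<oplus> e \<otimes> (b \<otimes> d)) \<otimes> (b \<otimes> (d \<otimes> f)) =
      (a \<otimes> (d \<otimes> f) \<oplus> (c \<otimes> f \<oplus> e \<otimes> d) \<otimes> b) \<otimes> ((b \<otimes> d) \<otimes> f)"
      using c by algebra
    then show "x \<oplus>\<^bsub>quotient_field R\<^esub> y \<oplus>\<^bsub>quotient_field R\<^esub> z
        = x \<oplus>\<^bsub>quotient_field R\<^esub> (y \<oplus>\<^bsub>quotient_field R\<^esub> z)"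
      unfolding r using c n by (simp add: simps)
  next
    fix x y assume x: "x \<in> carrier (quotient_field R)" and y: "y \<in> carrier (quotient_field R)"
    obtain a b c d where r: "x = fraction R a b" "y = fraction R c d"
      and c: "a \<in> carrier R" "b \<in> carrier R" "c \<in> carrier R" "d \<in> carrier R"
      and n: "b \<noteq> \<zero>" "d \<noteq> \<zero>"
      using x y by (elim quotient_fieldE) blast
    show "x \<oplus>\<^bsub>quotient_field R\<^esub> y \<in> carrier (quotient_field R)"
      unfolding r using c n by (simp add: simps)
    have "(a \<otimes> d \<oplus> c \<otimes> b) \<otimes> (d \<otimes> b) = (c \<otimes> b \<oplus> a \<otimes> d) \<otimes> (b \<otimes> d)"
      using c by algebra
    then show "x \<oplus>\<^bsub>quotient_field R\<^esub> y = y \<oplus>\<^bsub>quotient_field R\<^esub> x"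
      unfolding r using c n by (simp add: simps)
  next
    show "\<zero>\<^bsub>quotient_field R\<^esub> \<in> carrier (quotient_field R)" by (simp add: simps)
  next
    fix x assume x: "x \<in> carrier (quotient_field R)"
    obtain a b where r: "x = fraction R a b"
      and c: "a \<in> carrier R" "b \<in> carrier R" and n: "b \<noteq> \<zero>"
      using x by (elim quotient_fieldE) blast
    show "\<zero>\<^bsub>quotient_field R\<^esub> \<oplus>\<^bsub>quotient_field R\<^esub> x = x"
      unfolding r using c n by (simp add: simps)
    have "((\<ominus> a) \<otimes> b \<oplus> a \<otimes> b) = \<zero>" using c by algebra
    then have "fraction R (\<ominus> a) b \<oplus>\<^bsub>quotient_field R\<^esub> x = \<zero>\<^bsub>quotient_field R\<^esub>"
      unfolding r using c n by (simp add: simps)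
    then show "\<exists>y\<in>carrier (quotient_field R). y \<oplus>\<^bsub>quotient_field R\<^esub> x = \<zero>\<^bsub>quotient_field R\<^esub>"
      using c n by (intro bexI[of _ "fraction R (\<ominus> a) b"]) (auto simp: simps)
  qed
  show "comm_monoid (quotient_field R)"
  proof (rule comm_monoidI)
    fix x y z assume x: "x \<in> carrier (quotient_field R)" and y: "y \<in> carrier (quotient_field R)"
      and z: "z \<in> carrier (quotient_field R)"
    obtain a b c d e f where r: "x = fraction R a b" "y = fraction R c d" "z = fraction R e f"
      and c: "a \<in> carrier R" "b \<in> carrier R" "c \<in> carrier R" "d \<in> carrier R" "e \<in> carrier R"
        "f \<in> carrier R"
      and n: "b \<noteq> \<zero>" "d \<noteq> \<zero>" "f \<noteq> \<zero>"
      using x y z by (elim quotient_fieldE) blast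
    show "x \<otimes>\<^bsub>quotient_field R\<^esub> y \<otimes>\<^bsub>quotient_field R\<^esub> z
        = x \<otimes>\<^bsub>quotient_field R\<^esub> (y \<otimes>\<^bsub>quotient_field R\<^esub> z)"
      unfolding r using c n by (simp add: simps m_assoc)
  next
    fix x y assume x: "x \<in> carrier (quotient_field R)" and y: "y \<in> carrier (quotient_field R)"
    obtain a b c d where r: "x = fraction R a b" "y = fraction R c d"
      and c: "a \<in> carrier R" "b \<in> carrier R" "c \<in> carrier R" "d \<in> carrier R"
      and n: "b \<noteq> \<zero>" "d \<noteq> \<zero>"
      using x y by (elim quotient_fieldE) blast
    show "x \<otimes>\<^bsub>quotient_field R\<^esub> y \<in> carrier (quotient_field R)"
      unfolding r using c n by (simp add: simps)
    show "x \<otimes>\<^bsub>quotient_field R\<^esub> y = y \<otimes>\<^bsub>quotient_field R\<^esub> x"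
      unfolding r using c n by (simp add: simps m_ac)
  next
    show "\<one>\<^bsub>quotient_field R\<^esub> \<in> carrier (quotient_field R)" by (simp add: simps)
  next
    fix x assume x: "x \<in> carrier (quotient_field R)"
    obtain a b where r: "x = fraction R a b"
      and c: "a \<in> carrier R" "b \<in> carrier R" and n: "b \<noteq> \<zero>"
      using x by (elim quotient_fieldE) blast
    show "\<one>\<^bsub>quotient_field R\<^esub> \<otimes>\<^bsub>quotient_field R\<^esub> x = x"
      unfolding r using c n by (simp add: simps)
  qed
  fix x y z assume x: "x \<in> carrier (quotient_field R)" and y: "y \<in> carrier (quotient_field R)"
    and z: "z \<in> carrier (quotient_field R)"
  obtain a b c d e f where r: "x = fraction R a b" "y = fraction R c d" "z = fraction R e f"
    and c: "a \<in> carrier R" "b \<in> carrier R" "c \<in> carrier R" "d \<in> carrier R" "e \<in> carrier R"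
      "f \<in> carrier R"
    and n: "b \<noteq> \<zero>" "d \<noteq> \<zero>" "f \<noteq> \<zero>"
    using x y z by (elim quotient_fieldE) blast
  have "((a \<otimes> d \<oplus> c \<otimes> b) \<otimes> e) \<otimes> ((b \<otimes> f) \<otimes> (d \<otimes> f))
    = ((a \<otimes> e) \<otimes> (d \<otimes> f) \<oplus> (c \<otimes> e) \<otimes> (b \<otimes> f)) \<otimes> ((b \<otimes> d) \<otimes> f)"
    using c by algebra
  then have "fraction R ((a \<otimes> d \<oplus> c \<otimes> b) \<otimes> e) ((b \<otimes> d) \<otimes> f)
    = fraction R ((a \<otimes> e) \<otimes> (d \<otimes> f) \<oplus> (c \<otimes> e) \<otimes> (b \<otimes> f)) ((b \<otimes> f) \<otimes> (d \<otimes> f))"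
    using c n by (subst fraction_eq_iff) (simp_all add: integral_iff)
  then show "(x \<oplus>\<^bsub>quotient_field R\<^esub> y) \<otimes>\<^bsub>quotient_field R\<^esub> z
      = x \<otimes>\<^bsub>quotient_field R\<^esub> z \<oplus>\<^bsub>quotient_field R\<^esub> y \<otimes>\<^bsub>quotient_field R\<^esub> z"
    unfolding r using c n by (simp add: fraction_mult fraction_add integral_iff del: fraction_eq_iff)
qed

end

lemma (in cring) lin_span_insertE:
  assumes C: "subring C R" and F: "insert f F \<subseteq> carrier R" and x: "x \<in> lin_span R C (insert f F)"
  shows "\<exists>z \<in> lin_span R C F. \<exists>c \<in> C. x = z \<oplus> c \<otimes> f"
  using x
proof induction
  case zero
  then show ?case using F subringE(2)[OF C] lin_span.zero[of R C F] by force
next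
  case (add x d h)
  then obtain z c where z: "z \<in> lin_span R C F" "c \<in> C" "x = z \<oplus> c \<otimes> f" by auto
  have car: "z \<in> carrier R" "c \<in> carrier R" "f \<in> carrier R" "d \<in> carrier R" "h \<in> carrier R"
    using z add.hyps F subringE(1)[OF C] lin_span_closed[of C F z] by auto
  show ?case
  proof (cases "h = f")
    case True
    have "x \<oplus> d \<otimes> h = z \<oplus> (c \<oplus> d) \<otimes> f" unfolding z True using car by algebra
    then show ?thesis using z add.hyps subringE(7)[OF C] by blast
  next
    case False
    have "x \<oplus> d \<otimes> h = (z \<oplus> d \<otimes> h) \<oplus> c \<otimes> f" unfolding z using car by algebra
    moreover have "z \<oplus> d \<otimes> h \<in> lin_span R C F" using z add.hyps False by (auto intro: lin_span.add)
    ultimately show ?thesis using z by blast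
  qed
qed

context domain
begin

text \<open>The recursion expresses \<open>y n = (a / b)\<^sup>n y 0\<close> without leaving the domain.\<close>

lemma fraction_pow:
  fixes y :: "nat \<Rightarrow> 'a"
  assumes a: "a \<in> carrier R" and b: "b \<in> carrier R" "b \<noteq> \<zero>"
    and y: "\<And>n. y n \<in> carrier R" "y 0 \<noteq> \<zero>" "\<And>n. b \<otimes> y (Suc n) = a \<otimes> y n"
  shows "fraction R a b [^]\<^bsub>quotient_field R\<^esub> n = fraction R (y n) (y 0)"
proof (induction n)
  case 0
  show ?case using y by (simp add: nat_pow_def quotient_field_consts fraction_eq_iff)
next
  case (Suc n)
  have c: "y n \<in> carrier R" "y (Suc n) \<in> carrier R" "y 0 \<in> carrier R" using y by auto
  have "(y n \<otimes> a) \<otimes> y 0 = (b \<otimes> y (Suc n)) \<otimes> y 0" unfolding y(3) using c a by algebra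
  also have "\<dots> = y (Suc n) \<otimes> (y 0 \<otimes> b)" using c b by algebra
  finally have "fraction R (y n \<otimes> a) (y 0 \<otimes> b) = fraction R (y (Suc n)) (y 0)"
    using y a b by (subst fraction_eq_iff) (simp_all add: integral_iff)
  moreover have "fraction R a b [^]\<^bsub>quotient_field R\<^esub> Suc n
      = fraction R a b [^]\<^bsub>quotient_field R\<^esub> n \<otimes>\<^bsub>quotient_field R\<^esub> fraction R a b"
    by (simp add: nat_pow_def)
  ultimately show ?case unfolding Suc using y a b by (simp add: fraction_mult)
qed

text \<open>Division by \<open>y 0\<close> turns \<open>y n\<close> into \<open>(a / b)\<^sup>n\<close>, and hence an \<open>R\<close>-linear combination of the \<open>y n\<close> into
  a polynomial expression in \<open>a / b\<close>.\<close>

lemma eval_of_lin_span: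
  fixes y :: "nat \<Rightarrow> 'a"
  assumes a: "a \<in> carrier R" and b: "b \<in> carrier R" "b \<noteq> \<zero>"
    and y: "\<And>n. y n \<in> carrier R" "y 0 \<noteq> \<zero>" "\<And>n. b \<otimes> y (Suc n) = a \<otimes> y n"
    and z: "z \<in> lin_span R (carrier R) (y ` {..<m})"
  shows "\<exists>p. length p = m \<and> set p \<subseteq> (\<lambda>a. fraction R a \<one>) ` carrier R \<and>
    ring.eval (quotient_field R) p (fraction R a b) = fraction R z (y 0)"
  using z
proof (induction m arbitrary: z)
  interpret Q: cring "quotient_field R" by (rule quotient_field_cring)
  case 0
  then have "z = \<zero>" by (auto elim: lin_span.cases)
  then show ?case using y by (simp add: quotient_field_consts fraction_eq_iff)
next
  interpret Q: cring "quotient_field R" by (rule quotient_field_cring)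
  case (Suc m)
  have ins: "y ` {..<Suc m} = insert (y m) (y ` {..<m})" by (simp add: lessThan_Suc)
  obtain z' c where z': "z' \<in> lin_span R (carrier R) (y ` {..<m})" "c \<in> carrier R"
    "z = z' \<oplus> c \<otimes> y m"
    using lin_span_insertE[OF carrier_is_subring _ Suc.prems[unfolded ins]] y(1) by blast
  have z'c: "z' \<in> carrier R" by (rule lin_span_closed[OF _ _ z'(1)]) (use y in auto)
  obtain p where p: "length p = m" "set p \<subseteq> (\<lambda>a. fraction R a \<one>) ` carrier R"
    "Q.eval p (fraction R a b) = fraction R z' (y 0)"
    using Suc.IH[OF z'(1)] by auto
  have c: "y m \<in> carrier R" "y 0 \<in> carrier R" "z' \<in> carrier R" "c \<in> carrier R"
    using y z'c z' by auto
  have "(c \<otimes> y m \<otimes> y 0 \<oplus> z' \<otimes> y 0) \<otimes> y 0 = (z' \<oplus> c \<otimes> y m) \<otimes> (y 0 \<otimes> y 0)"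
    using c by algebra
  then have "Q.eval (fraction R c \<one> # p) (fraction R a b) = fraction R z (y 0)"
    using p c y(2) z'(3)
    by (simp add: fraction_pow[OF a b y] fraction_mult fraction_add fraction_eq_iff integral_iff)
  then show ?case using p z' by (intro exI[of _ "fraction R c \<one> # p"]) auto
qed

text \<open>Some \<open>y m\<close> is a linear combination of its predecessors, as the ring is Noetherian. Division by \<open>y 0\<close>
  gives an integral equation for \<open>a / b\<close>, so \<open>a / b\<close> belongs to the ring by normality.\<close>

lemma divides_if_almost_integral:
  fixes y :: "nat \<Rightarrow> 'a"
  assumes N: "noetherian_on R (carrier R)" and IC: "integrally_closed_in_quotient_field R"
    and a: "a \<in> carrier R" and b: "b \<in> carrier R" "b \<noteq> \<zero>"
    and y: "\<And>n. y n \<in> carrier R" "y 0 \<noteq> \<zero>" "\<And>n. b \<otimes> y (Suc n) = a \<otimes> y n"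
  shows "b divides a"
proof -
  interpret Q: cring "quotient_field R" by (rule quotient_field_cring)
  let ?A = "(\<lambda>a. fraction R a \<one>) ` carrier R"
  obtain m where m: "y m \<in> lin_span R (carrier R) (y ` {..<m})"
    using N y(1) unfolding noetherian_on_def by blast
  have yc: "y ` {..<m} \<subseteq> carrier R" using y(1) by auto
  have "\<zero> \<ominus> y m \<in> lin_span R (carrier R) (y ` {..<m})"
    by (rule lin_span_minus[OF carrier_is_subring yc lin_span.zero m])
  moreover have "\<zero> \<ominus> y m = \<ominus> y m" using y(1) by (simp add: minus_eq)
  ultimately have "\<ominus> y m \<in> lin_span R (carrier R) (y ` {..<m})" by simp
  from eval_of_lin_span[OF a b y this]
  obtain p where p: "length p = m" "set p \<subseteq> ?A"
    "Q.eval p (fraction R a b) = fraction R (\<ominus> y m) (y 0)" by auto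
  have c: "y m \<in> carrier R" "y 0 \<in> carrier R" using y by auto
  have 0: "y m \<otimes> y 0 \<oplus> \<ominus> y m \<otimes> y 0 = \<zero>" using c by algebra
  have "Q.eval (\<one>\<^bsub>quotient_field R\<^esub> # p) (fraction R a b) = \<zero>\<^bsub>quotient_field R\<^esub>"
    using p c y(2) 0
    by (simp add: fraction_pow[OF a b y] fraction_mult fraction_add fraction_eq_iff integral_iff
        quotient_field_consts)
  moreover have "polynomial\<^bsub>quotient_field R\<^esub> ?A (\<one>\<^bsub>quotient_field R\<^esub> # p)"
    using p(2) unfolding polynomial_def
    by (auto simp: quotient_field_consts fraction_eq_iff)
  ultimately have "integral_over (quotient_field R) ?A (fraction R a b)"
    unfolding integral_over_def by (intro exI[of _ "\<one>\<^bsub>quotient_field R\<^esub> # p"]) simp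
  then have "fraction R a b \<in> ?A"
    using IC fraction_in_quotient_field[OF a b]
    unfolding integrally_closed_in_quotient_field_def Let_def by blast
  then obtain c where "c \<in> carrier R" "fraction R a b = fraction R c \<one>" by auto
  then have "a = b \<otimes> c" using a b by (simp add: fraction_eq_iff m_comm)
  then show ?thesis using \<open>c \<in> carrier R\<close> unfolding factor_def by blast
qed

text \<open>If multiplication by \<open>a / b\<close> maps the set \<open>J\<close> to itself, all elements \<open>(a / b)\<^sup>n q\<close> stay in the
  ring. This replaces the usual determinant argument for finitely generated ideals.\<close>

lemma divides_if_stable:
  assumes N: "noetherian_on R (carrier R)" and IC: "integrally_closed_in_quotient_field R"
    and a: "a \<in> carrier R" and b: "b \<in> carrier R" "b \<noteq> \<zero>"
    and J: "J \<subseteq> carrier R" "q \<in> J" "q \<noteq> \<zero>" "\<And>x. x \<in> J \<Longrightarrow> \<exists>y \<in> J. b \<otimes> y = a \<otimes> x"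
  shows "b divides a"
proof -
  have "\<exists>y. y 0 = q \<and> (\<forall>n. y n \<in> J) \<and> (\<forall>n :: nat. b \<otimes> y (Suc n) = a \<otimes> y n)"
  proof -
    obtain h where h: "\<And>x. x \<in> J \<Longrightarrow> h x \<in> J \<and> b \<otimes> h x = a \<otimes> x" using J(4) by metis
    have "(h ^^ n) q \<in> J" for n by (induction n) (use J h in auto)
    then show ?thesis using h by (intro exI[of _ "\<lambda>n. (h ^^ n) q"]) auto
  qed
  then obtain y where "y 0 = q" "\<And>n. y n \<in> J" "\<And>n::nat. b \<otimes> y (Suc n) = a \<otimes> y n" by blast
  then show ?thesis using divides_if_almost_integral[OF N IC a b, of y] J by auto
qed

end

lemma (in cring) ideal_intro:
  assumes "I \<subseteq> carrier R" "\<zero> \<in> I" "\<And>x y. x \<in> I \<Longrightarrow> y \<in> I \<Longrightarrow> x \<oplus> y \<in> I"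
    "\<And>r x. r \<in> carrier R \<Longrightarrow> x \<in> I \<Longrightarrow> r \<otimes> x \<in> I"
  shows "ideal I R"
proof (rule idealI)
  show "ring R" by (rule ring_axioms)
  show "subgroup I (add_monoid R)"
  proof (rule add.subgroupI)
    fix x assume x: "x \<in> I"
    have "(\<ominus> \<one>) \<otimes> x \<in> I" using assms(4)[OF _ x] by simp
    moreover have "(\<ominus> \<one>) \<otimes> x = \<ominus> x" using x assms(1) by (simp add: l_minus subset_iff)
    ultimately show "\<ominus> x \<in> I" by simp
  qed (use assms in auto)
  show "x \<otimes> a \<in> I" "a \<otimes> x \<in> I" if "a \<in> I" "x \<in> carrier R" for a x
    using that assms m_comm[of a x] by (auto simp: subset_iff)
qed

context domain
begin

text \<open>The zero ideal of a domain is prime, so \<open>{\<zero>} \<subset> P\<close> is a longest chain of primes ending in a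
  minimal nonzero prime \<open>P\<close>.\<close>

lemma prime_height_eq_1I:
  assumes P: "primeideal P R" "P \<noteq> {\<zero>}"
    and min: "\<And>Q. primeideal Q R \<Longrightarrow> Q \<subseteq> P \<Longrightarrow> Q \<noteq> {\<zero>} \<Longrightarrow> Q = P"
  shows "prime_height R P = 1"
  unfolding prime_height_def
proof (rule antisym)
  have zero: "\<zero> \<in> Q" if "primeideal Q R" for Q
    using that by (simp add: additive_subgroup.zero_closed ideal.axioms(1) primeideal.axioms(1))
  show "Sup {enat n |n Q. (\<forall>i\<le>n. primeideal (Q i) R) \<and> (\<forall>i<n. Q i \<subset> Q (Suc i)) \<and> Q n = P} \<le> 1"
  proof (rule Sup_least, safe)
    fix n and Q :: "nat \<Rightarrow> 'a set"
    assume Q: "\<forall>i\<le>n. primeideal (Q i) R" "\<forall>i<n. Q i \<subset> Q (Suc i)" "P = Q n"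
    have "n \<le> 1"
    proof (rule ccontr)
      assume "\<not> n \<le> 1"
      then obtain m where m: "n = Suc (Suc m)" by (metis One_nat_def Suc_le_D not_less_eq_eq)
      have "\<zero> \<in> Q m" "Q m \<subset> Q (Suc m)" "Q (Suc m) \<subset> P" using Q m zero by auto
      have "Q (Suc m) \<noteq> {\<zero>}"
      proof
        assume "Q (Suc m) = {\<zero>}"
        then have "Q m = {\<zero>}" using \<open>\<zero> \<in> Q m\<close> \<open>Q m \<subset> Q (Suc m)\<close> by auto
        then show False using \<open>Q m \<subset> Q (Suc m)\<close> \<open>Q (Suc m) = {\<zero>}\<close> by simp
      qed
      then have "Q (Suc m) = P" using min[of "Q (Suc m)"] Q(1) m \<open>Q (Suc m) \<subset> P\<close> by auto
      then show False using \<open>Q (Suc m) \<subset> P\<close> by simp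
    qed
    then show "enat n \<le> 1" by (simp add: one_enat_def)
  qed
  show "1 \<le> Sup {enat n |n Q. (\<forall>i\<le>n. primeideal (Q i) R) \<and> (\<forall>i<n. Q i \<subset> Q (Suc i)) \<and> Q n = P}"
  proof (rule Sup_upper, rule CollectI)
    have "{\<zero>} \<subset> P" using P zero by auto
    then show "\<exists>n Q. 1 = enat n \<and> (\<forall>i\<le>n. primeideal (Q i) R) \<and> (\<forall>i<n. Q i \<subset> Q (Suc i)) \<and> Q n = P"
      using P(1) zeroprimeideal
      by (intro exI[of _ 1] exI[of _ "\<lambda>i::nat. if i = 0 then {\<zero>} else P"])
        (auto simp: one_enat_def)
  qed
qed

lemma colon_ideal:
  assumes a: "a \<in> carrier R" and b: "b \<in> carrier R"
  shows "ideal {x \<in> carrier R. b divides (x \<otimes> a)} R"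
proof (rule ideal_intro)
  show "\<zero> \<in> {x \<in> carrier R. b divides (x \<otimes> a)}" using a b unfolding factor_def
    by (auto intro!: bexI[of _ "\<zero>"])
next
  fix x y assume "x \<in> {x \<in> carrier R. b divides (x \<otimes> a)}" "y \<in> {x \<in> carrier R. b divides (x \<otimes> a)}"
  then obtain c d where *: "x \<in> carrier R" "y \<in> carrier R" "c \<in> carrier R" "d \<in> carrier R"
    "x \<otimes> a = b \<otimes> c" "y \<otimes> a = b \<otimes> d" unfolding factor_def by auto
  then have "(x \<oplus> y) \<otimes> a = b \<otimes> (c \<oplus> d)" using a b by (simp add: l_distr r_distr)
  then show "x \<oplus> y \<in> {x \<in> carrier R. b divides (x \<otimes> a)}" using * unfolding factor_def by auto
next
  fix r x assume r: "r \<in> carrier R" and "x \<in> {x \<in> carrier R. b divides (x \<otimes> a)}"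
  then obtain c where *: "x \<in> carrier R" "c \<in> carrier R" "x \<otimes> a = b \<otimes> c"
    unfolding factor_def by auto
  have "(r \<otimes> x) \<otimes> a = b \<otimes> (r \<otimes> c)" using * a b r by (simp add: m_assoc m_lcomm)
  then show "r \<otimes> x \<in> {x \<in> carrier R. b divides (x \<otimes> a)}" using * r unfolding factor_def by auto
qed auto

text \<open>A strictly increasing sequence of the ideals \<open>(b : c a)\<close> would provide elements \<open>d n\<close>, each outside an
  ideal that contains all earlier ones, contrary to the Noetherian property.\<close>

lemma exists_maximal_colon_ideal:
  assumes N: "noetherian_on R (carrier R)" and a: "a \<in> carrier R" and b: "b \<in> carrier R"
    and nd: "\<not> b divides a"
  defines "D \<equiv> \<lambda>c. {x \<in> carrier R. b divides (x \<otimes> (c \<otimes> a))}"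
  shows "\<exists>c \<in> carrier R. \<not> b divides (c \<otimes> a) \<and>
    (\<forall>c' \<in> carrier R. \<not> b divides (c' \<otimes> a) \<longrightarrow> D c \<subseteq> D c' \<longrightarrow> D c' = D c)"
proof (rule ccontr)
  assume "\<not> ?thesis"
  then have step: "\<exists>c' \<in> carrier R. \<not> b divides (c' \<otimes> a) \<and> D c \<subset> D c'"
    if "c \<in> carrier R" "\<not> b divides (c \<otimes> a)" for c
    using that by blast
  have "\<exists>c. \<forall>n. (c n \<in> carrier R \<and> \<not> b divides (c n \<otimes> a)) \<and> D (c n) \<subset> D (c (Suc n))"
  proof (rule dependent_nat_choice)
    show "\<exists>c. c \<in> carrier R \<and> \<not> b divides (c \<otimes> a)" using nd a by (intro exI[of _ \<one>]) simp
    fix c and n :: nat assume "c \<in> carrier R \<and> \<not> b divides (c \<otimes> a)"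
    then show "\<exists>c'. (c' \<in> carrier R \<and> \<not> b divides (c' \<otimes> a)) \<and> D c \<subset> D c'"
      using step[of c] by blast
  qed
  then obtain c where "\<forall>n. (c n \<in> carrier R \<and> \<not> b divides (c n \<otimes> a)) \<and> D (c n) \<subset> D (c (Suc n))" ..
  then have c: "c n \<in> carrier R" "D (c n) \<subset> D (c (Suc n))" for n by simp_all
  have mono: "D (c i) \<subseteq> D (c j)" if "i \<le> j" for i j
    using that
  proof (rule lift_Suc_mono_le[rotated])
    show "D (c n) \<subseteq> D (c (Suc n))" for n using c(2)[of n] by (rule psubset_imp_subset)
  qed
  have "\<forall>n. \<exists>d. d \<in> D (c (Suc n)) - D (c n)" using c(2) psubset_imp_ex_mem by metis
  then obtain d where d': "\<forall>n. d n \<in> D (c (Suc n)) - D (c n)" by metis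
  have d: "d n \<in> D (c (Suc n))" "d n \<notin> D (c n)" for n using d' by auto
  have "d n \<in> carrier R" for n using d(1)[of n] unfolding D_def by auto
  then obtain m where m: "d m \<in> lin_span R (carrier R) (d ` {..<m})"
    using N unfolding noetherian_on_def by blast
  interpret I: ideal "D (c m)" R unfolding D_def by (rule colon_ideal) (use a b c in auto)
  have "x \<in> D (c m)" if "x \<in> lin_span R (carrier R) (d ` {..<m})" for x
    using that
  proof induction
    case (add x r f)
    then obtain i where "i < m" "f = d i" by auto
    then have "f \<in> D (c m)" using d(1)[of i] mono[of "Suc i" m] by auto
    then show ?case using add I.I_l_closed I.a_closed by auto
  qed simp
  then show False using m d(2) by blast
qed

text \<open>If \<open>b\<close> does not divide \<open>a\<close>, choose \<open>c\<close> such that the proper ideal \<open>P = (b : c a)\<close> is maximal among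
  such ideals. Maximality makes \<open>P\<close> prime. It has height one: by normality the fraction \<open>c a / b\<close> does
  not map \<open>P\<close> to itself, so there are \<open>p \<in> P\<close> and \<open>u \<notin> P\<close> with \<open>p c a = b u\<close>. Consider a nonzero
  prime \<open>Q \<subseteq> P\<close>. If \<open>p\<close> were not in \<open>Q\<close>, then \<open>c a / b\<close> would map \<open>Q\<close> to itself, which is
  impossible; hence \<open>p \<in> Q\<close>, and then \<open>u P \<subseteq> p R \<subseteq> Q\<close> forces \<open>P \<subseteq> Q\<close>. But at this \<open>P\<close> the
  hypothesis yields an \<open>s \<notin> P\<close> with \<open>b\<close> dividing \<open>s a\<close>, contrary to the definition of \<open>P\<close>.\<close>

theorem divides_if_locally_divides:
  assumes N: "noetherian_on R (carrier R)" and IC: "integrally_closed_in_quotient_field R"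
    and a: "a \<in> carrier R" and b: "b \<in> carrier R" "b \<noteq> \<zero>"
    and loc: "\<And>P. primeideal P R \<Longrightarrow> prime_height R P = 1 \<Longrightarrow>
      \<exists>s \<in> carrier R - P. b divides (s \<otimes> a)"
  shows "b divides a"
proof (rule ccontr)
  assume nd: "\<not> b divides a"
  define D where "D c = {x \<in> carrier R. b divides (x \<otimes> (c \<otimes> a))}" for c
  have "\<exists>c \<in> carrier R. \<not> b divides (c \<otimes> a) \<and>
      (\<forall>c' \<in> carrier R. \<not> b divides (c' \<otimes> a) \<longrightarrow> D c \<subseteq> D c' \<longrightarrow> D c' = D c)"
    unfolding D_def by (rule exists_maximal_colon_ideal[OF N a b(1) nd])
  then obtain c where c: "c \<in> carrier R" "\<not> b divides (c \<otimes> a)"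
    and max': "\<forall>c' \<in> carrier R. \<not> b divides (c' \<otimes> a) \<longrightarrow> D c \<subseteq> D c' \<longrightarrow> D c' = D c"
    by (elim bexE conjE) (rule that)
  have max: "D c' = D c" if "c' \<in> carrier R" "\<not> b divides (c' \<otimes> a)" "D c \<subseteq> D c'" for c'
    using max' that by simp
  let ?a = "c \<otimes> a"
  have ac: "?a \<in> carrier R" using c a by simp
  have memD: "x \<in> D c \<longleftrightarrow> x \<in> carrier R \<and> b divides (x \<otimes> ?a)" for x unfolding D_def by auto
  have P: "primeideal (D c) R"
  proof (rule primeidealI)
    show "ideal (D c) R" unfolding D_def by (rule colon_ideal[OF ac b(1)])
    show "cring R" by (rule is_cring)
    show "carrier R \<noteq> D c" using memD[of \<one>] c ac by auto
    fix x y assume xy: "x \<in> carrier R" "y \<in> carrier R" "x \<otimes> y \<in> D c"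
    show "x \<in> D c \<or> y \<in> D c"
    proof (rule disjCI)
      assume y: "y \<notin> D c"
      have "\<not> b divides ((y \<otimes> c) \<otimes> a)" using y xy memD[of y] a c by (simp add: m_assoc)
      moreover have "D c \<subseteq> D (y \<otimes> c)"
      proof
        fix z assume z: "z \<in> D c"
        then have "y \<otimes> z \<in> D c" using ideal.I_l_closed[OF primeideal.axioms(1)] \<open>ideal (D c) R\<close> xy
          by (simp add: ideal.I_l_closed)
        moreover have "z \<in> carrier R" using z memD by auto
        moreover have "(y \<otimes> z) \<otimes> (c \<otimes> a) = z \<otimes> ((y \<otimes> c) \<otimes> a)"
          using \<open>z \<in> carrier R\<close> xy(2) a c(1) by algebra
        ultimately show "z \<in> D (y \<otimes> c)" unfolding D_def by auto
      qed
      ultimately have "D (y \<otimes> c) = D c" using max[of "y \<otimes> c"] xy c by auto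
      moreover have "(x \<otimes> y) \<otimes> (c \<otimes> a) = x \<otimes> ((y \<otimes> c) \<otimes> a)"
        using xy(1,2) a c(1) by algebra
      then have "x \<in> D (y \<otimes> c)" using xy(3) memD[of "x \<otimes> y"] xy(1) unfolding D_def by simp
      ultimately show "x \<in> D c" by simp
    qed
  qed
  interpret P: primeideal "D c" R by (rule P)
  have bP: "b \<in> D c" using memD[of b] b ac unfolding factor_def by auto
  have "\<not> (\<forall>x \<in> D c. \<exists>y \<in> D c. b \<otimes> y = ?a \<otimes> x)"
    using divides_if_stable[OF N IC ac b, of "D c" b] bP b c(2) P.a_subset by blast
  then obtain p where p: "p \<in> D c" "\<And>y. y \<in> D c \<Longrightarrow> b \<otimes> y \<noteq> ?a \<otimes> p" by meson
  have pc: "p \<in> carrier R" using p(1) memD[of p] by simp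
  obtain u where u: "u \<in> carrier R" "p \<otimes> ?a = b \<otimes> u"
    using p(1) memD[of p] unfolding factor_def by blast
  have uP: "u \<notin> D c" using p(2)[of u] u m_comm[OF pc ac] by metis
  \<comment> \<open>both sides represent \<open>p x (c a / b)\<close>\<close>
  have key: "u \<otimes> x = p \<otimes> x'" if "x \<in> carrier R" "x' \<in> carrier R" "x \<otimes> ?a = b \<otimes> x'" for x x'
  proof -
    have "b \<otimes> (u \<otimes> x) = (b \<otimes> u) \<otimes> x" using u b that by (simp add: m_assoc)
    also have "\<dots> = p \<otimes> (x \<otimes> ?a)" unfolding u(2)[symmetric] using pc that ac by (simp add: m_ac)
    also have "\<dots> = b \<otimes> (p \<otimes> x')" unfolding that(3) using pc that b by (simp add: m_ac)
    finally show ?thesis using b u pc that m_lcancel[of b] by simp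
  qed
  have "prime_height R (D c) = 1"
  proof (rule prime_height_eq_1I[OF P])
    show "D c \<noteq> {\<zero>}" using bP b by auto
  next
    fix Q assume Q: "primeideal Q R" "Q \<subseteq> D c" "Q \<noteq> {\<zero>}"
    interpret Q: primeideal Q R by (rule Q)
    obtain q where q: "q \<in> Q" "q \<noteq> \<zero>" using Q(3) Q.zero_closed by blast
    have uQ: "u \<notin> Q" using uP Q by auto
    have pQ: "p \<in> Q"
    proof (rule ccontr)
      assume pQ: "p \<notin> Q"
      have "\<exists>y \<in> Q. b \<otimes> y = ?a \<otimes> x" if xQ: "x \<in> Q" for x
      proof -
        have xc: "x \<in> carrier R" "b divides (x \<otimes> ?a)"
          using subsetD[OF Q(2) xQ] memD[of x] by simp_all
        from xc(2) obtain y where y: "y \<in> carrier R" "x \<otimes> ?a = b \<otimes> y"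
          unfolding factor_def by (elim bexE) (rule that)
        have "p \<otimes> y \<in> Q" using key[OF xc(1) y] Q.I_l_closed[OF xQ u(1)] by simp
        then have "y \<in> Q" using Q.I_prime[OF pc y(1)] pQ by simp
        moreover have "b \<otimes> y = ?a \<otimes> x" using y(2) m_comm[OF xc(1) ac] by simp
        ultimately show ?thesis by (rule bexI[rotated])
      qed
      then have "b divides ?a"
        by (rule divides_if_stable[OF N IC ac b Q.a_subset q])
      then show False using c by simp
    qed
    show "Q = D c"
    proof
      show "D c \<subseteq> Q"
      proof
        fix x assume "x \<in> D c"
        then have xc: "x \<in> carrier R" "b divides (x \<otimes> ?a)" using memD[of x] by simp_all
        from xc(2) obtain y where y: "y \<in> carrier R" "x \<otimes> ?a = b \<otimes> y"
          unfolding factor_def by (elim bexE) (rule that)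
        have "u \<otimes> x \<in> Q" using key[OF xc(1) y] Q.I_r_closed[OF pQ y(1)] by simp
        then show "x \<in> Q" using Q.I_prime[OF u(1) xc(1)] uQ by simp
      qed
    qed (rule Q)
  qed
  from loc[OF P this] obtain s where s: "s \<in> carrier R" "s \<notin> D c" "b divides (s \<otimes> a)" by blast
  then obtain d where "d \<in> carrier R" "s \<otimes> a = b \<otimes> d" unfolding factor_def by blast
  then have "s \<otimes> ?a = b \<otimes> (c \<otimes> d)"
    using s(1) c(1) a b(1) by (metis m_lcomm)
  then have "b divides (s \<otimes> ?a)" using \<open>d \<in> carrier R\<close> c(1) unfolding factor_def by (intro bexI[of _ "c \<otimes> d"]) simp_all
  then show False using s(1,2) memD[of s] by simp
qed

end

section \<open>Separating a prime by invariants of its inertia group\<close>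

context cring
begin

text \<open>The coefficient of \<open>X\<^sup>n\<^sup>-\<^sup>j\<close>, where \<open>n = card S\<close>, of the polynomial \<open>\<Prod>(X - f s)\<close>; the sign of the
  elementary symmetric function is included.\<close>

definition elem_sym :: "('i \<Rightarrow> 'a) \<Rightarrow> 'i set \<Rightarrow> nat \<Rightarrow> 'a" where
  "elem_sym f S j = (\<Oplus>Y\<in>{Y. Y \<subseteq> S \<and> card Y = j}. \<Otimes>s\<in>Y. \<ominus> f s)"

lemma finprod_minus_eq_sum_Pow:
  assumes "finite S" "f \<in> S \<rightarrow> carrier R" "x \<in> carrier R"
  shows "(\<Otimes>s\<in>S. x \<ominus> f s) = (\<Oplus>Y\<in>Pow S. (\<Otimes>s\<in>Y. \<ominus> f s) \<otimes> x [^] card (S - Y))"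
  using assms
proof (induction S)
  case (insert s S)
  let ?m = "\<lambda>Y. \<Otimes>s\<in>Y. \<ominus> f s"
  have fS: "f \<in> S \<rightarrow> carrier R" and fs: "f s \<in> carrier R" using insert.prems by auto
  have mc: "?m Y \<in> carrier R" if "Y \<in> Pow S" for Y
    by (rule finprod_closed) (use fS that in auto)
  have Pc: "(\<lambda>Y. ?m Y \<otimes> x [^] card (S - Y)) \<in> Pow S \<rightarrow> carrier R" using mc insert.prems by auto
  have m_ins: "?m (insert s Y) = (\<ominus> f s) \<otimes> ?m Y" if "Y \<in> Pow S" for Y
    using that insert.hyps fS fs by (subst finprod_insert) (auto intro: finite_subset)
  have inj: "inj_on (insert s) (Pow S)" using insert.hyps by (auto simp: inj_on_def)
  have card1: "card (insert s S - Y) = Suc (card (S - Y))" if "Y \<in> Pow S" for Y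
    using that insert.hyps by (subst insert_Diff_if) auto
  have card2: "insert s S - insert s Y = S - Y" if "Y \<in> Pow S" for Y
    using that insert.hyps by auto
  have c1: "(\<lambda>Y. ?m Y \<otimes> x [^] card (insert s S - Y)) \<in> Pow S \<rightarrow> carrier R" using mc insert.prems by auto
  have c2: "(\<lambda>Y. ?m Y \<otimes> x [^] card (insert s S - Y)) \<in> insert s ` Pow S \<rightarrow> carrier R"
  proof
    fix Y assume "Y \<in> insert s ` Pow S"
    then obtain Z where Z: "Z \<in> Pow S" "Y = insert s Z" by auto
    then have "?m Y \<in> carrier R" using m_ins[of Z] mc[of Z] fs by simp
    then show "?m Y \<otimes> x [^] card (insert s S - Y) \<in> carrier R" using insert.prems by simp
  qed
  have "(\<Oplus>Y\<in>Pow (insert s S). ?m Y \<otimes> x [^] card (insert s S - Y))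
    = (\<Oplus>Y\<in>Pow S. ?m Y \<otimes> x [^] card (insert s S - Y)) \<oplus>
      (\<Oplus>Y\<in>insert s ` Pow S. ?m Y \<otimes> x [^] card (insert s S - Y))"
    unfolding Pow_insert
    by (rule finsum_Un_disjoint) (use insert.hyps c1 c2 in auto)
  also have "(\<Oplus>Y\<in>insert s ` Pow S. ?m Y \<otimes> x [^] card (insert s S - Y))
    = (\<Oplus>Y\<in>Pow S. ?m (insert s Y) \<otimes> x [^] card (insert s S - insert s Y))"
    by (rule finsum_reindex[OF c2 inj])
  also have "\<dots> = (\<Oplus>Y\<in>Pow S. (\<ominus> f s) \<otimes> (?m Y \<otimes> x [^] card (S - Y)))"
  proof (rule finsum_cong')
    fix Y assume Y: "Y \<in> Pow S"
    show "?m (insert s Y) \<otimes> x [^] card (insert s S - insert s Y) = (\<ominus> f s) \<otimes> (?m Y \<otimes> x [^] card (S - Y))"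
      unfolding m_ins[OF Y] card2[OF Y] using mc[OF Y] fs insert.prems by (simp add: m_assoc)
  qed (use Pc fs in auto)
  also have "\<dots> = (\<ominus> f s) \<otimes> (\<Oplus>Y\<in>Pow S. ?m Y \<otimes> x [^] card (S - Y))"
    by (rule finsum_rdistr[symmetric]) (use insert.hyps fs Pc in auto)
  also have "(\<Oplus>Y\<in>Pow S. ?m Y \<otimes> x [^] card (insert s S - Y))
    = (\<Oplus>Y\<in>Pow S. x \<otimes> (?m Y \<otimes> x [^] card (S - Y)))"
  proof (rule finsum_cong')
    fix Y assume Y: "Y \<in> Pow S"
    show "?m Y \<otimes> x [^] card (insert s S - Y) = x \<otimes> (?m Y \<otimes> x [^] card (S - Y))"
      unfolding card1[OF Y] using mc[OF Y] insert.prems by (simp add: m_ac)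
  qed (use Pc insert.prems in auto)
  also have "\<dots> = x \<otimes> (\<Oplus>Y\<in>Pow S. ?m Y \<otimes> x [^] card (S - Y))"
    by (rule finsum_rdistr[symmetric]) (use insert.hyps insert.prems Pc in auto)
  finally have eq: "(\<Oplus>Y\<in>Pow (insert s S). ?m Y \<otimes> x [^] card (insert s S - Y))
    = x \<otimes> (\<Otimes>s\<in>S. x \<ominus> f s) \<oplus> (\<ominus> f s) \<otimes> (\<Otimes>s\<in>S. x \<ominus> f s)"
    using insert.IH[OF fS insert.prems(2)] by simp
  have pc: "(\<Otimes>s\<in>S. x \<ominus> f s) \<in> carrier R" by (rule finprod_closed) (use fS insert.prems in auto)
  have "(\<Otimes>s\<in>insert s S. x \<ominus> f s) = (x \<ominus> f s) \<otimes> (\<Otimes>s\<in>S. x \<ominus> f s)"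
    using insert.hyps insert.prems fS fs by (subst finprod_insert) auto
  also have "\<dots> = x \<otimes> (\<Otimes>s\<in>S. x \<ominus> f s) \<oplus> (\<ominus> f s) \<otimes> (\<Otimes>s\<in>S. x \<ominus> f s)"
    using pc fs insert.prems by (simp add: minus_eq l_distr)
  finally show ?case unfolding eq .
qed simp

lemma elem_sym_closed:
  "f \<in> S \<rightarrow> carrier R \<Longrightarrow> elem_sym f S j \<in> carrier R"
  unfolding elem_sym_def by (intro finsum_closed Pi_I finprod_closed) auto

lemma finprod_minus_eq_sum_elem_sym:
  assumes S: "finite S" and f: "f \<in> S \<rightarrow> carrier R" and x: "x \<in> carrier R"
  shows "(\<Otimes>s\<in>S. x \<ominus> f s) = (\<Oplus>j\<in>{..card S}. elem_sym f S j \<otimes> x [^] (card S - j))"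
proof -
  let ?m = "\<lambda>Y. \<Otimes>s\<in>Y. \<ominus> f s"
  let ?L = "\<lambda>j. {Y. Y \<subseteq> S \<and> card Y = j}"
  have mc: "?m Y \<in> carrier R" if "Y \<subseteq> S" for Y
    by (rule finprod_closed) (use f that in auto)
  have "Pow S = (\<Union>j\<in>{..card S}. ?L j)" using S card_mono by auto
  then have "(\<Otimes>s\<in>S. x \<ominus> f s) = (\<Oplus>Y\<in>(\<Union>j\<in>{..card S}. ?L j). ?m Y \<otimes> x [^] card (S - Y))"
    using finprod_minus_eq_sum_Pow[OF assms] by simp
  also have "\<dots> = (\<Oplus>j\<in>{..card S}. \<Oplus>Y\<in>?L j. ?m Y \<otimes> x [^] card (S - Y))"
    by (rule add.finprod_UN_disjoint)
      (use S x mc in \<open>auto simp: pairwise_def disjnt_iff\<close>)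
  also have "\<dots> = (\<Oplus>j\<in>{..card S}. elem_sym f S j \<otimes> x [^] (card S - j))"
  proof (rule finsum_cong')
    fix j assume "j \<in> {..card S}"
    have "(\<Oplus>Y\<in>?L j. ?m Y \<otimes> x [^] card (S - Y)) = (\<Oplus>Y\<in>?L j. ?m Y \<otimes> x [^] (card S - j))"
    proof (rule finsum_cong')
      show "(\<lambda>Y. ?m Y \<otimes> x [^] (card S - j)) \<in> ?L j \<rightarrow> carrier R" using mc x by auto
      fix Y assume "Y \<in> ?L j"
      then show "?m Y \<otimes> x [^] card (S - Y) = ?m Y \<otimes> x [^] (card S - j)"
        using card_Diff_subset[of Y S] finite_subset[OF _ S] by simp
    qed simp
    also have "\<dots> = elem_sym f S j \<otimes> x [^] (card S - j)"
      unfolding elem_sym_def by (rule finsum_ldistr[symmetric]) (use S mc x in auto)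
    finally show "(\<Oplus>Y\<in>?L j. ?m Y \<otimes> x [^] card (S - Y)) = elem_sym f S j \<otimes> x [^] (card S - j)" .
  qed (use elem_sym_closed[OF f] x in auto)
  finally show ?thesis .
qed

text \<open>A homomorphism that permutes the values of \<open>f\<close> permutes the summands, which are indexed by the
  subsets of a given size.\<close>

lemma elem_sym_invariant:
  assumes h: "h \<in> ring_hom R R" and f: "f \<in> S \<rightarrow> carrier R"
    and p: "bij_betw p S S" "\<And>s. s \<in> S \<Longrightarrow> h (f s) = f (p s)" and S: "finite S"
  shows "h (elem_sym f S j) = elem_sym f S j"
proof -
  interpret h: ring_hom_cring R R h
    by (intro ring_hom_cring.intro ring_hom_cring_axioms.intro is_cring h)
  let ?m = "\<lambda>Y. \<Otimes>s\<in>Y. \<ominus> f s"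
  let ?L = "{Y. Y \<subseteq> S \<and> card Y = j}"
  have mc: "?m Y \<in> carrier R" if "Y \<subseteq> S" for Y
    by (rule finprod_closed) (use f that in auto)
  have bij: "bij_betw ((`) p) ?L ?L"
  proof (rule bij_betw_imageI)
    show "inj_on ((`) p) ?L"
      using inj_on_image_Pow[OF bij_betw_imp_inj_on[OF p(1)]] by (rule inj_on_subset) auto
    have sub: "(`) p ` ?L \<subseteq> ?L"
      using p(1) by (auto simp: bij_betw_def card_image inj_on_subset)
    have "finite ?L" using S by simp
    then show "(`) p ` ?L = ?L"
      using sub \<open>inj_on ((`) p) ?L\<close> by (simp add: endo_inj_surj)
  qed
  have "h (elem_sym f S j) = (\<Oplus>Y\<in>?L. h (?m Y))"
    unfolding elem_sym_def using mc by (subst h.hom_finsum) (auto simp: comp_def)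
  also have "\<dots> = (\<Oplus>Y\<in>?L. ?m (p ` Y))"
  proof (rule finsum_cong')
    fix Y assume Y: "Y \<in> ?L"
    have inj: "inj_on p Y" using p(1) Y by (auto simp: bij_betw_def intro: inj_on_subset)
    have pY: "p ` Y \<subseteq> S" using p(1) Y by (auto simp: bij_betw_def)
    have "h (?m Y) = (\<Otimes>s\<in>Y. h (\<ominus> f s))"
      using f Y by (subst h.hom_finprod) (auto simp: comp_def)
    also have "\<dots> = (\<Otimes>s\<in>Y. \<ominus> f (p s))"
    proof (rule finprod_cong')
      fix s assume "s \<in> Y"
      then have "s \<in> S" using Y by auto
      then have "f s \<in> carrier R" "h (f s) = f (p s)" using f p(2) by auto
      then show "h (\<ominus> f s) = \<ominus> f (p s)" by simp
    qed (use Y f pY in auto)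
    also have "\<dots> = ?m (p ` Y)"
      by (rule finprod_reindex[symmetric, OF _ inj]) (use pY f in auto)
    finally show "h (?m Y) = ?m (p ` Y)" .
  next
    show "(\<lambda>Y. ?m (p ` Y)) \<in> ?L \<rightarrow> carrier R"
    proof
      fix Y assume "Y \<in> ?L"
      then have "p ` Y \<subseteq> S" using p(1) by (auto simp: bij_betw_def)
      then show "?m (p ` Y) \<in> carrier R" by (rule mc)
    qed
  qed simp
  also have "\<dots> = (\<Oplus>Y\<in>(`) p ` ?L. ?m Y)"
  proof (rule finsum_reindex[symmetric])
    show "?m \<in> (`) p ` ?L \<rightarrow> carrier R" using mc bij by (auto simp: bij_betw_def)
  qed (use bij in \<open>simp add: bij_betw_def\<close>)
  also have "(`) p ` ?L = ?L" using bij by (simp add: bij_betw_def)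
  finally show ?thesis unfolding elem_sym_def .
qed

end

lemma (in ideal) finsum_mem:
  assumes "\<And>s. s \<in> S \<Longrightarrow> f s \<in> I"
  shows "(\<Oplus>s\<in>S. f s) \<in> I"
  using assms
proof (induction S rule: infinite_finite_induct)
  case (insert s S)
  then have "f \<in> S \<rightarrow> carrier R" "f s \<in> carrier R" "f s \<in> I" "(\<Oplus>s\<in>S. f s) \<in> I"
    using a_subset by auto
  then show ?case using insert.hyps a_closed by (simp add: finsum_insert)
qed auto

lemma (in primeideal) finprod_mem_imp:
  assumes "finite S" "f \<in> S \<rightarrow> carrier R" "(\<Otimes>s\<in>S. f s) \<in> I"
  shows "\<exists>s \<in> S. f s \<in> I"
  using assms
proof (induction S)
  case empty
  then have "\<one> \<in> I" by simp
  then show ?case using one_imp_carrier I_notcarr by simp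
next
  case (insert s S)
  have f: "f \<in> S \<rightarrow> carrier R" "f s \<in> carrier R" using insert.prems by auto
  then have "f s \<otimes> (\<Otimes>s\<in>S. f s) \<in> I" using insert.hyps insert.prems by (simp add: finprod_insert)
  then have "f s \<in> I \<or> (\<Otimes>s\<in>S. f s) \<in> I" using f by (intro I_prime) auto
  then show ?case using insert.IH[OF f(1)] by auto
qed

text \<open>The setting of the descent argument. It will be applied to \<open>V = A \<otimes> M\<close> with the diagonal action.
  Torsion-freeness of \<open>V\<close> allows division by scalars, and faithfulness makes the inertia group of
  the zero ideal trivial.\<close>

locale semilinear_action =
  A: domain A + V: module A V + G: group \<Gamma>
  for A :: "('a, 'n) ring_scheme" (structure) and V :: "('a, 'v, 'q) module_scheme" (structure)
    and \<Gamma> :: "('g, 'h) monoid_scheme" (structure)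
    and \<alpha> :: "'g \<Rightarrow> 'a \<Rightarrow> 'a" and \<beta> :: "'g \<Rightarrow> 'v \<Rightarrow> 'v" +
  assumes finite_group: "finite (carrier \<Gamma>)"
    and act_hom: "g \<in> carrier \<Gamma> \<Longrightarrow> \<alpha> g \<in> ring_hom A A"
    and act_mult: "g \<in> carrier \<Gamma> \<Longrightarrow> h \<in> carrier \<Gamma> \<Longrightarrow> a \<in> carrier A \<Longrightarrow>
      \<alpha> (g \<otimes>\<^bsub>\<Gamma>\<^esub> h) a = \<alpha> g (\<alpha> h a)"
    and act_one: "a \<in> carrier A \<Longrightarrow> \<alpha> \<one>\<^bsub>\<Gamma>\<^esub> a = a"
    and faithful: "g \<in> carrier \<Gamma> \<Longrightarrow> (\<And>a. a \<in> carrier A \<Longrightarrow> \<alpha> g a = a) \<Longrightarrow> g = \<one>\<^bsub>\<Gamma>\<^esub>"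
    and vact_closed: "g \<in> carrier \<Gamma> \<Longrightarrow> v \<in> carrier V \<Longrightarrow> \<beta> g v \<in> carrier V"
    and vact_add: "g \<in> carrier \<Gamma> \<Longrightarrow> v \<in> carrier V \<Longrightarrow> w \<in> carrier V \<Longrightarrow>
      \<beta> g (v \<oplus>\<^bsub>V\<^esub> w) = \<beta> g v \<oplus>\<^bsub>V\<^esub> \<beta> g w"
    and vact_smult: "g \<in> carrier \<Gamma> \<Longrightarrow> a \<in> carrier A \<Longrightarrow> v \<in> carrier V \<Longrightarrow>
      \<beta> g (a \<odot>\<^bsub>V\<^esub> v) = \<alpha> g a \<odot>\<^bsub>V\<^esub> \<beta> g v"
    and vact_mult: "g \<in> carrier \<Gamma> \<Longrightarrow> h \<in> carrier \<Gamma> \<Longrightarrow> v \<in> carrier V \<Longrightarrow>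
      \<beta> (g \<otimes>\<^bsub>\<Gamma>\<^esub> h) v = \<beta> g (\<beta> h v)"
    and vact_one: "v \<in> carrier V \<Longrightarrow> \<beta> \<one>\<^bsub>\<Gamma>\<^esub> v = v"
    and torsion_free: "a \<in> carrier A \<Longrightarrow> v \<in> carrier V \<Longrightarrow> a \<odot>\<^bsub>V\<^esub> v = \<zero>\<^bsub>V\<^esub> \<Longrightarrow>
      a = \<zero>\<^bsub>A\<^esub> \<or> v = \<zero>\<^bsub>V\<^esub>"
begin

definition fixed_ring :: "'g set \<Rightarrow> 'a set" where
  "fixed_ring H = {a \<in> carrier A. \<forall>g \<in> H. \<alpha> g a = a}"

definition fixed_vectors :: "'g set \<Rightarrow> 'v set" where
  "fixed_vectors H = {v \<in> carrier V. \<forall>g \<in> H. \<beta> g v = v}"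

definition inertia :: "'a set \<Rightarrow> 'g set" where
  "inertia P = {g \<in> carrier \<Gamma>. \<forall>a \<in> carrier A. \<alpha> g a \<ominus>\<^bsub>A\<^esub> a \<in> P}"

lemma act_ring_hom: "g \<in> carrier \<Gamma> \<Longrightarrow> ring_hom_cring A A (\<alpha> g)"
  by (intro ring_hom_cring.intro ring_hom_cring_axioms.intro A.is_cring act_hom)

lemma act_closed: "g \<in> carrier \<Gamma> \<Longrightarrow> a \<in> carrier A \<Longrightarrow> \<alpha> g a \<in> carrier A"
  using act_hom ring_hom_closed by fast

text \<open>Closure under products holds since \<open>g h a - a = (g (h a) - h a) + (h a - a)\<close>; closure under inverses
  follows on replacing \<open>a\<close> by \<open>g\<^sup>-\<^sup>1 a\<close>.\<close>

lemma inertia_subgroup_of: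
  assumes "ideal P A"
  shows "subgroup (inertia P) \<Gamma>"
proof (rule G.subgroupI)
  interpret P: ideal P A by fact
  show "inertia P \<subseteq> carrier \<Gamma>" unfolding inertia_def by auto
  have "\<one>\<^bsub>\<Gamma>\<^esub> \<in> inertia P" unfolding inertia_def by (simp add: act_one A.minus_eq A.r_neg)
  then show "inertia P \<noteq> {}" by auto
  fix g assume "g \<in> inertia P"
  then have g: "g \<in> carrier \<Gamma>" "\<And>a. a \<in> carrier A \<Longrightarrow> \<alpha> g a \<ominus>\<^bsub>A\<^esub> a \<in> P"
    unfolding inertia_def by auto
  show "inv\<^bsub>\<Gamma>\<^esub> g \<in> inertia P"
    unfolding inertia_def
  proof safe
    show "inv\<^bsub>\<Gamma>\<^esub> g \<in> carrier \<Gamma>" using g by simp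
    fix a assume a: "a \<in> carrier A"
    let ?c = "\<alpha> (inv\<^bsub>\<Gamma>\<^esub> g) a"
    have c: "?c \<in> carrier A" using act_closed a g by simp
    have gc: "\<alpha> g ?c = a" using act_mult[of g "inv\<^bsub>\<Gamma>\<^esub> g" a] a g by (simp add: act_one)
    have "\<ominus>\<^bsub>A\<^esub> (\<alpha> g ?c \<ominus>\<^bsub>A\<^esub> ?c) \<in> P" using g(2)[OF c] by (rule P.a_inv_closed)
    moreover have "\<ominus>\<^bsub>A\<^esub> (\<alpha> g ?c \<ominus>\<^bsub>A\<^esub> ?c) = ?c \<ominus>\<^bsub>A\<^esub> a" unfolding gc using a c by algebra
    ultimately show "?c \<ominus>\<^bsub>A\<^esub> a \<in> P" by simp
  qed
  fix h assume "h \<in> inertia P"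
  then have h: "h \<in> carrier \<Gamma>" "\<And>a. a \<in> carrier A \<Longrightarrow> \<alpha> h a \<ominus>\<^bsub>A\<^esub> a \<in> P"
    unfolding inertia_def by auto
  show "g \<otimes>\<^bsub>\<Gamma>\<^esub> h \<in> inertia P"
    unfolding inertia_def
  proof safe
    show "g \<otimes>\<^bsub>\<Gamma>\<^esub> h \<in> carrier \<Gamma>" using g h by simp
    fix a assume a: "a \<in> carrier A"
    have c: "\<alpha> h a \<in> carrier A" "\<alpha> g (\<alpha> h a) \<in> carrier A" using act_closed a g h by auto
    have "(\<alpha> g (\<alpha> h a) \<ominus>\<^bsub>A\<^esub> \<alpha> h a) \<oplus>\<^bsub>A\<^esub> (\<alpha> h a \<ominus>\<^bsub>A\<^esub> a) \<in> P"
      using g(2)[OF c(1)] h(2)[OF a] by (rule P.a_closed)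
    moreover have "(\<alpha> g (\<alpha> h a) \<ominus>\<^bsub>A\<^esub> \<alpha> h a) \<oplus>\<^bsub>A\<^esub> (\<alpha> h a \<ominus>\<^bsub>A\<^esub> a) = \<alpha> g (\<alpha> h a) \<ominus>\<^bsub>A\<^esub> a"
      using a c by algebra
    ultimately show "\<alpha> (g \<otimes>\<^bsub>\<Gamma>\<^esub> h) a \<ominus>\<^bsub>A\<^esub> a \<in> P" using act_mult[OF g(1) h(1) a] by simp
  qed
qed

text \<open>Suppose that \<open>g\<close> acts trivially modulo \<open>P\<close> on all invariants of the inertia group \<open>I\<close>. For any \<open>a\<close> the
  polynomial \<open>\<Prod>(X - s a)\<close> over \<open>s \<in> I\<close> vanishes at \<open>a\<close>, and its coefficients are invariants of \<open>I\<close>.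
  Applying \<open>g\<close> shows that its value at \<open>g a\<close> lies in \<open>P\<close>. As \<open>P\<close> is prime, \<open>g a\<close> is congruent to some
  \<open>s a\<close> and therefore to \<open>a\<close>; hence \<open>g\<close> belongs to \<open>I\<close>.\<close>

lemma exists_separating_invariant:
  assumes P: "primeideal P A" and g: "g \<in> carrier \<Gamma>" "g \<notin> inertia P"
  shows "\<exists>b \<in> fixed_ring (inertia P). \<alpha> g b \<ominus>\<^bsub>A\<^esub> b \<notin> P"
proof (rule ccontr)
  assume "\<not> ?thesis"
  then have triv: "\<And>b. b \<in> fixed_ring (inertia P) \<Longrightarrow> \<alpha> g b \<ominus>\<^bsub>A\<^esub> b \<in> P" by blast
  interpret P: primeideal P A by fact
  interpret g: ring_hom_cring A A "\<alpha> g" by (rule act_ring_hom[OF g(1)])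
  obtain a where a: "a \<in> carrier A" "\<alpha> g a \<ominus>\<^bsub>A\<^esub> a \<notin> P" using g unfolding inertia_def by auto
  let ?I = "inertia P"
  have sub: "subgroup ?I \<Gamma>" by (rule inertia_subgroup_of) (rule P.is_ideal)
  have Ic: "?I \<subseteq> carrier \<Gamma>" using sub by (rule subgroup.subset)
  have fin: "finite ?I" using finite_subset[OF Ic finite_group] .
  define f where "f s = \<alpha> s a" for s
  have f: "f \<in> ?I \<rightarrow> carrier A" unfolding f_def using act_closed a Ic by auto
  let ?e = "A.elem_sym f ?I"
  let ?n = "card ?I"
  have ec: "?e j \<in> carrier A" for j by (rule A.elem_sym_closed[OF f])
  have e_inv: "?e j \<in> fixed_ring ?I" for j
  proof -
    have "\<alpha> t (?e j) = ?e j" if t: "t \<in> ?I" for t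
    proof (rule A.elem_sym_invariant[OF act_hom f _ _ fin])
      show tc: "t \<in> carrier \<Gamma>" using t Ic by auto
      show "bij_betw (\<lambda>s. t \<otimes>\<^bsub>\<Gamma>\<^esub> s) ?I ?I"
      proof (rule bij_betw_imageI)
        show inj: "inj_on (\<lambda>s. t \<otimes>\<^bsub>\<Gamma>\<^esub> s) ?I" using tc Ic by (auto simp: inj_on_def subset_iff)
        have "(\<lambda>s. t \<otimes>\<^bsub>\<Gamma>\<^esub> s) ` ?I \<subseteq> ?I" using subgroup.m_closed[OF sub t] by auto
        then show "(\<lambda>s. t \<otimes>\<^bsub>\<Gamma>\<^esub> s) ` ?I = ?I" using inj fin by (simp add: endo_inj_surj)
      qed
      show "\<alpha> t (f s) = f (t \<otimes>\<^bsub>\<Gamma>\<^esub> s)" if "s \<in> ?I" for s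
        unfolding f_def using act_mult[OF tc _ a(1), of s] that Ic by auto
    qed
    then show ?thesis unfolding fixed_ring_def using ec by auto
  qed
  have ga: "\<alpha> g a \<in> carrier A" using act_closed g a by auto
  have one: "\<one>\<^bsub>\<Gamma>\<^esub> \<in> ?I" by (rule subgroup.one_closed[OF sub])
  have "(\<Otimes>\<^bsub>A\<^esub>s\<in>?I. a \<ominus>\<^bsub>A\<^esub> f s) = (a \<ominus>\<^bsub>A\<^esub> f \<one>\<^bsub>\<Gamma>\<^esub>) \<otimes>\<^bsub>A\<^esub> (\<Otimes>\<^bsub>A\<^esub>s\<in>?I - {\<one>\<^bsub>\<Gamma>\<^esub>}. a \<ominus>\<^bsub>A\<^esub> f s)"
    using A.finprod_insert[of "?I - {\<one>\<^bsub>\<Gamma>\<^esub>}" "\<one>\<^bsub>\<Gamma>\<^esub>" "\<lambda>s. a \<ominus>\<^bsub>A\<^esub> f s"] fin one f a(1)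
    by (auto simp: insert_absorb Pi_iff)
  also have "\<dots> = \<zero>\<^bsub>A\<^esub>"
  proof -
    have "a \<ominus>\<^bsub>A\<^esub> f \<one>\<^bsub>\<Gamma>\<^esub> = \<zero>\<^bsub>A\<^esub>" unfolding f_def using a(1) by (simp add: act_one A.minus_eq A.r_neg)
    moreover have "(\<Otimes>\<^bsub>A\<^esub>s\<in>?I - {\<one>\<^bsub>\<Gamma>\<^esub>}. a \<ominus>\<^bsub>A\<^esub> f s) \<in> carrier A"
      by (rule A.finprod_closed) (use f a(1) in auto)
    ultimately show ?thesis by simp
  qed
  finally have zero: "(\<Oplus>\<^bsub>A\<^esub>j\<in>{..?n}. ?e j \<otimes>\<^bsub>A\<^esub> a [^]\<^bsub>A\<^esub> (?n - j)) = \<zero>\<^bsub>A\<^esub>"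
    unfolding A.finprod_minus_eq_sum_elem_sym[OF fin f a(1)] .
  let ?x = "\<lambda>j. \<alpha> g a [^]\<^bsub>A\<^esub> (?n - j)"
  have xc: "?x j \<in> carrier A" for j using ga by simp
  have gec: "\<alpha> g (?e j) \<in> carrier A" for j using act_closed g ec by auto
  have pow: "\<alpha> g (a [^]\<^bsub>A\<^esub> i) = \<alpha> g a [^]\<^bsub>A\<^esub> i" for i :: nat
    by (induction i) (use a(1) in auto)
  \<comment> \<open>apply \<open>g\<close> to the equation for \<open>a\<close> and split every coefficient as \<open>g e = (g e - e) + e\<close>\<close>
  have "\<zero>\<^bsub>A\<^esub> = \<alpha> g (\<Oplus>\<^bsub>A\<^esub>j\<in>{..?n}. ?e j \<otimes>\<^bsub>A\<^esub> a [^]\<^bsub>A\<^esub> (?n - j))"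
    unfolding zero by simp
  also have "\<dots> = (\<Oplus>\<^bsub>A\<^esub>j\<in>{..?n}. \<alpha> g (?e j) \<otimes>\<^bsub>A\<^esub> ?x j)"
    using ec a(1) by (subst g.hom_finsum) (auto simp: comp_def pow)
  also have "\<dots> = (\<Oplus>\<^bsub>A\<^esub>j\<in>{..?n}. (\<alpha> g (?e j) \<ominus>\<^bsub>A\<^esub> ?e j) \<otimes>\<^bsub>A\<^esub> ?x j \<oplus>\<^bsub>A\<^esub> ?e j \<otimes>\<^bsub>A\<^esub> ?x j)"
  proof (rule A.finsum_cong')
    fix j
    show "\<alpha> g (?e j) \<otimes>\<^bsub>A\<^esub> ?x j = (\<alpha> g (?e j) \<ominus>\<^bsub>A\<^esub> ?e j) \<otimes>\<^bsub>A\<^esub> ?x j \<oplus>\<^bsub>A\<^esub> ?e j \<otimes>\<^bsub>A\<^esub> ?x j"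
      using ec[of j] xc[of j] gec[of j] by algebra
  qed (use ec xc gec in auto)
  also have "\<dots> = (\<Oplus>\<^bsub>A\<^esub>j\<in>{..?n}. (\<alpha> g (?e j) \<ominus>\<^bsub>A\<^esub> ?e j) \<otimes>\<^bsub>A\<^esub> ?x j) \<oplus>\<^bsub>A\<^esub>
      (\<Oplus>\<^bsub>A\<^esub>j\<in>{..?n}. ?e j \<otimes>\<^bsub>A\<^esub> ?x j)"
    by (rule A.finsum_addf) (use ec xc gec in auto)
  finally have sum0: "\<zero>\<^bsub>A\<^esub> = (\<Oplus>\<^bsub>A\<^esub>j\<in>{..?n}. (\<alpha> g (?e j) \<ominus>\<^bsub>A\<^esub> ?e j) \<otimes>\<^bsub>A\<^esub> ?x j) \<oplus>\<^bsub>A\<^esub>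
      (\<Oplus>\<^bsub>A\<^esub>j\<in>{..?n}. ?e j \<otimes>\<^bsub>A\<^esub> ?x j)" .
  let ?d = "\<Oplus>\<^bsub>A\<^esub>j\<in>{..?n}. (\<alpha> g (?e j) \<ominus>\<^bsub>A\<^esub> ?e j) \<otimes>\<^bsub>A\<^esub> ?x j"
  let ?q = "\<Oplus>\<^bsub>A\<^esub>j\<in>{..?n}. ?e j \<otimes>\<^bsub>A\<^esub> ?x j"
  have d: "?d \<in> P" by (rule P.finsum_mem) (use triv[OF e_inv] xc P.I_r_closed in auto)
  have qc: "?q \<in> carrier A" by (rule A.finsum_closed) (use ec xc in auto)
  have dc: "?d \<in> carrier A" using d by (rule P.a_Hcarr)
  have "\<ominus>\<^bsub>A\<^esub> ?d = ?q"
    by (rule A.minus_equality[OF trans[OF A.a_comm[OF qc dc] sum0[symmetric]] dc qc])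
  with P.a_inv_closed[OF d] have "?q \<in> P" by (rule subst[rotated])
  then have "(\<Otimes>\<^bsub>A\<^esub>s\<in>?I. \<alpha> g a \<ominus>\<^bsub>A\<^esub> f s) \<in> P"
    unfolding A.finprod_minus_eq_sum_elem_sym[OF fin f ga] .
  then obtain s where s: "s \<in> ?I" "\<alpha> g a \<ominus>\<^bsub>A\<^esub> f s \<in> P"
    using P.finprod_mem_imp[OF fin, of "\<lambda>s. \<alpha> g a \<ominus>\<^bsub>A\<^esub> f s"] ga f by auto
  have "f s \<ominus>\<^bsub>A\<^esub> a \<in> P" using s(1) a(1) unfolding f_def inertia_def by auto
  then have "(\<alpha> g a \<ominus>\<^bsub>A\<^esub> f s) \<oplus>\<^bsub>A\<^esub> (f s \<ominus>\<^bsub>A\<^esub> a) \<in> P" by (rule P.a_closed[OF s(2)])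
  moreover have "f s \<in> carrier A" using s(1) f by auto
  then have "(\<alpha> g a \<ominus>\<^bsub>A\<^esub> f s) \<oplus>\<^bsub>A\<^esub> (f s \<ominus>\<^bsub>A\<^esub> a) = \<alpha> g a \<ominus>\<^bsub>A\<^esub> a"
    using ga a(1) by algebra
  ultimately show False using a(2) by simp
qed

end

section \<open>Descent of bases of fixed vectors\<close>

context group
begin

lemma inv_mult_cancel_left:
  assumes "a \<in> carrier G" "b \<in> carrier G" "c \<in> carrier G"
  shows "inv (c \<otimes> a) \<otimes> (c \<otimes> b) = inv a \<otimes> b"
proof -
  have "inv c \<otimes> (c \<otimes> b) = b" using assms by (simp add: m_assoc[symmetric])
  then show ?thesis using assms by (simp add: inv_mult_group m_assoc)
qed

lemma exists_left_transversal:
  assumes I: "subgroup I G"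
  shows "\<exists>T \<subseteq> carrier G. \<forall>g \<in> carrier G. \<exists>!r. r \<in> T \<and> inv r \<otimes> g \<in> I"
proof -
  define rep where "rep g = (SOME x. x \<in> carrier G \<and> inv x \<otimes> g \<in> I)" for g
  have rep: "rep g \<in> carrier G \<and> inv (rep g) \<otimes> g \<in> I" if "g \<in> carrier G" for g
    unfolding rep_def
    by (rule someI[of _ g]) (use that subgroup.one_closed[OF I] in simp)
  have trans_I: "inv x \<otimes> h \<in> I"
    if c: "x \<in> carrier G" "g \<in> carrier G" "h \<in> carrier G" and xg: "inv x \<otimes> g \<in> I"
      and gh: "inv g \<otimes> h \<in> I" for x g h
  proof -
    have "(inv x \<otimes> g) \<otimes> (inv g \<otimes> h) \<in> I" using xg gh by (rule subgroup.m_closed[OF I])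
    moreover have "g \<otimes> (inv g \<otimes> h) = h" using c by (simp add: m_assoc[symmetric])
    ultimately show ?thesis using c by (simp add: m_assoc)
  qed
  have sym_I: "inv h \<otimes> g \<in> I" if "g \<in> carrier G" "h \<in> carrier G" "inv g \<otimes> h \<in> I" for g h
    using subgroup.m_inv_closed[OF I that(3)] that(1,2) by (simp add: inv_mult_group)
  have rep_eq: "rep g = rep h" if "g \<in> carrier G" "h \<in> carrier G" "inv g \<otimes> h \<in> I" for g h
  proof -
    have "(x \<in> carrier G \<and> inv x \<otimes> g \<in> I) = (x \<in> carrier G \<and> inv x \<otimes> h \<in> I)" for x
      using trans_I[of x g h] trans_I[of x h g] that sym_I[OF that] by blast
    then show ?thesis unfolding rep_def by simp
  qed
  have "\<exists>!r. r \<in> rep ` carrier G \<and> inv r \<otimes> g \<in> I" if g: "g \<in> carrier G" for g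
  proof (rule ex1I[of _ "rep g"])
    fix r assume r: "r \<in> rep ` carrier G \<and> inv r \<otimes> g \<in> I"
    then obtain h where h: "h \<in> carrier G" "r = rep h" by auto
    have "inv (rep h) \<otimes> h \<in> I" "rep h \<in> carrier G" using rep[OF h(1)] by auto
    then have "inv h \<otimes> g \<in> I"
      using trans_I[of h "rep h" g] sym_I[of "rep h" h] r h g by auto
    then show "r = rep g" using rep_eq[of h g] h g by simp
  qed (use rep[OF g] g in auto)
  then show ?thesis using rep by (intro exI[of _ "rep ` carrier G"]) auto
qed

end

context semilinear_action
begin

lemma vact_zero: "g \<in> carrier \<Gamma> \<Longrightarrow> \<beta> g \<zero>\<^bsub>V\<^esub> = \<zero>\<^bsub>V\<^esub>"
  using vact_smult[of g "\<zero>\<^bsub>A\<^esub>" "\<zero>\<^bsub>V\<^esub>"] vact_closed[of g "\<zero>\<^bsub>V\<^esub>"]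
    ring_hom_cring.hom_zero[OF act_ring_hom, of g] by simp

lemma vact_finsum:
  assumes g: "g \<in> carrier \<Gamma>" and f: "\<And>s. s \<in> S \<Longrightarrow> f s \<in> carrier V"
  shows "\<beta> g (\<Oplus>\<^bsub>V\<^esub>s\<in>S. f s) = (\<Oplus>\<^bsub>V\<^esub>s\<in>S. \<beta> g (f s))"
  using f
proof (induction S rule: infinite_finite_induct)
  case (insert s S)
  have f: "f \<in> S \<rightarrow> carrier V" "f s \<in> carrier V" "(\<lambda>s. \<beta> g (f s)) \<in> S \<rightarrow> carrier V"
    "\<beta> g (f s) \<in> carrier V" "(\<Oplus>\<^bsub>V\<^esub>s\<in>S. f s) \<in> carrier V"
    using insert.prems vact_closed[OF g] by (auto intro!: V.finsum_closed)
  show ?case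
    using f insert.hyps insert.IH insert.prems g by (simp add: V.finsum_insert vact_add)
qed (use g vact_zero in auto)

text \<open>Since \<open>v\<close> is fixed by \<open>I\<close>, the vector \<open>\<beta> r v\<close> depends only on the coset \<open>r I\<close>, and left translation
  permutes the cosets.\<close>

lemma trace_invariant:
  assumes I: "subgroup I \<Gamma>" and T: "T \<subseteq> carrier \<Gamma>"
    and tr: "\<And>g. g \<in> carrier \<Gamma> \<Longrightarrow> \<exists>!r. r \<in> T \<and> inv\<^bsub>\<Gamma>\<^esub> r \<otimes>\<^bsub>\<Gamma>\<^esub> g \<in> I"
    and v: "v \<in> fixed_vectors I"
  shows "(\<Oplus>\<^bsub>V\<^esub>r\<in>T. \<beta> r v) \<in> fixed_vectors (carrier \<Gamma>)"
proof -
  have vc: "v \<in> carrier V" and vI: "\<And>g. g \<in> I \<Longrightarrow> \<beta> g v = v"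
    using v unfolding fixed_vectors_def by auto
  have c: "\<beta> r v \<in> carrier V" if "r \<in> T" for r using that T vc by (auto intro: vact_closed)
  have "\<beta> h (\<Oplus>\<^bsub>V\<^esub>r\<in>T. \<beta> r v) = (\<Oplus>\<^bsub>V\<^esub>r\<in>T. \<beta> r v)" if h: "h \<in> carrier \<Gamma>" for h
  proof -
    define p where "p r = (THE q. q \<in> T \<and> inv\<^bsub>\<Gamma>\<^esub> q \<otimes>\<^bsub>\<Gamma>\<^esub> (h \<otimes>\<^bsub>\<Gamma>\<^esub> r) \<in> I)" for r
    have p: "p r \<in> T \<and> inv\<^bsub>\<Gamma>\<^esub> (p r) \<otimes>\<^bsub>\<Gamma>\<^esub> (h \<otimes>\<^bsub>\<Gamma>\<^esub> r) \<in> I" if "r \<in> T" for r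
      unfolding p_def by (rule theI'[OF tr]) (use h that T in auto)
    have inj: "inj_on p T"
    proof (rule inj_onI)
      fix r s assume rs: "r \<in> T" "s \<in> T" "p r = p s"
      let ?c = "inv\<^bsub>\<Gamma>\<^esub> (p r) \<otimes>\<^bsub>\<Gamma>\<^esub> h"
      have car: "r \<in> carrier \<Gamma>" "s \<in> carrier \<Gamma>" "p r \<in> carrier \<Gamma>" "?c \<in> carrier \<Gamma>"
        using rs p[OF rs(1)] T h by auto
      have "?c \<otimes>\<^bsub>\<Gamma>\<^esub> r \<in> I" "?c \<otimes>\<^bsub>\<Gamma>\<^esub> s \<in> I"
        using p[OF rs(1)] p[OF rs(2)] rs(3) car h by (simp_all add: G.m_assoc)
      then have "inv\<^bsub>\<Gamma>\<^esub> (?c \<otimes>\<^bsub>\<Gamma>\<^esub> r) \<otimes>\<^bsub>\<Gamma>\<^esub> (?c \<otimes>\<^bsub>\<Gamma>\<^esub> s) \<in> I"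
        using subgroup.m_inv_closed[OF I] subgroup.m_closed[OF I] by simp
      then have "inv\<^bsub>\<Gamma>\<^esub> r \<otimes>\<^bsub>\<Gamma>\<^esub> s \<in> I" using G.inv_mult_cancel_left[OF car(1,2,4)] by simp
      moreover have "inv\<^bsub>\<Gamma>\<^esub> s \<otimes>\<^bsub>\<Gamma>\<^esub> s \<in> I" using subgroup.one_closed[OF I] car by simp
      ultimately show "r = s" using tr[OF car(2)] rs(1,2) by blast
    qed
    have fin: "finite T" using T finite_group finite_subset by auto
    have surj: "p ` T = T" by (rule endo_inj_surj[OF fin _ inj]) (use p in auto)
    have "\<beta> h (\<Oplus>\<^bsub>V\<^esub>r\<in>T. \<beta> r v) = (\<Oplus>\<^bsub>V\<^esub>r\<in>T. \<beta> h (\<beta> r v))"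
      by (rule vact_finsum[OF h c])
    also have "\<dots> = (\<Oplus>\<^bsub>V\<^esub>r\<in>T. \<beta> (p r) v)"
    proof (rule V.finsum_cong')
      fix r assume r: "r \<in> T"
      let ?t = "inv\<^bsub>\<Gamma>\<^esub> (p r) \<otimes>\<^bsub>\<Gamma>\<^esub> (h \<otimes>\<^bsub>\<Gamma>\<^esub> r)"
      have car: "r \<in> carrier \<Gamma>" "p r \<in> carrier \<Gamma>" using r p[OF r] T by auto
      have "p r \<otimes>\<^bsub>\<Gamma>\<^esub> ?t = h \<otimes>\<^bsub>\<Gamma>\<^esub> r" using car h by (simp add: G.m_assoc[symmetric])
      then have "\<beta> h (\<beta> r v) = \<beta> (p r) (\<beta> ?t v)"
        using vact_mult[of h r v] vact_mult[of "p r" ?t v] car h vc by simp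
      then show "\<beta> h (\<beta> r v) = \<beta> (p r) v" using vI[of ?t] p[OF r] by simp
    next
      show "(\<lambda>r. \<beta> (p r) v) \<in> T \<rightarrow> carrier V" using p c by auto
    qed simp
    also have "\<dots> = (\<Oplus>\<^bsub>V\<^esub>r\<in>p ` T. \<beta> r v)"
      by (rule V.finsum_reindex[symmetric, OF _ inj]) (use surj c in auto)
    finally show ?thesis unfolding surj .
  qed
  moreover have "(\<Oplus>\<^bsub>V\<^esub>r\<in>T. \<beta> r v) \<in> carrier V" by (rule V.finsum_closed) (use c in auto)
  ultimately show ?thesis unfolding fixed_vectors_def by auto
qed

lemma fixed_vectors_smult:
  assumes "H \<subseteq> carrier \<Gamma>" "b \<in> fixed_ring H" "v \<in> fixed_vectors H"
  shows "b \<odot>\<^bsub>V\<^esub> v \<in> fixed_vectors H"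
  using assms vact_smult unfolding fixed_vectors_def fixed_ring_def by (auto simp: subset_iff)

lemma one_fixed: "H \<subseteq> carrier \<Gamma> \<Longrightarrow> \<one>\<^bsub>A\<^esub> \<in> fixed_ring H"
  unfolding fixed_ring_def using ring_hom_one[OF act_hom] by auto

text \<open>For every invariant \<open>b\<close> of the inertia group \<open>I\<close> the trace \<open>\<Sum> r (b v)\<close> over representatives \<open>r\<close> of
  the cosets of \<open>I\<close> is fixed by the whole group and lies in \<open>N\<close>. The terms with \<open>r \<notin> I\<close> are
  removed one after the other: combining the sums for \<open>b\<^sub>0 b\<close> and \<open>b\<close> multiplies the \<open>r\<close>-th term by
  \<open>r b\<^sub>0 - g b\<^sub>0\<close>, which vanishes for \<open>r = g\<close> and, if \<open>b\<^sub>0\<close> separates \<open>g\<close> from \<open>I\<close> modulo \<open>P\<close>, is outside \<open>P\<close>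
  for the representative of \<open>I\<close> itself. The last remaining term is a multiple of \<open>v\<close>.\<close>

lemma exists_localized_multiple:
  assumes P: "primeideal P A"
    and N: "submodule A N V" "fixed_vectors (carrier \<Gamma>) \<subseteq> N"
    and v: "v \<in> fixed_vectors (inertia P)"
  shows "\<exists>s \<in> carrier A - P. s \<odot>\<^bsub>V\<^esub> v \<in> N"
proof -
  let ?I = "inertia P"
  interpret P: primeideal P A by fact
  interpret N: submodule A N V by fact
  have I: "subgroup ?I \<Gamma>" by (rule inertia_subgroup_of) (rule P.is_ideal)
  have Ic: "?I \<subseteq> carrier \<Gamma>" using I by (rule subgroup.subset)
  obtain T where T: "T \<subseteq> carrier \<Gamma>"
    and tr': "\<forall>g \<in> carrier \<Gamma>. \<exists>!r. r \<in> T \<and> inv\<^bsub>\<Gamma>\<^esub> r \<otimes>\<^bsub>\<Gamma>\<^esub> g \<in> ?I"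
    using G.exists_left_transversal[OF I] by (elim exE conjE) (rule that)
  note tr = bspec[OF tr']
  have fin: "finite T" using T finite_group finite_subset by auto
  obtain r0 where r0': "r0 \<in> T \<and> inv\<^bsub>\<Gamma>\<^esub> r0 \<otimes>\<^bsub>\<Gamma>\<^esub> \<one>\<^bsub>\<Gamma>\<^esub> \<in> ?I"
    and r0_uniq: "\<forall>r. r \<in> T \<and> inv\<^bsub>\<Gamma>\<^esub> r \<otimes>\<^bsub>\<Gamma>\<^esub> \<one>\<^bsub>\<Gamma>\<^esub> \<in> ?I \<longrightarrow> r = r0"
    using tr[OF G.one_closed] by (elim ex1E) (rule that)
  note r0 = conjunct1[OF r0'] conjunct2[OF r0']
  have r0I: "r0 \<in> ?I" using subgroup.m_inv_closed[OF I r0(2)] r0(1) T by auto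
  have notI: "r \<notin> ?I" if r: "r \<in> T" "r \<noteq> r0" for r
  proof
    assume "r \<in> ?I"
    then have "inv\<^bsub>\<Gamma>\<^esub> r \<otimes>\<^bsub>\<Gamma>\<^esub> \<one>\<^bsub>\<Gamma>\<^esub> \<in> ?I"
      using subgroup.m_inv_closed[OF I, of r] r(1) T by auto
    then have "r = r0" by (intro r0_uniq[THEN spec, THEN mp] conjI r(1))
    then show False using r(2) by simp
  qed
  have vc: "v \<in> carrier V" using v unfolding fixed_vectors_def by auto
  \<comment> \<open>the quantifier over \<open>b\<close> keeps the property stable under the elimination step, which passes
    from \<open>b\<close> to \<open>b\<^sub>0 b\<close>\<close>
  define ok where "ok c \<longleftrightarrow> (\<forall>b \<in> fixed_ring ?I.
      (\<Oplus>\<^bsub>V\<^esub>r\<in>T. c r \<odot>\<^bsub>V\<^esub> \<beta> r (b \<odot>\<^bsub>V\<^esub> v)) \<in> N)" for c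
  have bc: "b \<in> carrier A" if "b \<in> fixed_ring ?I" for b using that unfolding fixed_ring_def by auto
  have "\<exists>c. c \<in> T \<rightarrow> carrier A \<and> ok c \<and> (\<forall>r \<in> Y. c r = \<zero>\<^bsub>A\<^esub>) \<and> c r0 \<notin> P"
    if "finite Y" "Y \<subseteq> T - {r0}" for Y
    using that
  proof (induction Y)
    case empty
    have "ok (\<lambda>r. \<one>\<^bsub>A\<^esub>)"
      unfolding ok_def
    proof
      fix b assume b: "b \<in> fixed_ring ?I"
      have bv: "b \<odot>\<^bsub>V\<^esub> v \<in> fixed_vectors ?I" by (rule fixed_vectors_smult[OF Ic b v])
      have "(\<Oplus>\<^bsub>V\<^esub>r\<in>T. \<one>\<^bsub>A\<^esub> \<odot>\<^bsub>V\<^esub> \<beta> r (b \<odot>\<^bsub>V\<^esub> v)) = (\<Oplus>\<^bsub>V\<^esub>r\<in>T. \<beta> r (b \<odot>\<^bsub>V\<^esub> v))"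
        by (rule V.finsum_cong') (use T vc bc[OF b] in \<open>auto intro!: V.smult_one vact_closed\<close>)
      also have "\<dots> \<in> N" using trace_invariant[OF I T tr bv] N(2) by auto
      finally show "(\<Oplus>\<^bsub>V\<^esub>r\<in>T. \<one>\<^bsub>A\<^esub> \<odot>\<^bsub>V\<^esub> \<beta> r (b \<odot>\<^bsub>V\<^esub> v)) \<in> N" .
    qed
    then show ?case using P.I_notcarr P.one_imp_carrier by (intro exI[of _ "\<lambda>r. \<one>\<^bsub>A\<^esub>"]) auto
  next
    case (insert g Y)
    then obtain c where c: "c \<in> T \<rightarrow> carrier A" "ok c" "\<forall>r \<in> Y. c r = \<zero>\<^bsub>A\<^esub>" "c r0 \<notin> P"
      by auto
    have g: "g \<in> T" "g \<in> carrier \<Gamma>" "g \<notin> ?I" using insert.prems notI T by auto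
    obtain b0 where b0: "b0 \<in> fixed_ring ?I" "\<alpha> g b0 \<ominus>\<^bsub>A\<^esub> b0 \<notin> P"
      using exists_separating_invariant[OF P g(2,3)] by auto
    have b0c: "b0 \<in> carrier A" using bc[OF b0(1)] .
    have gbc: "\<alpha> r b0 \<in> carrier A" if "r \<in> T" for r using that T b0c by (auto intro: act_closed)
    define c' where "c' r = c r \<otimes>\<^bsub>A\<^esub> (\<alpha> r b0 \<ominus>\<^bsub>A\<^esub> \<alpha> g b0)" for r
    have c'c: "c' \<in> T \<rightarrow> carrier A" unfolding c'_def using c(1) gbc g(1) by auto
    have "ok c'"
      unfolding ok_def
    proof
      fix b assume b: "b \<in> fixed_ring ?I"
      let ?u = "\<lambda>r. c r \<odot>\<^bsub>V\<^esub> \<beta> r ((b0 \<otimes>\<^bsub>A\<^esub> b) \<odot>\<^bsub>V\<^esub> v)"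
      let ?w = "\<lambda>r. c r \<odot>\<^bsub>V\<^esub> \<beta> r (b \<odot>\<^bsub>V\<^esub> v)"
      have bvc: "b \<odot>\<^bsub>V\<^esub> v \<in> carrier V" using bc[OF b] vc by auto
      have u: "?u \<in> T \<rightarrow> carrier V" and w: "?w \<in> T \<rightarrow> carrier V"
        using c(1) T b0c bc[OF b] vc by (auto intro!: V.smult_closed vact_closed)
      have b0b: "b0 \<otimes>\<^bsub>A\<^esub> b \<in> fixed_ring ?I"
        using b0(1) b Ic unfolding fixed_ring_def by (auto simp: ring_hom_mult[OF act_hom])
      have "(\<Oplus>\<^bsub>V\<^esub>r\<in>T. c' r \<odot>\<^bsub>V\<^esub> \<beta> r (b \<odot>\<^bsub>V\<^esub> v)) =
          (\<Oplus>\<^bsub>V\<^esub>r\<in>T. ?u r \<oplus>\<^bsub>V\<^esub> (\<ominus>\<^bsub>A\<^esub> \<alpha> g b0) \<odot>\<^bsub>V\<^esub> ?w r)"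
      proof (rule V.finsum_cong')
        fix r assume r: "r \<in> T"
        have car: "c r \<in> carrier A" "\<alpha> r b0 \<in> carrier A" "\<alpha> g b0 \<in> carrier A" "\<beta> r (b \<odot>\<^bsub>V\<^esub> v) \<in> carrier V"
          "r \<in> carrier \<Gamma>"
          using r c(1) gbc g(1) T bvc by (auto intro: vact_closed)
        have "\<beta> r ((b0 \<otimes>\<^bsub>A\<^esub> b) \<odot>\<^bsub>V\<^esub> v) = \<alpha> r b0 \<odot>\<^bsub>V\<^esub> \<beta> r (b \<odot>\<^bsub>V\<^esub> v)"
          using V.smult_assoc1[OF b0c bc[OF b] vc] vact_smult[OF car(5) b0c bvc] by simp
        moreover have "c' r = c r \<otimes>\<^bsub>A\<^esub> \<alpha> r b0 \<oplus>\<^bsub>A\<^esub> (\<ominus>\<^bsub>A\<^esub> \<alpha> g b0) \<otimes>\<^bsub>A\<^esub> c r"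
          unfolding c'_def using car(1-3) by algebra
        ultimately show "c' r \<odot>\<^bsub>V\<^esub> \<beta> r (b \<odot>\<^bsub>V\<^esub> v) = ?u r \<oplus>\<^bsub>V\<^esub> (\<ominus>\<^bsub>A\<^esub> \<alpha> g b0) \<odot>\<^bsub>V\<^esub> ?w r"
          using car by (simp add: V.smult_l_distr V.smult_assoc1)
      next
        show "(\<lambda>r. ?u r \<oplus>\<^bsub>V\<^esub> (\<ominus>\<^bsub>A\<^esub> \<alpha> g b0) \<odot>\<^bsub>V\<^esub> ?w r) \<in> T \<rightarrow> carrier V"
        proof
          fix r assume r: "r \<in> T"
          show "?u r \<oplus>\<^bsub>V\<^esub> (\<ominus>\<^bsub>A\<^esub> \<alpha> g b0) \<odot>\<^bsub>V\<^esub> ?w r \<in> carrier V"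
            using funcset_mem[OF u r] funcset_mem[OF w r] gbc[OF g(1)] by simp
        qed
      qed simp
      also have "\<dots> = (\<Oplus>\<^bsub>V\<^esub>r\<in>T. ?u r) \<oplus>\<^bsub>V\<^esub> (\<Oplus>\<^bsub>V\<^esub>r\<in>T. (\<ominus>\<^bsub>A\<^esub> \<alpha> g b0) \<odot>\<^bsub>V\<^esub> ?w r)"
        by (rule V.finsum_addf[OF u]) (use funcset_mem[OF w] gbc[OF g(1)] in auto)
      also have "(\<Oplus>\<^bsub>V\<^esub>r\<in>T. (\<ominus>\<^bsub>A\<^esub> \<alpha> g b0) \<odot>\<^bsub>V\<^esub> ?w r) = (\<ominus>\<^bsub>A\<^esub> \<alpha> g b0) \<odot>\<^bsub>V\<^esub> (\<Oplus>\<^bsub>V\<^esub>r\<in>T. ?w r)"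
        by (rule V.finsum_smult_ldistr[symmetric, OF fin _ w]) (use gbc[OF g(1)] in auto)
      finally have eq: "(\<Oplus>\<^bsub>V\<^esub>r\<in>T. c' r \<odot>\<^bsub>V\<^esub> \<beta> r (b \<odot>\<^bsub>V\<^esub> v)) =
          (\<Oplus>\<^bsub>V\<^esub>r\<in>T. ?u r) \<oplus>\<^bsub>V\<^esub> (\<ominus>\<^bsub>A\<^esub> \<alpha> g b0) \<odot>\<^bsub>V\<^esub> (\<Oplus>\<^bsub>V\<^esub>r\<in>T. ?w r)" .
      have "(\<Oplus>\<^bsub>V\<^esub>r\<in>T. ?u r) \<in> N" "(\<Oplus>\<^bsub>V\<^esub>r\<in>T. ?w r) \<in> N"
        using c(2) b b0b unfolding ok_def by auto
      then show "(\<Oplus>\<^bsub>V\<^esub>r\<in>T. c' r \<odot>\<^bsub>V\<^esub> \<beta> r (b \<odot>\<^bsub>V\<^esub> v)) \<in> N"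
        unfolding eq using gbc[OF g(1)] by auto
    qed
    moreover have "c' r = \<zero>\<^bsub>A\<^esub>" if "r \<in> insert g Y" for r
    proof (cases "r = g")
      case True
      then show ?thesis unfolding c'_def using gbc[OF g(1)] funcset_mem[OF c(1) g(1)] by (simp add: A.minus_eq A.r_neg)
    next
      case False
      then have "r \<in> Y" "r \<in> T" using that insert.prems by auto
      then show ?thesis unfolding c'_def using c(3) gbc[of r] gbc[OF g(1)] by simp
    qed
    moreover have "c' r0 \<notin> P"
    proof
      assume "c' r0 \<in> P"
      then have "c r0 \<in> P \<or> \<alpha> r0 b0 \<ominus>\<^bsub>A\<^esub> \<alpha> g b0 \<in> P"
        unfolding c'_def using c(1) r0(1) gbc g(1) by (intro P.I_prime) auto
      moreover have "\<alpha> r0 b0 = b0" using b0(1) r0I unfolding fixed_ring_def by auto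
      ultimately have "b0 \<ominus>\<^bsub>A\<^esub> \<alpha> g b0 \<in> P" using c(4) by simp
      then have "\<ominus>\<^bsub>A\<^esub> (b0 \<ominus>\<^bsub>A\<^esub> \<alpha> g b0) \<in> P" by (rule P.a_inv_closed)
      moreover have "\<ominus>\<^bsub>A\<^esub> (b0 \<ominus>\<^bsub>A\<^esub> \<alpha> g b0) = \<alpha> g b0 \<ominus>\<^bsub>A\<^esub> b0"
        using b0c gbc[OF g(1)] by algebra
      ultimately show False using b0(2) by simp
    qed
    ultimately show ?case using c'c by (intro exI[of _ c']) auto
  qed
  from this[of "T - {r0}"] obtain c where c: "c \<in> T \<rightarrow> carrier A" "ok c"
    "\<And>r. r \<in> T \<Longrightarrow> r \<noteq> r0 \<Longrightarrow> c r = \<zero>\<^bsub>A\<^esub>" "c r0 \<notin> P"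
    using fin by auto
  have c0: "c r0 \<in> carrier A" using c(1) r0(1) by auto
  have rvc: "\<beta> r v \<in> carrier V" if "r \<in> T" for r using that T vc by (auto intro: vact_closed)
  have "(\<Oplus>\<^bsub>V\<^esub>r\<in>T. c r \<odot>\<^bsub>V\<^esub> \<beta> r (\<one>\<^bsub>A\<^esub> \<odot>\<^bsub>V\<^esub> v)) \<in> N"
    using c(2) one_fixed[OF Ic] unfolding ok_def by blast
  also have "(\<Oplus>\<^bsub>V\<^esub>r\<in>T. c r \<odot>\<^bsub>V\<^esub> \<beta> r (\<one>\<^bsub>A\<^esub> \<odot>\<^bsub>V\<^esub> v)) =
      (\<Oplus>\<^bsub>V\<^esub>r\<in>T. if r0 = r then c r \<odot>\<^bsub>V\<^esub> \<beta> r v else \<zero>\<^bsub>V\<^esub>)"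
    by (rule V.finsum_cong') (use c(3) funcset_mem[OF c(1)] rvc vc in auto)
  also have "\<dots> = c r0 \<odot>\<^bsub>V\<^esub> \<beta> r0 v"
    by (rule V.finsum_singleton[OF r0(1) fin]) (use funcset_mem[OF c(1)] rvc in auto)
  also have "\<beta> r0 v = v" using v r0I unfolding fixed_vectors_def by auto
  finally show ?thesis using c(4) c0 by blast
qed

text \<open>Left translation permutes the factors of the norm, and none of them vanishes because the group acts
  by injective maps on a domain.\<close>

lemma norm_fixed:
  assumes a: "a \<in> carrier A" "a \<noteq> \<zero>\<^bsub>A\<^esub>"
  shows "(\<Otimes>\<^bsub>A\<^esub>g\<in>carrier \<Gamma>. \<alpha> g a) \<in> fixed_ring (carrier \<Gamma>)"
    and "(\<Otimes>\<^bsub>A\<^esub>g\<in>carrier \<Gamma>. \<alpha> g a) \<noteq> \<zero>\<^bsub>A\<^esub>"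
proof -
  have c: "\<alpha> g a \<in> carrier A" if "g \<in> carrier \<Gamma>" for g using act_closed[OF that a(1)] .
  let ?n = "\<Otimes>\<^bsub>A\<^esub>g\<in>carrier \<Gamma>. \<alpha> g a"
  have "\<alpha> h ?n = ?n" if h: "h \<in> carrier \<Gamma>" for h
  proof -
    interpret h: ring_hom_cring A A "\<alpha> h" by (rule act_ring_hom[OF h])
    have inj: "inj_on (\<lambda>g. h \<otimes>\<^bsub>\<Gamma>\<^esub> g) (carrier \<Gamma>)" using h by (auto simp: inj_on_def)
    have surj: "(\<lambda>g. h \<otimes>\<^bsub>\<Gamma>\<^esub> g) ` carrier \<Gamma> = carrier \<Gamma>"
      by (rule endo_inj_surj[OF finite_group _ inj]) (use h in auto)
    have "\<alpha> h ?n = (\<Otimes>\<^bsub>A\<^esub>g\<in>carrier \<Gamma>. \<alpha> h (\<alpha> g a))"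
      using c by (subst h.hom_finprod) (auto simp: comp_def)
    also have "\<dots> = (\<Otimes>\<^bsub>A\<^esub>g\<in>carrier \<Gamma>. \<alpha> (h \<otimes>\<^bsub>\<Gamma>\<^esub> g) a)"
      by (rule A.finprod_cong') (use h c a(1) act_mult in auto)
    also have "\<dots> = (\<Otimes>\<^bsub>A\<^esub>g\<in>(\<lambda>g. h \<otimes>\<^bsub>\<Gamma>\<^esub> g) ` carrier \<Gamma>. \<alpha> g a)"
      by (rule A.finprod_reindex[symmetric, OF _ inj]) (use surj c in auto)
    finally show ?thesis unfolding surj .
  qed
  moreover have "?n \<in> carrier A" by (rule A.finprod_closed) (use c in auto)
  ultimately show "?n \<in> fixed_ring (carrier \<Gamma>)" unfolding fixed_ring_def by auto
  show "?n \<noteq> \<zero>\<^bsub>A\<^esub>"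
  proof
    assume "?n = \<zero>\<^bsub>A\<^esub>"
    then have "?n \<in> {\<zero>\<^bsub>A\<^esub>}" by simp
    then obtain g where g: "g \<in> carrier \<Gamma>" "\<alpha> g a \<in> {\<zero>\<^bsub>A\<^esub>}"
      using primeideal.finprod_mem_imp[OF A.zeroprimeideal finite_group, of "\<lambda>g. \<alpha> g a"] c by auto
    have "a = \<alpha> (inv\<^bsub>\<Gamma>\<^esub> g) (\<alpha> g a)"
      using act_mult[of "inv\<^bsub>\<Gamma>\<^esub> g" g a] g(1) a(1) by (simp add: act_one)
    also have "\<dots> = \<zero>\<^bsub>A\<^esub>" using g ring_hom_cring.hom_zero[OF act_ring_hom, of "inv\<^bsub>\<Gamma>\<^esub> g"] by simp
    finally show False using a(2) by simp
  qed
qed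

text \<open>The coefficients are restricted to a subset \<open>C\<close> of \<open>A\<close>, since the same vectors have to be compared
  over the rings of invariants of two groups and over \<open>A\<close>.\<close>

definition independent_over :: "'a set \<Rightarrow> 'v set \<Rightarrow> bool" where
  "independent_over C B \<longleftrightarrow> (\<forall>F c. finite F \<longrightarrow> F \<subseteq> B \<longrightarrow> c \<in> F \<rightarrow> C \<longrightarrow>
     (\<Oplus>\<^bsub>V\<^esub>v\<in>F. c v \<odot>\<^bsub>V\<^esub> v) = \<zero>\<^bsub>V\<^esub> \<longrightarrow> (\<forall>v \<in> F. c v = \<zero>\<^bsub>A\<^esub>))"

definition spans_over :: "'a set \<Rightarrow> 'v set \<Rightarrow> 'v set \<Rightarrow> bool" where
  "spans_over C B W \<longleftrightarrow> (\<forall>w \<in> W. \<exists>F c. finite F \<and> F \<subseteq> B \<and> c \<in> F \<rightarrow> C \<and>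
     w = (\<Oplus>\<^bsub>V\<^esub>v\<in>F. c v \<odot>\<^bsub>V\<^esub> v))"

text \<open>Artin's argument, by induction on the length of a relation: multiply it by the missing factors of
  the norm of one coefficient, so that this coefficient becomes invariant. Subtracting the image under a group
  element then gives a shorter relation, which must be trivial, so all coefficients are invariant
  and the hypothesis applies.\<close>

lemma independent_over_ring:
  assumes B: "B \<subseteq> fixed_vectors (carrier \<Gamma>)"
    and ind: "independent_over (fixed_ring (carrier \<Gamma>)) B"
  shows "independent_over (carrier A) B"
proof -
  have Bc: "v \<in> carrier V" "\<And>g. g \<in> carrier \<Gamma> \<Longrightarrow> \<beta> g v = v" if "v \<in> B" for v
    using that B unfolding fixed_vectors_def by auto
  have "\<forall>v \<in> F. x v = \<zero>\<^bsub>A\<^esub>"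
    if "finite F" "F \<subseteq> B" "x \<in> F \<rightarrow> carrier A" "(\<Oplus>\<^bsub>V\<^esub>v\<in>F. x v \<odot>\<^bsub>V\<^esub> v) = \<zero>\<^bsub>V\<^esub>" for F x
    using that
  proof (induction F arbitrary: x)
    case (insert w F)
    have w: "w \<in> carrier V" "w \<in> B" using insert.prems Bc by auto
    have FB: "F \<subseteq> B" using insert.prems by auto
    have Fc: "F \<subseteq> carrier V" using FB Bc by auto
    have split: "(\<Oplus>\<^bsub>V\<^esub>v\<in>insert w F. z v \<odot>\<^bsub>V\<^esub> v) = z w \<odot>\<^bsub>V\<^esub> w \<oplus>\<^bsub>V\<^esub> (\<Oplus>\<^bsub>V\<^esub>v\<in>F. z v \<odot>\<^bsub>V\<^esub> v)"
      "(\<Oplus>\<^bsub>V\<^esub>v\<in>F. z v \<odot>\<^bsub>V\<^esub> v) \<in> carrier V"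
      if z: "z \<in> insert w F \<rightarrow> carrier A" for z
    proof -
      have zc: "(\<lambda>v. z v \<odot>\<^bsub>V\<^esub> v) \<in> F \<rightarrow> carrier V" "z w \<odot>\<^bsub>V\<^esub> w \<in> carrier V"
        using z w Fc by auto
      show "(\<Oplus>\<^bsub>V\<^esub>v\<in>F. z v \<odot>\<^bsub>V\<^esub> v) \<in> carrier V" by (rule V.finsum_closed[OF zc(1)])
      show "(\<Oplus>\<^bsub>V\<^esub>v\<in>insert w F. z v \<odot>\<^bsub>V\<^esub> v) = z w \<odot>\<^bsub>V\<^esub> w \<oplus>\<^bsub>V\<^esub> (\<Oplus>\<^bsub>V\<^esub>v\<in>F. z v \<odot>\<^bsub>V\<^esub> v)"
        by (rule V.finsum_insert[OF insert.hyps zc])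
    qed
    have shrink: "\<forall>v \<in> F. z v = \<zero>\<^bsub>A\<^esub>"
      if z: "z \<in> insert w F \<rightarrow> carrier A" "(\<Oplus>\<^bsub>V\<^esub>v\<in>insert w F. z v \<odot>\<^bsub>V\<^esub> v) = \<zero>\<^bsub>V\<^esub>" "z w = \<zero>\<^bsub>A\<^esub>" for z
    proof (rule insert.IH[OF FB])
      show "z \<in> F \<rightarrow> carrier A" using z(1) by auto
      show "(\<Oplus>\<^bsub>V\<^esub>v\<in>F. z v \<odot>\<^bsub>V\<^esub> v) = \<zero>\<^bsub>V\<^esub>" using split[OF z(1)] z(2,3) w by simp
    qed
    show ?case
    proof (cases "x w = \<zero>\<^bsub>A\<^esub>")
      case True
      then show ?thesis using shrink[OF insert.prems(2,3)] by simp
    next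
      case False
      have xw: "x w \<in> carrier A" using insert.prems(2) by auto
      \<comment> \<open>the product of the other conjugates: \<open>x w \<otimes> n\<close> is the norm of \<open>x w\<close>\<close>
      define n where "n = (\<Otimes>\<^bsub>A\<^esub>g\<in>carrier \<Gamma> - {\<one>\<^bsub>\<Gamma>\<^esub>}. \<alpha> g (x w))"
      have nc: "n \<in> carrier A" unfolding n_def by (rule A.finprod_closed) (use act_closed xw in auto)
      have "(\<Otimes>\<^bsub>A\<^esub>g\<in>insert \<one>\<^bsub>\<Gamma>\<^esub> (carrier \<Gamma> - {\<one>\<^bsub>\<Gamma>\<^esub>}). \<alpha> g (x w)) = x w \<otimes>\<^bsub>A\<^esub> n"
        unfolding n_def using finite_group act_closed xw
        by (subst A.finprod_insert) (auto simp: act_one)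
      then have norm: "(\<Otimes>\<^bsub>A\<^esub>g\<in>carrier \<Gamma>. \<alpha> g (x w)) = x w \<otimes>\<^bsub>A\<^esub> n" by (simp add: insert_absorb)
      define y where "y v = n \<otimes>\<^bsub>A\<^esub> x v" for v
      have yc: "y \<in> insert w F \<rightarrow> carrier A" unfolding y_def using nc insert.prems(2) by auto
      have yw: "y w = x w \<otimes>\<^bsub>A\<^esub> n" unfolding y_def using nc xw by (rule A.m_comm)
      have y0: "(\<Oplus>\<^bsub>V\<^esub>v\<in>insert w F. y v \<odot>\<^bsub>V\<^esub> v) = \<zero>\<^bsub>V\<^esub>"
      proof -
        have "(\<Oplus>\<^bsub>V\<^esub>v\<in>insert w F. y v \<odot>\<^bsub>V\<^esub> v) = (\<Oplus>\<^bsub>V\<^esub>v\<in>insert w F. n \<odot>\<^bsub>V\<^esub> (x v \<odot>\<^bsub>V\<^esub> v))"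
        proof (rule V.finsum_cong')
          fix v assume v: "v \<in> insert w F"
          show "y v \<odot>\<^bsub>V\<^esub> v = n \<odot>\<^bsub>V\<^esub> (x v \<odot>\<^bsub>V\<^esub> v)"
            unfolding y_def using nc funcset_mem[OF insert.prems(2) v] v w Fc
            by (intro V.smult_assoc1) auto
        qed (use nc insert.prems(2) w Fc in auto)
        also have "\<dots> = n \<odot>\<^bsub>V\<^esub> (\<Oplus>\<^bsub>V\<^esub>v\<in>insert w F. x v \<odot>\<^bsub>V\<^esub> v)"
          by (rule V.finsum_smult_ldistr[symmetric]) (use insert.hyps nc insert.prems(2) w Fc in auto)
        finally show ?thesis unfolding insert.prems(3) using nc by simp
      qed
      have y_fix: "\<alpha> g (y v) = y v" if g: "g \<in> carrier \<Gamma>" and v: "v \<in> insert w F" for g v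
      proof -
        have w_fix: "\<alpha> g (y w) = y w"
          using norm_fixed(1)[OF xw False] g unfolding norm yw fixed_ring_def by auto
        have gyc: "\<alpha> g (y v) \<in> carrier A" if "v \<in> insert w F" for v
          using act_closed[OF g] yc that by auto
        have term_c: "y v \<odot>\<^bsub>V\<^esub> v \<in> carrier V" "\<alpha> g (y v) \<odot>\<^bsub>V\<^esub> v \<in> carrier V"
          if "v \<in> insert w F" for v
          using gyc[OF that] funcset_mem[OF yc that] that w Fc by auto
        have "\<zero>\<^bsub>V\<^esub> = \<beta> g (\<Oplus>\<^bsub>V\<^esub>v\<in>insert w F. y v \<odot>\<^bsub>V\<^esub> v)" unfolding y0 using vact_zero[OF g] by simp
        also have "\<dots> = (\<Oplus>\<^bsub>V\<^esub>v\<in>insert w F. \<beta> g (y v \<odot>\<^bsub>V\<^esub> v))"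
          by (rule vact_finsum[OF g]) (use yc w Fc in auto)
        also have "\<dots> = (\<Oplus>\<^bsub>V\<^esub>v\<in>insert w F. \<alpha> g (y v) \<odot>\<^bsub>V\<^esub> v)"
        proof (rule V.finsum_cong')
          fix v assume v: "v \<in> insert w F"
          then have vB: "v \<in> B" using w FB by auto
          show "\<beta> g (y v \<odot>\<^bsub>V\<^esub> v) = \<alpha> g (y v) \<odot>\<^bsub>V\<^esub> v"
            using vact_smult[OF g funcset_mem[OF yc v] Bc(1)[OF vB]] Bc(2)[OF vB g] by simp
        qed (use gyc w Fc in auto)
        finally have gy0: "(\<Oplus>\<^bsub>V\<^esub>v\<in>insert w F. \<alpha> g (y v) \<odot>\<^bsub>V\<^esub> v) = \<zero>\<^bsub>V\<^esub>" by (rule sym)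
        let ?z = "\<lambda>v. \<alpha> g (y v) \<oplus>\<^bsub>A\<^esub> (\<ominus>\<^bsub>A\<^esub> \<one>\<^bsub>A\<^esub>) \<otimes>\<^bsub>A\<^esub> y v"
        have "(\<Oplus>\<^bsub>V\<^esub>v\<in>insert w F. ?z v \<odot>\<^bsub>V\<^esub> v)
          = (\<Oplus>\<^bsub>V\<^esub>v\<in>insert w F. \<alpha> g (y v) \<odot>\<^bsub>V\<^esub> v \<oplus>\<^bsub>V\<^esub> (\<ominus>\<^bsub>A\<^esub> \<one>\<^bsub>A\<^esub>) \<odot>\<^bsub>V\<^esub> (y v \<odot>\<^bsub>V\<^esub> v))"
        proof (rule V.finsum_cong')
          fix v assume v: "v \<in> insert w F"
          have "v \<in> carrier V" using v w Fc by auto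
          then show "?z v \<odot>\<^bsub>V\<^esub> v = \<alpha> g (y v) \<odot>\<^bsub>V\<^esub> v \<oplus>\<^bsub>V\<^esub> (\<ominus>\<^bsub>A\<^esub> \<one>\<^bsub>A\<^esub>) \<odot>\<^bsub>V\<^esub> (y v \<odot>\<^bsub>V\<^esub> v)"
            using gyc[OF v] funcset_mem[OF yc v] by (simp only: V.smult_l_distr V.smult_assoc1
                A.m_closed A.a_inv_closed A.one_closed)
        next
          show "(\<lambda>v. \<alpha> g (y v) \<odot>\<^bsub>V\<^esub> v \<oplus>\<^bsub>V\<^esub> (\<ominus>\<^bsub>A\<^esub> \<one>\<^bsub>A\<^esub>) \<odot>\<^bsub>V\<^esub> (y v \<odot>\<^bsub>V\<^esub> v)) \<in> insert w F \<rightarrow> carrier V"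
          proof
            fix v assume v: "v \<in> insert w F"
            have "v \<in> carrier V" using v w Fc by auto
            then show "\<alpha> g (y v) \<odot>\<^bsub>V\<^esub> v \<oplus>\<^bsub>V\<^esub> (\<ominus>\<^bsub>A\<^esub> \<one>\<^bsub>A\<^esub>) \<odot>\<^bsub>V\<^esub> (y v \<odot>\<^bsub>V\<^esub> v) \<in> carrier V"
              using gyc[OF v] funcset_mem[OF yc v] by (intro V.M.a_closed V.smult_closed) auto
          qed
        qed simp
        also have "\<dots> = (\<Oplus>\<^bsub>V\<^esub>v\<in>insert w F. \<alpha> g (y v) \<odot>\<^bsub>V\<^esub> v) \<oplus>\<^bsub>V\<^esub>
            (\<Oplus>\<^bsub>V\<^esub>v\<in>insert w F. (\<ominus>\<^bsub>A\<^esub> \<one>\<^bsub>A\<^esub>) \<odot>\<^bsub>V\<^esub> (y v \<odot>\<^bsub>V\<^esub> v))"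
          by (rule V.finsum_addf) (use term_c in auto)
        also have "(\<Oplus>\<^bsub>V\<^esub>v\<in>insert w F. (\<ominus>\<^bsub>A\<^esub> \<one>\<^bsub>A\<^esub>) \<odot>\<^bsub>V\<^esub> (y v \<odot>\<^bsub>V\<^esub> v))
            = (\<ominus>\<^bsub>A\<^esub> \<one>\<^bsub>A\<^esub>) \<odot>\<^bsub>V\<^esub> (\<Oplus>\<^bsub>V\<^esub>v\<in>insert w F. y v \<odot>\<^bsub>V\<^esub> v)"
          by (rule V.finsum_smult_ldistr[symmetric]) (use insert.hyps term_c in auto)
        finally have "(\<Oplus>\<^bsub>V\<^esub>v\<in>insert w F. ?z v \<odot>\<^bsub>V\<^esub> v) = \<zero>\<^bsub>V\<^esub>"
          unfolding y0 gy0 by simp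
        moreover have "?z \<in> insert w F \<rightarrow> carrier A" using gyc yc by auto
        moreover have "?z w = \<zero>\<^bsub>A\<^esub>"
          unfolding w_fix using yc by (simp add: A.l_minus A.r_neg)
        ultimately have "\<forall>v \<in> F. ?z v = \<zero>\<^bsub>A\<^esub>" by (intro shrink)
        then have zv: "?z v = \<zero>\<^bsub>A\<^esub>" using v \<open>?z w = \<zero>\<^bsub>A\<^esub>\<close> by auto
        have c: "y v \<in> carrier A" "\<alpha> g (y v) \<in> carrier A" using gyc[OF v] funcset_mem[OF yc v] by auto
        have "\<alpha> g (y v) = ?z v \<oplus>\<^bsub>A\<^esub> y v" using c by algebra
        then show ?thesis unfolding zv using c by simp
      qed
      have "y \<in> insert w F \<rightarrow> fixed_ring (carrier \<Gamma>)"
        unfolding fixed_ring_def using yc y_fix by auto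
      then have "y w = \<zero>\<^bsub>A\<^esub>"
        using ind insert.hyps(1) insert.prems(1) y0 unfolding independent_over_def
        by (meson finite.insertI insertI1)
      then have False using norm_fixed(2)[OF xw False] unfolding norm yw by simp
      then show ?thesis ..
    qed
  qed simp
  then show ?thesis unfolding independent_over_def by blast
qed

lemma independent_over_unique:
  assumes ind: "independent_over (carrier A) B" and B: "B \<subseteq> carrier V"
    and F: "finite F" "F \<subseteq> B" and x: "x \<in> F \<rightarrow> carrier A" and y: "y \<in> F \<rightarrow> carrier A"
    and eq: "(\<Oplus>\<^bsub>V\<^esub>v\<in>F. x v \<odot>\<^bsub>V\<^esub> v) = (\<Oplus>\<^bsub>V\<^esub>v\<in>F. y v \<odot>\<^bsub>V\<^esub> v)"
    and v: "v \<in> F"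
  shows "x v = y v"
proof -
  have Fc: "F \<subseteq> carrier V" using F B by auto
  let ?z = "\<lambda>v. x v \<oplus>\<^bsub>A\<^esub> (\<ominus>\<^bsub>A\<^esub> \<one>\<^bsub>A\<^esub>) \<otimes>\<^bsub>A\<^esub> y v"
  have term_c: "x v \<odot>\<^bsub>V\<^esub> v \<in> carrier V" "y v \<odot>\<^bsub>V\<^esub> v \<in> carrier V"
    "(\<ominus>\<^bsub>A\<^esub> \<one>\<^bsub>A\<^esub>) \<odot>\<^bsub>V\<^esub> (y v \<odot>\<^bsub>V\<^esub> v) \<in> carrier V" if "v \<in> F" for v
    using funcset_mem[OF x that] funcset_mem[OF y that] that Fc by auto
  have "(\<Oplus>\<^bsub>V\<^esub>v\<in>F. ?z v \<odot>\<^bsub>V\<^esub> v)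
      = (\<Oplus>\<^bsub>V\<^esub>v\<in>F. x v \<odot>\<^bsub>V\<^esub> v \<oplus>\<^bsub>V\<^esub> (\<ominus>\<^bsub>A\<^esub> \<one>\<^bsub>A\<^esub>) \<odot>\<^bsub>V\<^esub> (y v \<odot>\<^bsub>V\<^esub> v))"
  proof (rule V.finsum_cong')
    fix v assume v: "v \<in> F"
    have "v \<in> carrier V" using v Fc by auto
    then show "?z v \<odot>\<^bsub>V\<^esub> v = x v \<odot>\<^bsub>V\<^esub> v \<oplus>\<^bsub>V\<^esub> (\<ominus>\<^bsub>A\<^esub> \<one>\<^bsub>A\<^esub>) \<odot>\<^bsub>V\<^esub> (y v \<odot>\<^bsub>V\<^esub> v)"
      using funcset_mem[OF x v] funcset_mem[OF y v]
      by (simp only: V.smult_l_distr V.smult_assoc1 A.m_closed A.a_inv_closed A.one_closed)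
  next
    show "(\<lambda>v. x v \<odot>\<^bsub>V\<^esub> v \<oplus>\<^bsub>V\<^esub> (\<ominus>\<^bsub>A\<^esub> \<one>\<^bsub>A\<^esub>) \<odot>\<^bsub>V\<^esub> (y v \<odot>\<^bsub>V\<^esub> v)) \<in> F \<rightarrow> carrier V"
      using term_c by (intro Pi_I V.M.a_closed) auto
  qed simp
  also have "\<dots> = (\<Oplus>\<^bsub>V\<^esub>v\<in>F. x v \<odot>\<^bsub>V\<^esub> v) \<oplus>\<^bsub>V\<^esub> (\<Oplus>\<^bsub>V\<^esub>v\<in>F. (\<ominus>\<^bsub>A\<^esub> \<one>\<^bsub>A\<^esub>) \<odot>\<^bsub>V\<^esub> (y v \<odot>\<^bsub>V\<^esub> v))"
    by (rule V.finsum_addf) (use term_c in auto)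
  also have "(\<Oplus>\<^bsub>V\<^esub>v\<in>F. (\<ominus>\<^bsub>A\<^esub> \<one>\<^bsub>A\<^esub>) \<odot>\<^bsub>V\<^esub> (y v \<odot>\<^bsub>V\<^esub> v)) = (\<ominus>\<^bsub>A\<^esub> \<one>\<^bsub>A\<^esub>) \<odot>\<^bsub>V\<^esub> (\<Oplus>\<^bsub>V\<^esub>v\<in>F. y v \<odot>\<^bsub>V\<^esub> v)"
    by (rule V.finsum_smult_ldistr[symmetric]) (use F term_c in auto)
  finally have "(\<Oplus>\<^bsub>V\<^esub>v\<in>F. ?z v \<odot>\<^bsub>V\<^esub> v) = (\<Oplus>\<^bsub>V\<^esub>v\<in>F. y v \<odot>\<^bsub>V\<^esub> v) \<oplus>\<^bsub>V\<^esub>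
      (\<ominus>\<^bsub>A\<^esub> \<one>\<^bsub>A\<^esub>) \<odot>\<^bsub>V\<^esub> (\<Oplus>\<^bsub>V\<^esub>v\<in>F. y v \<odot>\<^bsub>V\<^esub> v)" unfolding eq .
  also have "\<dots> = \<zero>\<^bsub>V\<^esub>"
  proof -
    have "(\<Oplus>\<^bsub>V\<^esub>v\<in>F. y v \<odot>\<^bsub>V\<^esub> v) \<in> carrier V" by (rule V.finsum_closed) (use term_c in auto)
    then show ?thesis by (simp add: V.smult_l_minus V.M.r_neg)
  qed
  finally have "(\<Oplus>\<^bsub>V\<^esub>v\<in>F. ?z v \<odot>\<^bsub>V\<^esub> v) = \<zero>\<^bsub>V\<^esub>" .
  moreover have "?z \<in> F \<rightarrow> carrier A" using x y by auto
  ultimately have z: "?z v = \<zero>\<^bsub>A\<^esub>" using ind F v unfolding independent_over_def by meson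
  have c: "x v \<in> carrier A" "y v \<in> carrier A" using x y v by auto
  have "x v = ?z v \<oplus>\<^bsub>A\<^esub> y v" using c by algebra
  then show ?thesis unfolding z using c by simp
qed

lemma sum_extend_zero:
  assumes "finite F'" "F \<subseteq> F'" "F' \<subseteq> carrier V" "c \<in> F \<rightarrow> carrier A"
  shows "(\<Oplus>\<^bsub>V\<^esub>v\<in>F. c v \<odot>\<^bsub>V\<^esub> v) = (\<Oplus>\<^bsub>V\<^esub>v\<in>F'. (if v \<in> F then c v else \<zero>\<^bsub>A\<^esub>) \<odot>\<^bsub>V\<^esub> v)"
  by (rule V.add.finprod_mono_neutral_cong_left)
    (use assms in \<open>auto split: if_splits intro!: V.smult_l_null simp: subset_iff Pi_iff\<close>)

text \<open>Independence of \<open>B\<close> holds over \<open>A\<close> and a fortiori over the smaller ring. Let \<open>w\<close> be fixed by \<open>K\<close>.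
  Localised at the zero ideal, \<open>s\<^sub>0 w\<close> is a combination of \<open>B\<close> with coefficients \<open>x v\<close>; localised at a
  prime \<open>P\<close> of height one, \<open>s w\<close> is a combination with coefficients \<open>y v\<close>, where \<open>s \<notin> P\<close>, because the
  inertia group of \<open>P\<close> lies in \<open>K\<close>. Hence \<open>s x v = s\<^sub>0 y v\<close>, and \<open>s\<^sub>0\<close> divides \<open>x v\<close> since divisibility
  is decided at the primes of height one. Division by \<open>s\<^sub>0\<close> expresses \<open>w\<close> by \<open>B\<close>, and uniqueness of
  the coefficients makes them invariant under \<open>K\<close>.\<close>

theorem fixed_basis_descends:
  assumes noeth: "noetherian_on A (carrier A)" and normal: "integrally_closed_in_quotient_field A"
    and B: "B \<subseteq> fixed_vectors (carrier \<Gamma>)"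
    and ind: "independent_over (fixed_ring (carrier \<Gamma>)) B"
    and span: "spans_over (fixed_ring (carrier \<Gamma>)) B (fixed_vectors (carrier \<Gamma>))"
    and K: "subgroup K \<Gamma>"
    and refl: "\<And>P. primeideal P A \<Longrightarrow> prime_height A P = 1 \<Longrightarrow> inertia P \<subseteq> K"
  shows "independent_over (fixed_ring K) B" "spans_over (fixed_ring K) B (fixed_vectors K)"
proof -
  have indA: "independent_over (carrier A) B" by (rule independent_over_ring[OF B ind])
  have Bc: "B \<subseteq> carrier V" using B unfolding fixed_vectors_def by auto
  have "fixed_ring K \<subseteq> carrier A" unfolding fixed_ring_def by auto
  then have "c \<in> F \<rightarrow> carrier A" if "c \<in> F \<rightarrow> fixed_ring K" for c and F :: "'v set" using that by auto
  then show "independent_over (fixed_ring K) B"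
    using indA unfolding independent_over_def by meson
  show "spans_over (fixed_ring K) B (fixed_vectors K)"
    unfolding spans_over_def
  proof
    fix w assume w: "w \<in> fixed_vectors K"
    then have wc: "w \<in> carrier V" unfolding fixed_vectors_def by auto
    have N: "submodule A (V.span B) V" by (rule V.span_is_submodule[OF Bc])
    have NG: "fixed_vectors (carrier \<Gamma>) \<subseteq> V.span B"
    proof
      fix u assume "u \<in> fixed_vectors (carrier \<Gamma>)"
      then obtain F c where "finite F" "F \<subseteq> B" "c \<in> F \<rightarrow> fixed_ring (carrier \<Gamma>)"
        "u = (\<Oplus>\<^bsub>V\<^esub>v\<in>F. c v \<odot>\<^bsub>V\<^esub> v)"
        using span unfolding spans_over_def by meson
      moreover from this have "c \<in> F \<rightarrow> carrier A" unfolding fixed_ring_def by auto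
      ultimately show "u \<in> V.span B" unfolding V.span_def V.lincomb_def by auto
    qed
    have local: "\<exists>s F c. s \<in> carrier A - P \<and> finite F \<and> F \<subseteq> B \<and> c \<in> F \<rightarrow> carrier A \<and>
        s \<odot>\<^bsub>V\<^esub> w = (\<Oplus>\<^bsub>V\<^esub>v\<in>F. c v \<odot>\<^bsub>V\<^esub> v)"
      if P: "primeideal P A" "inertia P \<subseteq> K" for P
    proof -
      have "w \<in> fixed_vectors (inertia P)" using w P(2) unfolding fixed_vectors_def by auto
      then obtain s where s: "s \<in> carrier A - P" "s \<odot>\<^bsub>V\<^esub> w \<in> V.span B"
        using exists_localized_multiple[OF P(1) N NG] by meson
      then show ?thesis unfolding V.span_def V.lincomb_def by auto
    qed
    have "inertia {\<zero>\<^bsub>A\<^esub>} \<subseteq> K"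
    proof
      fix g assume "g \<in> inertia {\<zero>\<^bsub>A\<^esub>}"
      then have g: "g \<in> carrier \<Gamma>" "\<And>a. a \<in> carrier A \<Longrightarrow> \<alpha> g a \<ominus>\<^bsub>A\<^esub> a = \<zero>\<^bsub>A\<^esub>"
        unfolding inertia_def by auto
      have "\<alpha> g a = a" if a: "a \<in> carrier A" for a
        using g(2)[OF a] act_closed[OF g(1) a] a by simp
      then have "g = \<one>\<^bsub>\<Gamma>\<^esub>" by (rule faithful[OF g(1)])
      then show "g \<in> K" using subgroup.one_closed[OF K] by simp
    qed
    then obtain s0 F x where s0: "s0 \<in> carrier A" "s0 \<noteq> \<zero>\<^bsub>A\<^esub>" and F: "finite F" "F \<subseteq> B"
      and x: "x \<in> F \<rightarrow> carrier A" and s0w: "s0 \<odot>\<^bsub>V\<^esub> w = (\<Oplus>\<^bsub>V\<^esub>v\<in>F. x v \<odot>\<^bsub>V\<^esub> v)"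
      using local[OF A.zeroprimeideal] by auto
    have Fc: "F \<subseteq> carrier V" using F Bc by auto
    have "s0 divides\<^bsub>A\<^esub> x v" if v: "v \<in> F" for v
    proof (rule A.divides_if_locally_divides[OF noeth normal _ s0])
      show "x v \<in> carrier A" using x v by auto
      fix P assume P: "primeideal P A" "prime_height A P = 1"
      obtain s F' y where s: "s \<in> carrier A" "s \<notin> P" and F': "finite F'" "F' \<subseteq> B"
        and y: "y \<in> F' \<rightarrow> carrier A" and sw: "s \<odot>\<^bsub>V\<^esub> w = (\<Oplus>\<^bsub>V\<^esub>v\<in>F'. y v \<odot>\<^bsub>V\<^esub> v)"
        using local[OF P(1) refl[OF P]] by auto
      let ?F = "F \<union> F'"
      have FF: "finite ?F" "?F \<subseteq> B" "?F \<subseteq> carrier V" using F F' Bc by auto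
      let ?x = "\<lambda>v. if v \<in> F then x v else \<zero>\<^bsub>A\<^esub>" and ?y = "\<lambda>v. if v \<in> F' then y v else \<zero>\<^bsub>A\<^esub>"
      have xc: "?x \<in> ?F \<rightarrow> carrier A" and yc: "?y \<in> ?F \<rightarrow> carrier A" using x y by auto
      have sx: "s \<odot>\<^bsub>V\<^esub> (s0 \<odot>\<^bsub>V\<^esub> w) = (\<Oplus>\<^bsub>V\<^esub>v\<in>?F. (s \<otimes>\<^bsub>A\<^esub> ?x v) \<odot>\<^bsub>V\<^esub> v)"
        unfolding s0w sum_extend_zero[OF FF(1) Un_upper1 FF(3) x]
        using V.lincomb_smult[OF FF(3) xc s(1)] unfolding V.lincomb_def by (rule sym)
      have sy: "s0 \<odot>\<^bsub>V\<^esub> (s \<odot>\<^bsub>V\<^esub> w) = (\<Oplus>\<^bsub>V\<^esub>v\<in>?F. (s0 \<otimes>\<^bsub>A\<^esub> ?y v) \<odot>\<^bsub>V\<^esub> v)"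
        unfolding sw sum_extend_zero[OF FF(1) Un_upper2 FF(3) y]
        using V.lincomb_smult[OF FF(3) yc s0(1)] unfolding V.lincomb_def by (rule sym)
      have "s \<odot>\<^bsub>V\<^esub> (s0 \<odot>\<^bsub>V\<^esub> w) = s0 \<odot>\<^bsub>V\<^esub> (s \<odot>\<^bsub>V\<^esub> w)"
        using V.smult_assoc1[OF s(1) s0(1) wc] V.smult_assoc1[OF s0(1) s(1) wc] A.m_comm[OF s(1) s0(1)]
        by simp
      then have eq: "(\<Oplus>\<^bsub>V\<^esub>v\<in>?F. (s \<otimes>\<^bsub>A\<^esub> ?x v) \<odot>\<^bsub>V\<^esub> v) = (\<Oplus>\<^bsub>V\<^esub>v\<in>?F. (s0 \<otimes>\<^bsub>A\<^esub> ?y v) \<odot>\<^bsub>V\<^esub> v)"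
        unfolding sx sy .
      have "s \<otimes>\<^bsub>A\<^esub> ?x v = s0 \<otimes>\<^bsub>A\<^esub> ?y v"
        by (rule independent_over_unique[OF indA Bc FF(1,2) _ _ eq]) (use xc yc s s0 v in auto)
      then have "s \<otimes>\<^bsub>A\<^esub> x v = s0 \<otimes>\<^bsub>A\<^esub> ?y v" using v by simp
      moreover have "?y v \<in> carrier A" by (rule funcset_mem[OF yc]) (use v in simp)
      ultimately have "s0 divides\<^bsub>A\<^esub> (s \<otimes>\<^bsub>A\<^esub> x v)" unfolding factor_def by (rule bexI)
      then show "\<exists>s\<in>carrier A - P. s0 divides\<^bsub>A\<^esub> (s \<otimes>\<^bsub>A\<^esub> x v)" using s by auto
    qed
    then obtain z where z: "\<And>v. v \<in> F \<Longrightarrow> z v \<in> carrier A \<and> x v = s0 \<otimes>\<^bsub>A\<^esub> z v"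
      unfolding factor_def by metis
    have zc: "z \<in> F \<rightarrow> carrier A" using z by auto
    let ?u = "\<Oplus>\<^bsub>V\<^esub>v\<in>F. z v \<odot>\<^bsub>V\<^esub> v"
    have uc: "?u \<in> carrier V" by (rule V.finsum_closed) (use zc Fc in auto)
    have "(\<Oplus>\<^bsub>V\<^esub>v\<in>F. x v \<odot>\<^bsub>V\<^esub> v) = (\<Oplus>\<^bsub>V\<^esub>v\<in>F. (s0 \<otimes>\<^bsub>A\<^esub> z v) \<odot>\<^bsub>V\<^esub> v)"
      by (rule V.finsum_cong') (use z s0 Fc in auto)
    also have "\<dots> = s0 \<odot>\<^bsub>V\<^esub> ?u" using V.lincomb_smult[OF Fc zc s0(1)] unfolding V.lincomb_def .
    finally have "s0 \<odot>\<^bsub>V\<^esub> w = s0 \<odot>\<^bsub>V\<^esub> ?u" unfolding s0w .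
    then have "s0 \<odot>\<^bsub>V\<^esub> (w \<ominus>\<^bsub>V\<^esub> ?u) = \<zero>\<^bsub>V\<^esub>"
      using s0(1) wc uc by (simp add: V.M.minus_eq V.smult_r_distr V.smult_r_minus V.M.r_neg)
    then have "w \<ominus>\<^bsub>V\<^esub> ?u = \<zero>\<^bsub>V\<^esub>" using torsion_free[OF s0(1) _] s0(2) wc uc by auto
    then have wu: "w = ?u" using wc uc by simp
    have "z v \<in> fixed_ring K" if v: "v \<in> F" for v
    proof -
      have "\<alpha> g (z v) = z v" if g: "g \<in> K" for g
      proof (rule independent_over_unique[OF indA Bc F _ zc _ v])
        have gG: "g \<in> carrier \<Gamma>" using subgroup.subset[OF K] g by auto
        show ac: "(\<lambda>v. \<alpha> g (z v)) \<in> F \<rightarrow> carrier A" using act_closed[OF gG] zc by auto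
        have "(\<Oplus>\<^bsub>V\<^esub>v\<in>F. \<alpha> g (z v) \<odot>\<^bsub>V\<^esub> v) = (\<Oplus>\<^bsub>V\<^esub>v\<in>F. \<beta> g (z v \<odot>\<^bsub>V\<^esub> v))"
        proof (rule V.finsum_cong')
          fix v assume v: "v \<in> F"
          have "\<beta> g v = v" "v \<in> carrier V" using B F v gG unfolding fixed_vectors_def by auto
          then show "\<alpha> g (z v) \<odot>\<^bsub>V\<^esub> v = \<beta> g (z v \<odot>\<^bsub>V\<^esub> v)"
            using vact_smult[OF gG funcset_mem[OF zc v]] by simp
        qed (use funcset_mem[OF zc] Fc vact_closed[OF gG] in \<open>auto simp: subset_iff\<close>)
        also have "\<dots> = \<beta> g ?u" by (rule vact_finsum[OF gG, symmetric]) (use funcset_mem[OF zc] Fc in \<open>auto simp: subset_iff\<close>)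
        also have "\<dots> = ?u" using w g wu unfolding fixed_vectors_def by auto
        finally show "(\<Oplus>\<^bsub>V\<^esub>v\<in>F. \<alpha> g (z v) \<odot>\<^bsub>V\<^esub> v) = ?u" .
      qed
      then show ?thesis using z[OF v] unfolding fixed_ring_def by auto
    qed
    then show "\<exists>F c. finite F \<and> F \<subseteq> B \<and> c \<in> F \<rightarrow> fixed_ring K \<and> w = (\<Oplus>\<^bsub>V\<^esub>v\<in>F. c v \<odot>\<^bsub>V\<^esub> v)"
      using F wu by (intro exI[of _ F] exI[of _ z]) auto
  qed
qed

end

section \<open>The tensor product over a commutative ring\<close>

lemma (in abelian_group) add_minus_minus:
  assumes "a \<in> carrier G" "b \<in> carrier G"
  shows "((a \<oplus> b) \<oplus> \<ominus> a) \<oplus> \<ominus> b = \<zero>"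
proof -
  have "(a \<oplus> b) \<oplus> \<ominus> a = b" using a_comm[OF assms] assms by (simp add: a_assoc r_neg)
  then show ?thesis using assms by (simp add: r_neg)
qed

locale tensor = S: algebra R S + N: module R N
  for R :: "('r, 'l) ring_scheme" and S :: "('r, 's, 'm) module_scheme"
    and N :: "('r, 'n, 'p) module_scheme"
begin

abbreviation FA :: "('s \<times> 'n \<Rightarrow>\<^sub>0 int) monoid" where
  "FA \<equiv> free_Abelian_group (carrier S \<times> carrier N)"

abbreviation Rel :: "('s \<times> 'n \<Rightarrow>\<^sub>0 int) set" where
  "Rel \<equiv> tensor_relations R S N"

abbreviation T :: "('s, ('s \<times> 'n \<Rightarrow>\<^sub>0 int) set) module" where
  "T \<equiv> tensor_product R S N"

abbreviation coset :: "('s \<times> 'n \<Rightarrow>\<^sub>0 int) \<Rightarrow> ('s \<times> 'n \<Rightarrow>\<^sub>0 int) set" where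
  "coset \<equiv> tensor_coset R S N"

abbreviation pure :: "'s \<Rightarrow> 'n \<Rightarrow> ('s \<times> 'n \<Rightarrow>\<^sub>0 int) set" where
  "pure \<equiv> pure_tensor R S N"

text \<open>The generators of \<open>Rel\<close> are named in order to argue by induction over the generated subgroup.\<close>

definition rel_gens :: "('s \<times> 'n \<Rightarrow>\<^sub>0 int) set" where
  "rel_gens =
     {frag_of (a \<oplus>\<^bsub>S\<^esub> b, x) - frag_of (a, x) - frag_of (b, x) | a b x.
         a \<in> carrier S \<and> b \<in> carrier S \<and> x \<in> carrier N} \<union>
      {frag_of (a, x \<oplus>\<^bsub>N\<^esub> y) - frag_of (a, x) - frag_of (a, y) | a x y.
         a \<in> carrier S \<and> x \<in> carrier N \<and> y \<in> carrier N} \<union>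
      {frag_of (r \<odot>\<^bsub>S\<^esub> a, x) - frag_of (a, r \<odot>\<^bsub>N\<^esub> x) | r a x.
         r \<in> carrier R \<and> a \<in> carrier S \<and> x \<in> carrier N}"

lemma Rel_eq: "Rel = generate FA rel_gens"
  unfolding tensor_relations_def rel_gens_def ..

lemma keys_diff_frag_of:
  "x \<in> K \<Longrightarrow> y \<in> K \<Longrightarrow> Poly_Mapping.keys (frag_of x - frag_of y) \<subseteq> K"
  using keys_diff[of "frag_of x" "frag_of y"] by auto

lemma keys_diff_diff_frag_of:
  "x \<in> K \<Longrightarrow> y \<in> K \<Longrightarrow> z \<in> K \<Longrightarrow> Poly_Mapping.keys (frag_of x - frag_of y - frag_of z) \<subseteq> K"
  using keys_diff[of "frag_of x - frag_of y" "frag_of z"] keys_diff_frag_of[of x K y] by auto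

lemma rel_gens_carrier: "rel_gens \<subseteq> carrier FA"
proof
  fix z assume "z \<in> rel_gens"
  then show "z \<in> carrier FA"
    unfolding rel_gens_def
    by (elim UnE CollectE exE conjE) (simp_all add: keys_diff_frag_of keys_diff_diff_frag_of)
qed

lemma Rel_subgroup: "subgroup Rel FA"
  unfolding Rel_eq by (rule group.generate_is_subgroup[OF group_free_Abelian_group rel_gens_carrier])

lemma Rel_carrier: "z \<in> Rel \<Longrightarrow> z \<in> carrier FA"
  using subgroup.subset[OF Rel_subgroup] by blast

lemma Rel_zero: "0 \<in> Rel"
  using subgroup.one_closed[OF Rel_subgroup] by simp

lemma Rel_add: "y \<in> Rel \<Longrightarrow> z \<in> Rel \<Longrightarrow> y + z \<in> Rel"
  using subgroup.m_closed[OF Rel_subgroup, of y z] by simp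

lemma Rel_minus: "z \<in> Rel \<Longrightarrow> - z \<in> Rel"
  using subgroup.m_inv_closed[OF Rel_subgroup, of z] Rel_carrier[of z] by simp

lemma Rel_diff: "y \<in> Rel \<Longrightarrow> z \<in> Rel \<Longrightarrow> y - z \<in> Rel"
  using Rel_add[of y "- z"] Rel_minus[of z] by simp

lemma mem_coset: "y \<in> coset z \<longleftrightarrow> y - z \<in> Rel"
proof -
  have "coset z = {h + z | h. h \<in> Rel}" unfolding tensor_coset_def r_coset_def by auto
  then have "y \<in> coset z \<longleftrightarrow> (\<exists>h. y = h + z \<and> h \<in> Rel)" by simp
  also have "\<dots> \<longleftrightarrow> y - z \<in> Rel" by (metis diff_add_cancel add_diff_cancel_right')
  finally show ?thesis .
qed

lemma coset_eq_iff: "coset y = coset z \<longleftrightarrow> y - z \<in> Rel"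
proof
  assume "coset y = coset z"
  moreover have "y \<in> coset y" using mem_coset Rel_zero by simp
  ultimately show "y - z \<in> Rel" using mem_coset by blast
next
  assume yz: "y - z \<in> Rel"
  have "x - y \<in> Rel \<longleftrightarrow> x - z \<in> Rel" for x
    using Rel_add[OF _ yz, of "x - y"] Rel_diff[OF _ yz, of "x - z"] by (auto simp: algebra_simps)
  then show "coset y = coset z" by (auto simp: mem_coset)
qed

lemma Rel_normal: "Rel \<lhd> FA"
  by (rule comm_group.subgroup_imp_normal[OF abelian_free_Abelian_group Rel_subgroup])

lemma carrier_T: "carrier T = coset ` carrier FA"
  unfolding tensor_product_def Let_def tensor_coset_def by (simp add: carrier_FactGroup)

lemma zero_T: "\<zero>\<^bsub>T\<^esub> = coset 0"
proof -
  have "coset 0 = Rel" by (auto simp: mem_coset)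
  then show ?thesis unfolding tensor_product_def Let_def by simp
qed

lemma add_T: "y \<in> carrier FA \<Longrightarrow> z \<in> carrier FA \<Longrightarrow> coset y \<oplus>\<^bsub>T\<^esub> coset z = coset (y + z)"
  using normal.rcos_sum[OF Rel_normal, of y z]
  unfolding tensor_product_def Let_def tensor_coset_def by simp

lemma add_monoid_T: "comm_group (add_monoid T)"
proof -
  have "comm_group (FA Mod Rel)"
    by (rule comm_group.abelian_FactGroup[OF abelian_free_Abelian_group Rel_subgroup])
  then interpret C: comm_group "FA Mod Rel" .
  show ?thesis
    by (rule comm_groupI) (simp_all add: tensor_product_def Let_def C.m_ac C.l_inv_ex
      del: mult_FactGroup one_FactGroup)
qed

lemma abelian_group_T: "abelian_group T"
  by (rule comm_group_abelian_groupI[OF add_monoid_T])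

sublocale T: abelian_group T by (rule abelian_group_T)

lemma coset_closed: "z \<in> carrier FA \<Longrightarrow> coset z \<in> carrier T"
  unfolding carrier_T by simp

lemma pure_closed [simp, intro]: "a \<in> carrier S \<Longrightarrow> x \<in> carrier N \<Longrightarrow> pure a x \<in> carrier T"
  unfolding pure_tensor_def by (rule coset_closed) simp

lemma coset_minus: "z \<in> carrier FA \<Longrightarrow> \<ominus>\<^bsub>T\<^esub> coset z = coset (- z)"
  by (rule T.minus_equality) (simp_all add: add_T zero_T coset_closed)

lemma pure_add_left:
  assumes "a \<in> carrier S" "b \<in> carrier S" "x \<in> carrier N"
  shows "pure (a \<oplus>\<^bsub>S\<^esub> b) x = pure a x \<oplus>\<^bsub>T\<^esub> pure b x"
proof -
  have "frag_of (a \<oplus>\<^bsub>S\<^esub> b, x) - frag_of (a, x) - frag_of (b, x) \<in> Rel"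
    unfolding Rel_eq by (rule generate.incl) (use assms in \<open>auto simp: rel_gens_def\<close>)
  then show ?thesis
    unfolding pure_tensor_def using assms by (simp add: add_T coset_eq_iff algebra_simps)
qed

lemma pure_add_right:
  assumes "a \<in> carrier S" "x \<in> carrier N" "y \<in> carrier N"
  shows "pure a (x \<oplus>\<^bsub>N\<^esub> y) = pure a x \<oplus>\<^bsub>T\<^esub> pure a y"
proof -
  have "frag_of (a, x \<oplus>\<^bsub>N\<^esub> y) - frag_of (a, x) - frag_of (a, y) \<in> Rel"
    unfolding Rel_eq by (rule generate.incl) (use assms in \<open>auto simp: rel_gens_def\<close>)
  then show ?thesis
    unfolding pure_tensor_def using assms by (simp add: add_T coset_eq_iff algebra_simps)
qed

lemma pure_balanced:
  assumes "r \<in> carrier R" "a \<in> carrier S" "x \<in> carrier N"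
  shows "pure (r \<odot>\<^bsub>S\<^esub> a) x = pure a (r \<odot>\<^bsub>N\<^esub> x)"
proof -
  have "frag_of (r \<odot>\<^bsub>S\<^esub> a, x) - frag_of (a, r \<odot>\<^bsub>N\<^esub> x) \<in> Rel"
    unfolding Rel_eq by (rule generate.incl) (use assms in \<open>auto simp: rel_gens_def\<close>)
  then show ?thesis unfolding pure_tensor_def by (simp add: coset_eq_iff)
qed

lemma pure_zero_left: "x \<in> carrier N \<Longrightarrow> pure \<zero>\<^bsub>S\<^esub> x = \<zero>\<^bsub>T\<^esub>"
  using pure_add_left[of "\<zero>\<^bsub>S\<^esub>" "\<zero>\<^bsub>S\<^esub>" x] T.add.l_cancel_one[of "pure \<zero>\<^bsub>S\<^esub> x" "pure \<zero>\<^bsub>S\<^esub> x"] by simp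

lemma pure_zero_right: "a \<in> carrier S \<Longrightarrow> pure a \<zero>\<^bsub>N\<^esub> = \<zero>\<^bsub>T\<^esub>"
  using pure_add_right[of a "\<zero>\<^bsub>N\<^esub>" "\<zero>\<^bsub>N\<^esub>"] T.add.l_cancel_one[of "pure a \<zero>\<^bsub>N\<^esub>" "pure a \<zero>\<^bsub>N\<^esub>"] by simp

lemma pure_minus_left: "a \<in> carrier S \<Longrightarrow> x \<in> carrier N \<Longrightarrow> pure (\<ominus>\<^bsub>S\<^esub> a) x = \<ominus>\<^bsub>T\<^esub> pure a x"
proof -
  assume a: "a \<in> carrier S" and x: "x \<in> carrier N"
  have "pure (\<ominus>\<^bsub>S\<^esub> a) x \<oplus>\<^bsub>T\<^esub> pure a x = \<zero>\<^bsub>T\<^esub>"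
    using pure_add_left[of "\<ominus>\<^bsub>S\<^esub> a" a x] pure_zero_left[OF x] a x by (simp add: S.l_neg)
  then show ?thesis using T.minus_equality a x by (metis S.a_inv_closed pure_closed)
qed

text \<open>Sums without differences suffice, because a minus sign can be moved into the left factor of a
  pure tensor.\<close>

inductive_set pure_sums :: "('s \<times> 'n \<Rightarrow>\<^sub>0 int) set set" where
  zero: "\<zero>\<^bsub>T\<^esub> \<in> pure_sums"
| add: "t \<in> pure_sums \<Longrightarrow> a \<in> carrier S \<Longrightarrow> x \<in> carrier N \<Longrightarrow> t \<oplus>\<^bsub>T\<^esub> pure a x \<in> pure_sums"

lemma pure_sums_closed: "t \<in> pure_sums \<Longrightarrow> t \<in> carrier T"
  by (induction rule: pure_sums.induct) auto

lemma pure_sums_diff: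
  assumes "t \<in> pure_sums" "u \<in> pure_sums"
  shows "t \<ominus>\<^bsub>T\<^esub> u \<in> pure_sums"
  using assms(2)
proof induction
  case zero
  have z: "\<ominus>\<^bsub>T\<^esub> \<zero>\<^bsub>T\<^esub> = \<zero>\<^bsub>T\<^esub>" by (rule T.minus_equality) (rule T.l_zero T.zero_closed)+
  have "t \<oplus>\<^bsub>T\<^esub> \<zero>\<^bsub>T\<^esub> = t" by (rule T.r_zero[OF pure_sums_closed[OF assms(1)]])
  then show ?case unfolding a_minus_def z using assms(1) by simp
next
  case (add u a x)
  have "t \<ominus>\<^bsub>T\<^esub> (u \<oplus>\<^bsub>T\<^esub> pure a x) = (t \<ominus>\<^bsub>T\<^esub> u) \<oplus>\<^bsub>T\<^esub> pure (\<ominus>\<^bsub>S\<^esub> a) x"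
    using pure_sums_closed[OF assms(1)] pure_sums_closed[OF add.hyps(1)] add.hyps(2,3)
    by (simp add: pure_minus_left T.minus_eq T.minus_add T.a_assoc)
  then show ?case using pure_sums.add[OF add.IH, of "\<ominus>\<^bsub>S\<^esub> a" x] add.hyps by simp
qed

lemma coset_in_pure_sums: "Poly_Mapping.keys z \<subseteq> carrier S \<times> carrier N \<Longrightarrow> coset z \<in> pure_sums"
proof (erule free_Abelian_group_induct[where P = "\<lambda>z. coset z \<in> pure_sums"])
  show "coset 0 \<in> pure_sums" using pure_sums.zero zero_T by simp
next
  fix x y assume c: "Poly_Mapping.keys x \<subseteq> carrier S \<times> carrier N"
    "Poly_Mapping.keys y \<subseteq> carrier S \<times> carrier N"
    and xy: "coset x \<in> pure_sums" "coset y \<in> pure_sums"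
  have "coset x \<ominus>\<^bsub>T\<^esub> coset y = coset (x - y)"
    unfolding T.minus_eq using c by (simp add: coset_minus add_T)
  then show "coset (x - y) \<in> pure_sums" using pure_sums_diff[OF xy] by simp
next
  fix p assume "p \<in> carrier S \<times> carrier N"
  then obtain a x where p: "p = (a, x)" "a \<in> carrier S" "x \<in> carrier N" by auto
  have "\<zero>\<^bsub>T\<^esub> \<oplus>\<^bsub>T\<^esub> pure a x \<in> pure_sums" by (rule pure_sums.add[OF pure_sums.zero p(2,3)])
  then have "pure a x \<in> pure_sums" using pure_closed[OF p(2,3)] by simp
  then show "coset (frag_of p) \<in> pure_sums" unfolding p(1) pure_tensor_def .
qed

lemma tensor_induct [consumes 1, case_names zero add]:
  assumes "t \<in> carrier T" and "P \<zero>\<^bsub>T\<^esub>"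
    and "\<And>t a x. t \<in> carrier T \<Longrightarrow> P t \<Longrightarrow> a \<in> carrier S \<Longrightarrow> x \<in> carrier N \<Longrightarrow> P (t \<oplus>\<^bsub>T\<^esub> pure a x)"
  shows "P t"
proof -
  have "t \<in> pure_sums" using assms(1) coset_in_pure_sums unfolding carrier_T by auto
  then show ?thesis by induction (use assms(2,3) pure_sums_closed in auto)
qed

text \<open>The additive extension of a balanced biadditive map to the free abelian group vanishes on
  the defining relations and so factors through the quotient.\<close>

lemma universal:
  assumes C: "abelian_group C"
    and f: "\<And>a x. a \<in> carrier S \<Longrightarrow> x \<in> carrier N \<Longrightarrow> f a x \<in> carrier C"
    and f1: "\<And>a b x. a \<in> carrier S \<Longrightarrow> b \<in> carrier S \<Longrightarrow> x \<in> carrier N \<Longrightarrow>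
      f (a \<oplus>\<^bsub>S\<^esub> b) x = f a x \<oplus>\<^bsub>C\<^esub> f b x"
    and f2: "\<And>a x y. a \<in> carrier S \<Longrightarrow> x \<in> carrier N \<Longrightarrow> y \<in> carrier N \<Longrightarrow>
      f a (x \<oplus>\<^bsub>N\<^esub> y) = f a x \<oplus>\<^bsub>C\<^esub> f a y"
    and f3: "\<And>r a x. r \<in> carrier R \<Longrightarrow> a \<in> carrier S \<Longrightarrow> x \<in> carrier N \<Longrightarrow>
      f (r \<odot>\<^bsub>S\<^esub> a) x = f a (r \<odot>\<^bsub>N\<^esub> x)"
  shows "\<exists>h. (\<forall>t \<in> carrier T. h t \<in> carrier C) \<and>
    (\<forall>t \<in> carrier T. \<forall>u \<in> carrier T. h (t \<oplus>\<^bsub>T\<^esub> u) = h t \<oplus>\<^bsub>C\<^esub> h u) \<and>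
    (\<forall>a \<in> carrier S. \<forall>x \<in> carrier N. h (pure a x) = f a x)"
proof -
  interpret C: abelian_group C by fact
  have cg: "comm_group (add_monoid C)" by (rule C.a_comm_group)
  have "(\<lambda>(a, x). f a x) ` (carrier S \<times> carrier N) \<subseteq> carrier (add_monoid C)" using f by auto
  then obtain h where h: "h \<in> hom FA (add_monoid C)"
    and h_of: "\<And>p. p \<in> carrier S \<times> carrier N \<Longrightarrow> h (frag_of p) = (case p of (a, x) \<Rightarrow> f a x)"
    using comm_group.free_Abelian_group_universal[OF cg] by metis
  have h_add: "h (y + z) = h y \<oplus>\<^bsub>C\<^esub> h z" if "y \<in> carrier FA" "z \<in> carrier FA" for y z
    using hom_mult[OF h that] by simp
  have h_c: "h y \<in> carrier C" if "y \<in> carrier FA" for y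
    using hom_in_carrier[OF h that] by simp
  have gh: "group_hom FA (add_monoid C) h"
    using h C.a_group by (simp add: group_hom_def group_hom_axioms_def)
  have h_minus: "h (- y) = \<ominus>\<^bsub>C\<^esub> h y" if "y \<in> carrier FA" for y
    using group_hom.hom_inv[OF gh that] that by (simp add: a_inv_def)
  have h_diff: "h (y - z) = h y \<oplus>\<^bsub>C\<^esub> \<ominus>\<^bsub>C\<^esub> h z" if "y \<in> carrier FA" "z \<in> carrier FA" for y z
    using h_add[of y "- z"] h_minus[of z] that by simp
  have of_c: "frag_of (a, x) \<in> carrier FA" if "a \<in> carrier S" "x \<in> carrier N" for a x
    using that by simp
  have diff_c: "frag_of p - frag_of q \<in> carrier FA" if "p \<in> carrier S \<times> carrier N" "q \<in> carrier S \<times> carrier N" for p q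
    using keys_diff_frag_of[OF that] by simp
  have h_rel: "h z = \<zero>\<^bsub>C\<^esub>" if "z \<in> Rel" for z
    using that unfolding Rel_eq
  proof induction
    case one
    then show ?case using group_hom.hom_one[OF gh] by simp
  next
    have gen: "h z = \<zero>\<^bsub>C\<^esub>" if "z \<in> rel_gens" for z
      using that unfolding rel_gens_def
    proof (elim UnE CollectE exE conjE)
      fix a b x assume z: "z = frag_of (a \<oplus>\<^bsub>S\<^esub> b, x) - frag_of (a, x) - frag_of (b, x)"
        and c: "a \<in> carrier S" "b \<in> carrier S" "x \<in> carrier N"
      have "h z = (f (a \<oplus>\<^bsub>S\<^esub> b) x \<oplus>\<^bsub>C\<^esub> \<ominus>\<^bsub>C\<^esub> f a x) \<oplus>\<^bsub>C\<^esub> \<ominus>\<^bsub>C\<^esub> f b x"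
        unfolding z using c h_of h_diff[OF diff_c of_c] h_diff[OF of_c of_c] by simp
      then show ?thesis using c f f1 C.add_minus_minus by simp
    next
      fix a x y assume z: "z = frag_of (a, x \<oplus>\<^bsub>N\<^esub> y) - frag_of (a, x) - frag_of (a, y)"
        and c: "a \<in> carrier S" "x \<in> carrier N" "y \<in> carrier N"
      have "h z = (f a (x \<oplus>\<^bsub>N\<^esub> y) \<oplus>\<^bsub>C\<^esub> \<ominus>\<^bsub>C\<^esub> f a x) \<oplus>\<^bsub>C\<^esub> \<ominus>\<^bsub>C\<^esub> f a y"
        unfolding z using c h_of h_diff[OF diff_c of_c] h_diff[OF of_c of_c] by simp
      then show ?thesis using c f f2 C.add_minus_minus by simp
    next
      fix r a x assume z: "z = frag_of (r \<odot>\<^bsub>S\<^esub> a, x) - frag_of (a, r \<odot>\<^bsub>N\<^esub> x)"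
        and c: "r \<in> carrier R" "a \<in> carrier S" "x \<in> carrier N"
      have "h z = f (r \<odot>\<^bsub>S\<^esub> a) x \<oplus>\<^bsub>C\<^esub> \<ominus>\<^bsub>C\<^esub> f a (r \<odot>\<^bsub>N\<^esub> x)"
        unfolding z using c h_of h_diff[OF of_c of_c] by simp
      then show ?thesis using c f f3 by (simp add: C.r_neg)
    qed
    { case (incl z) then show ?case by (rule gen) }
    { case (inv z)
      then have "z \<in> carrier FA" using rel_gens_carrier by blast
      then show ?case using gen[OF inv] h_minus[of z] by simp }
    { case (eng y z)
      then have "y \<in> carrier FA" "z \<in> carrier FA" using Rel_carrier unfolding Rel_eq by blast+
      then show ?case using eng h_add[of y z] by simp }
  qed
  obtain g where g: "g \<in> hom (FA Mod Rel) (add_monoid C)"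
    "\<And>z. z \<in> carrier FA \<Longrightarrow> g (r_coset FA Rel z) = h z"
  proof (rule FactGroup_universal[OF h Rel_normal])
    fix y z assume y: "y \<in> carrier FA" and z: "z \<in> carrier FA" and "Rel #>\<^bsub>FA\<^esub> y = Rel #>\<^bsub>FA\<^esub> z"
    then have "y - z \<in> Rel" using coset_eq_iff unfolding tensor_coset_def by simp
    then have "h y \<oplus>\<^bsub>C\<^esub> \<ominus>\<^bsub>C\<^esub> h z = \<zero>\<^bsub>C\<^esub>" using h_rel[of "y - z"] h_diff[OF y z] by simp
    then have "\<ominus>\<^bsub>C\<^esub> (\<ominus>\<^bsub>C\<^esub> h z) = h y" by (rule C.minus_equality) (use h_c[OF y] h_c[OF z] in auto)
    then show "h y = h z" using h_c[OF z] by simp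
  next
    fix g assume g: "g \<in> hom (FA Mod Rel) (add_monoid C)"
      "\<And>z. z \<in> carrier FA \<Longrightarrow> g (r_coset FA Rel z) = h z"
    show thesis by (rule that[OF g])
  qed
  have gc: "g (coset z) = h z" if "z \<in> carrier FA" for z using g(2)[OF that] unfolding tensor_coset_def .
  show ?thesis
  proof (intro exI[of _ g] conjI ballI)
    show "g t \<in> carrier C" if "t \<in> carrier T" for t using that gc h_c unfolding carrier_T by auto
    show "g (t \<oplus>\<^bsub>T\<^esub> u) = g t \<oplus>\<^bsub>C\<^esub> g u" if tu: "t \<in> carrier T" "u \<in> carrier T" for t u
    proof -
      obtain y z where yz: "y \<in> carrier FA" "z \<in> carrier FA" "t = coset y" "u = coset z"
        using tu unfolding carrier_T by auto
      have "y + z \<in> carrier FA" using yz keys_add[of y z] by auto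
      then show ?thesis unfolding yz(3,4) add_T[OF yz(1,2)] using gc yz(1,2) h_add by simp
    qed
    show "g (pure a x) = f a x" if "a \<in> carrier S" "x \<in> carrier N" for a x
      unfolding pure_tensor_def using gc[OF of_c[OF that]] h_of that by simp
  qed
qed

text \<open>For \<open>R\<close>-linear \<open>f\<close> and \<open>g\<close> the substitution of \<open>(f a, g x)\<close> for \<open>(a, x)\<close> maps defining relations to
  defining relations. This makes \<open>tensor_map\<close> independent of representatives.\<close>

context
  fixes f g
  assumes f: "\<And>a. a \<in> carrier S \<Longrightarrow> f a \<in> carrier S"
    "\<And>a b. a \<in> carrier S \<Longrightarrow> b \<in> carrier S \<Longrightarrow> f (a \<oplus>\<^bsub>S\<^esub> b) = f a \<oplus>\<^bsub>S\<^esub> f b"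
    "\<And>r a. r \<in> carrier R \<Longrightarrow> a \<in> carrier S \<Longrightarrow> f (r \<odot>\<^bsub>S\<^esub> a) = r \<odot>\<^bsub>S\<^esub> f a"
    and g: "\<And>x. x \<in> carrier N \<Longrightarrow> g x \<in> carrier N"
    "\<And>x y. x \<in> carrier N \<Longrightarrow> y \<in> carrier N \<Longrightarrow> g (x \<oplus>\<^bsub>N\<^esub> y) = g x \<oplus>\<^bsub>N\<^esub> g y"
    "\<And>r x. r \<in> carrier R \<Longrightarrow> x \<in> carrier N \<Longrightarrow> g (r \<odot>\<^bsub>N\<^esub> x) = r \<odot>\<^bsub>N\<^esub> g x"
begin

abbreviation "fg \<equiv> frag_extend (\<lambda>(a, x). frag_of (f a, g x))"

lemma fg_carrier:
  assumes "z \<in> carrier FA"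
  shows "fg z \<in> carrier FA"
proof -
  have "Poly_Mapping.keys (case p of (a, x) \<Rightarrow> frag_of (f a, g x)) \<subseteq> carrier S \<times> carrier N"
    if p: "p \<in> Poly_Mapping.keys z" for p
  proof -
    have "p \<in> carrier S \<times> carrier N" using p assms by auto
    then obtain a x where "p = (a, x)" "a \<in> carrier S" "x \<in> carrier N" by (rule SigmaE)
    then show ?thesis using f(1) g(1) by simp
  qed
  then have "(\<Union>p\<in>Poly_Mapping.keys z. Poly_Mapping.keys (case p of (a, x) \<Rightarrow> frag_of (f a, g x)))
      \<subseteq> carrier S \<times> carrier N" by (rule UN_least)
  then show ?thesis
    using keys_frag_extend[of "\<lambda>(a, x). frag_of (f a, g x)" z] by simp
qed

lemma fg_Rel: "z \<in> Rel \<Longrightarrow> fg z \<in> Rel"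
  unfolding Rel_eq
proof (induction rule: generate.induct)
  case one
  then show ?case using Rel_zero unfolding Rel_eq by simp
next
  have gen: "fg z \<in> rel_gens" if "z \<in> rel_gens" for z
    using that[unfolded rel_gens_def]
  proof (elim UnE CollectE exE conjE)
    fix a b x assume z: "z = frag_of (a \<oplus>\<^bsub>S\<^esub> b, x) - frag_of (a, x) - frag_of (b, x)"
      and c: "a \<in> carrier S" "b \<in> carrier S" "x \<in> carrier N"
    have "fg z = frag_of (f a \<oplus>\<^bsub>S\<^esub> f b, g x) - frag_of (f a, g x) - frag_of (f b, g x)"
      unfolding z using c f by (simp add: frag_extend_diff)
    then show ?thesis unfolding rel_gens_def using f(1)[OF c(1)] f(1)[OF c(2)] g(1)[OF c(3)] by blast
  next
    fix a x y assume z: "z = frag_of (a, x \<oplus>\<^bsub>N\<^esub> y) - frag_of (a, x) - frag_of (a, y)"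
      and c: "a \<in> carrier S" "x \<in> carrier N" "y \<in> carrier N"
    have "fg z = frag_of (f a, g x \<oplus>\<^bsub>N\<^esub> g y) - frag_of (f a, g x) - frag_of (f a, g y)"
      unfolding z using c g by (simp add: frag_extend_diff)
    then show ?thesis unfolding rel_gens_def using f(1)[OF c(1)] g(1)[OF c(2)] g(1)[OF c(3)] by blast
  next
    fix r a x assume z: "z = frag_of (r \<odot>\<^bsub>S\<^esub> a, x) - frag_of (a, r \<odot>\<^bsub>N\<^esub> x)"
      and c: "r \<in> carrier R" "a \<in> carrier S" "x \<in> carrier N"
    have "fg z = frag_of (r \<odot>\<^bsub>S\<^esub> f a, g x) - frag_of (f a, r \<odot>\<^bsub>N\<^esub> g x)"
      unfolding z using c f g by (simp add: frag_extend_diff)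
    then show ?thesis unfolding rel_gens_def using c(1) f(1)[OF c(2)] g(1)[OF c(3)] by blast
  qed
  { case (incl z) then show ?case using gen by (auto intro: generate.incl) }
  { case (inv z)
    then have "z \<in> carrier FA" using rel_gens_carrier by blast
    moreover have "fg z \<in> generate FA rel_gens" using gen[OF inv] by (rule generate.incl)
    ultimately show ?case using Rel_minus unfolding Rel_eq by (simp add: frag_extend_minus) }
  { case (eng y z)
    then show ?case using Rel_add unfolding Rel_eq by (simp add: frag_extend_add) }
qed

lemma tensor_map_coset:
  assumes z: "z \<in> carrier FA"
  shows "tensor_map R S N f g (coset z) = coset (fg z)"
proof -
  have "coset (fg y) = coset (fg z)" if "y \<in> coset z" for y
    using fg_Rel[of "y - z"] that by (simp add: mem_coset coset_eq_iff frag_extend_diff)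
  moreover have "z \<in> coset z" by (simp add: mem_coset Rel_zero)
  ultimately show ?thesis unfolding tensor_map_def by fast
qed

lemma tensor_map_closed: "t \<in> carrier T \<Longrightarrow> tensor_map R S N f g t \<in> carrier T"
  unfolding carrier_T using tensor_map_coset fg_carrier by auto

lemma tensor_map_add:
  assumes "t \<in> carrier T" "u \<in> carrier T"
  shows "tensor_map R S N f g (t \<oplus>\<^bsub>T\<^esub> u) = tensor_map R S N f g t \<oplus>\<^bsub>T\<^esub> tensor_map R S N f g u"
proof -
  obtain y z where yz: "y \<in> carrier FA" "z \<in> carrier FA" "t = coset y" "u = coset z"
    using assms unfolding carrier_T by auto
  have "y + z \<in> carrier FA" using yz keys_add[of y z] by auto
  then show ?thesis unfolding yz(3,4)
    using yz(1,2) fg_carrier by (simp add: tensor_map_coset add_T frag_extend_add del: carrier_free_Abelian_group_iff)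
qed

lemma tensor_map_pure:
  "a \<in> carrier S \<Longrightarrow> x \<in> carrier N \<Longrightarrow> tensor_map R S N f g (pure a x) = pure (f a) (g x)"
  unfolding pure_tensor_def by (simp add: tensor_map_coset)

lemma tensor_map_zero: "tensor_map R S N f g \<zero>\<^bsub>T\<^esub> = \<zero>\<^bsub>T\<^esub>"
  unfolding zero_T by (simp add: tensor_map_coset)

end

lemma smult_T: "s \<odot>\<^bsub>T\<^esub> t = tensor_map R S N (\<lambda>a. s \<otimes>\<^bsub>S\<^esub> a) (\<lambda>x. x) t"
  unfolding tensor_product_def Let_def by simp

context
  fixes s assumes s: "s \<in> carrier S"
begin

lemma mult_linear:
  "\<And>a. a \<in> carrier S \<Longrightarrow> s \<otimes>\<^bsub>S\<^esub> a \<in> carrier S"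
  "\<And>a b. a \<in> carrier S \<Longrightarrow> b \<in> carrier S \<Longrightarrow> s \<otimes>\<^bsub>S\<^esub> (a \<oplus>\<^bsub>S\<^esub> b) = s \<otimes>\<^bsub>S\<^esub> a \<oplus>\<^bsub>S\<^esub> s \<otimes>\<^bsub>S\<^esub> b"
  "\<And>r a. r \<in> carrier R \<Longrightarrow> a \<in> carrier S \<Longrightarrow> s \<otimes>\<^bsub>S\<^esub> (r \<odot>\<^bsub>S\<^esub> a) = r \<odot>\<^bsub>S\<^esub> (s \<otimes>\<^bsub>S\<^esub> a)"
proof -
  show "s \<otimes>\<^bsub>S\<^esub> a \<in> carrier S" if "a \<in> carrier S" for a using s that by simp
  show "s \<otimes>\<^bsub>S\<^esub> (a \<oplus>\<^bsub>S\<^esub> b) = s \<otimes>\<^bsub>S\<^esub> a \<oplus>\<^bsub>S\<^esub> s \<otimes>\<^bsub>S\<^esub> b" if "a \<in> carrier S" "b \<in> carrier S" for a b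
    using s that by (simp add: S.r_distr)
  show "s \<otimes>\<^bsub>S\<^esub> (r \<odot>\<^bsub>S\<^esub> a) = r \<odot>\<^bsub>S\<^esub> (s \<otimes>\<^bsub>S\<^esub> a)" if "r \<in> carrier R" "a \<in> carrier S" for r a
    using s that S.smult_assoc2[of r a s] by (simp add: S.m_comm)
qed

lemma smult_pure: "a \<in> carrier S \<Longrightarrow> x \<in> carrier N \<Longrightarrow> s \<odot>\<^bsub>T\<^esub> pure a x = pure (s \<otimes>\<^bsub>S\<^esub> a) x"
  unfolding smult_T by (rule tensor_map_pure) (use mult_linear in auto)

lemma smult_closed_T: "t \<in> carrier T \<Longrightarrow> s \<odot>\<^bsub>T\<^esub> t \<in> carrier T"
  unfolding smult_T by (rule tensor_map_closed) (use mult_linear in auto)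

lemma smult_add_T:
  "t \<in> carrier T \<Longrightarrow> u \<in> carrier T \<Longrightarrow> s \<odot>\<^bsub>T\<^esub> (t \<oplus>\<^bsub>T\<^esub> u) = s \<odot>\<^bsub>T\<^esub> t \<oplus>\<^bsub>T\<^esub> s \<odot>\<^bsub>T\<^esub> u"
  unfolding smult_T by (rule tensor_map_add) (use mult_linear in auto)

lemma smult_zero_T: "s \<odot>\<^bsub>T\<^esub> \<zero>\<^bsub>T\<^esub> = \<zero>\<^bsub>T\<^esub>"
  unfolding smult_T by (rule tensor_map_zero) (use mult_linear in auto)

end

theorem module_T: "module S T"
proof (rule moduleI)
  show "cring S" by (rule S.M_cring)
  show "abelian_group T" by (rule abelian_group_T)
  show "s \<odot>\<^bsub>T\<^esub> t \<in> carrier T" if "s \<in> carrier S" "t \<in> carrier T" for s t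
    using smult_closed_T that .
  show "s \<odot>\<^bsub>T\<^esub> (t \<oplus>\<^bsub>T\<^esub> u) = s \<odot>\<^bsub>T\<^esub> t \<oplus>\<^bsub>T\<^esub> s \<odot>\<^bsub>T\<^esub> u"
    if "s \<in> carrier S" "t \<in> carrier T" "u \<in> carrier T" for s t u
    using smult_add_T that .
  show "(s \<oplus>\<^bsub>S\<^esub> s') \<odot>\<^bsub>T\<^esub> t = s \<odot>\<^bsub>T\<^esub> t \<oplus>\<^bsub>T\<^esub> s' \<odot>\<^bsub>T\<^esub> t"
    if s: "s \<in> carrier S" "s' \<in> carrier S" and t: "t \<in> carrier T" for s s' t
    using t
  proof (induction rule: tensor_induct)
    case (add t a x)
    then show ?case
      using s smult_closed_T
      by (simp add: smult_add_T smult_pure S.l_distr pure_add_left T.a_ac)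
  qed (use s in \<open>simp add: smult_zero_T\<close>)
  show "(s \<otimes>\<^bsub>S\<^esub> s') \<odot>\<^bsub>T\<^esub> t = s \<odot>\<^bsub>T\<^esub> (s' \<odot>\<^bsub>T\<^esub> t)"
    if s: "s \<in> carrier S" "s' \<in> carrier S" and t: "t \<in> carrier T" for s s' t
    using t
  proof (induction rule: tensor_induct)
    case (add t a x)
    then show ?case
      using s smult_closed_T by (simp add: smult_add_T smult_pure S.m_assoc)
  qed (use s in \<open>simp add: smult_zero_T\<close>)
  show "\<one>\<^bsub>S\<^esub> \<odot>\<^bsub>T\<^esub> t = t" if t: "t \<in> carrier T" for t
    using t
  proof (induction rule: tensor_induct)
    case (add t a x)
    then show ?case by (simp add: smult_add_T smult_pure)
  qed (simp add: smult_zero_T)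
qed

end

section \<open>Gradings\<close>

lemma finsum_substructure:
  assumes "abelian_monoid M" "abelian_monoid M'" "carrier M' \<subseteq> carrier M"
    "ring.add M' = ring.add M" "ring.zero M' = ring.zero M" "f \<in> F \<rightarrow> carrier M'"
  shows "finsum M' f F = finsum M f F"
proof -
  interpret M: abelian_monoid M by fact
  interpret M': abelian_monoid M' by fact
  show ?thesis
    using assms(6)
  proof (induction F rule: infinite_finite_induct)
    case (insert i F)
    then have "f \<in> F \<rightarrow> carrier M'" "f i \<in> carrier M'" "f \<in> F \<rightarrow> carrier M" "f i \<in> carrier M"
      using assms(3) by auto
    then show ?case using insert by (simp add: M.finsum_insert M'.finsum_insert assms(4))
  qed (simp_all add: assms(5))
qed

lemma a_inv_substructure:
  assumes "abelian_group M" "abelian_group M'" "carrier M' \<subseteq> carrier M"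
    "ring.add M' = ring.add M" "ring.zero M' = ring.zero M" "x \<in> carrier M'"
  shows "\<ominus>\<^bsub>M'\<^esub> x = \<ominus>\<^bsub>M\<^esub> x"
proof -
  interpret M: abelian_group M by fact
  interpret M': abelian_group M' by fact
  have "(\<ominus>\<^bsub>M'\<^esub> x) \<oplus>\<^bsub>M\<^esub> x = \<zero>\<^bsub>M\<^esub>" using M'.l_neg[OF assms(6)] assms(4,5) by simp
  moreover have "\<ominus>\<^bsub>M'\<^esub> x \<in> carrier M" using M'.a_inv_closed[OF assms(6)] assms(3) by auto
  ultimately show ?thesis using M.minus_equality[of "\<ominus>\<^bsub>M'\<^esub> x" x] assms(3,6) by auto
qed

text \<open>Existence and uniqueness of homogeneous decompositions are treated separately. Both are expressed
  by sums over initial segments of the degrees, which can be extended by zero and compared termwise,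
  instead of sums over the support.\<close>

definition graded_sums :: "('b, 'm) ring_scheme \<Rightarrow> (nat \<Rightarrow> 'b set) \<Rightarrow> 'b set" where
  "graded_sums M gr = {finsum M c {..<n} | c n. \<forall>i. c i \<in> gr i}"

definition graded_independent :: "('b, 'm) ring_scheme \<Rightarrow> (nat \<Rightarrow> 'b set) \<Rightarrow> bool" where
  "graded_independent M gr \<longleftrightarrow> (\<forall>c n. (\<forall>i. c i \<in> gr i) \<longrightarrow> finsum M c {..<n} = \<zero>\<^bsub>M\<^esub> \<longrightarrow>
     (\<forall>i<n. c i = \<zero>\<^bsub>M\<^esub>))"

lemma graded_independentD:
  "graded_independent M gr \<Longrightarrow> (\<And>i. c i \<in> gr i) \<Longrightarrow> finsum M c {..<n} = \<zero>\<^bsub>M\<^esub> \<Longrightarrow> i < n \<Longrightarrow> c i = \<zero>\<^bsub>M\<^esub>"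
  unfolding graded_independent_def by simp

context abelian_group
begin

lemma additive_subgroup_intro:
  assumes "H \<subseteq> carrier G" "\<zero> \<in> H" "\<And>x y. x \<in> H \<Longrightarrow> y \<in> H \<Longrightarrow> x \<oplus> y \<in> H"
    "\<And>x. x \<in> H \<Longrightarrow> \<ominus> x \<in> H"
  shows "additive_subgroup H G"
  by (rule additive_subgroup.intro, rule add.subgroupI) (use assms in auto)

lemma finsum_mem:
  assumes "\<zero> \<in> H" "\<And>x y. x \<in> H \<Longrightarrow> y \<in> H \<Longrightarrow> x \<oplus> y \<in> H" "H \<subseteq> carrier G"
    and "\<And>i. i \<in> F \<Longrightarrow> f i \<in> H"
  shows "(\<Oplus>i\<in>F. f i) \<in> H"
  using assms(4)
proof (induction F rule: infinite_finite_induct)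
  case (insert i F)
  then have "f \<in> F \<rightarrow> carrier G" "f i \<in> carrier G" using assms(3) by auto
  then show ?case using insert assms(2) by simp
qed (use assms(1) in auto)

context
  fixes gr :: "nat \<Rightarrow> 'a set" assumes sub: "\<And>i. additive_subgroup (gr i) G"
begin

lemma gr_carrier: "x \<in> gr i \<Longrightarrow> x \<in> carrier G"
  using additive_subgroup.a_subset[OF sub] by blast

lemma gr_zero: "\<zero> \<in> gr i"
  using additive_subgroup.zero_closed[OF sub] .

lemma gr_add: "x \<in> gr i \<Longrightarrow> y \<in> gr i \<Longrightarrow> x \<oplus> y \<in> gr i"
  using additive_subgroup.a_closed[OF sub] .

lemma gr_minus: "x \<in> gr i \<Longrightarrow> y \<in> gr i \<Longrightarrow> x \<ominus> y \<in> gr i"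
  unfolding minus_eq by (intro gr_add additive_subgroup.a_inv_closed[OF sub])

lemma finsum_extend:
  assumes "\<And>i. c i \<in> gr i" "finite F" "F \<subseteq> F'" "finite F'"
  shows "(\<Oplus>i\<in>F. c i) = (\<Oplus>i\<in>F'. if i \<in> F then c i else \<zero>)"
  by (rule add.finprod_mono_neutral_cong_left) (use assms gr_carrier[OF assms(1)] in auto)

lemma graded_sumsI: "(\<And>i. c i \<in> gr i) \<Longrightarrow> (\<Oplus>i\<in>{..<n}. c i) \<in> graded_sums G gr"
  unfolding graded_sums_def by auto

lemma graded_sumsE:
  assumes "x \<in> graded_sums G gr"
  obtains c n where "\<And>i. c i \<in> gr i" "x = (\<Oplus>i\<in>{..<n}. c i)"
  using assms unfolding graded_sums_def by auto

lemma graded_sums_carrier: "x \<in> graded_sums G gr \<Longrightarrow> x \<in> carrier G"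
  by (erule graded_sumsE) (use gr_carrier in \<open>auto intro!: finsum_closed\<close>)

lemma graded_sums_incl:
  assumes "x \<in> gr i"
  shows "x \<in> graded_sums G gr"
proof -
  let ?c = "\<lambda>j. if i = j then x else \<zero>"
  have "(\<Oplus>j\<in>{..<Suc i}. ?c j) \<in> graded_sums G gr"
    by (rule graded_sumsI) (use assms gr_zero in auto)
  moreover have "(\<Oplus>j\<in>{..<Suc i}. ?c j) = x"
    by (rule finsum_singleton) (use gr_carrier[OF assms] in auto)
  ultimately show ?thesis by simp
qed

lemma graded_sums_add:
  assumes "x \<in> graded_sums G gr" "y \<in> graded_sums G gr"
  shows "x \<oplus> y \<in> graded_sums G gr"
proof -
  obtain c m where c: "\<And>i. c i \<in> gr i" "x = (\<Oplus>i\<in>{..<m}. c i)" by (rule graded_sumsE[OF assms(1)]) (rule that)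
  obtain d n where d: "\<And>i. d i \<in> gr i" "y = (\<Oplus>i\<in>{..<n}. d i)" by (rule graded_sumsE[OF assms(2)]) (rule that)
  let ?c = "\<lambda>i. if i \<in> {..<m} then c i else \<zero>" and ?d = "\<lambda>i. if i \<in> {..<n} then d i else \<zero>"
  have "x = (\<Oplus>i\<in>{..<max m n}. ?c i)" unfolding c(2) by (rule finsum_extend[OF c(1)]) auto
  moreover have "y = (\<Oplus>i\<in>{..<max m n}. ?d i)" unfolding d(2) by (rule finsum_extend[OF d(1)]) auto
  moreover have "(\<Oplus>i\<in>{..<max m n}. ?c i \<oplus> ?d i) = (\<Oplus>i\<in>{..<max m n}. ?c i) \<oplus> (\<Oplus>i\<in>{..<max m n}. ?d i)"
    by (rule finsum_addf) (use gr_carrier[OF c(1)] gr_carrier[OF d(1)] in auto)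
  moreover have "(\<Oplus>i\<in>{..<max m n}. ?c i \<oplus> ?d i) \<in> graded_sums G gr"
    by (rule graded_sumsI) (use c(1) d(1) gr_add[OF c(1) d(1)] gr_zero gr_carrier[OF c(1)] gr_carrier[OF d(1)] in auto)
  ultimately show ?thesis by simp
qed

lemma graded_sums_zero: "\<zero> \<in> graded_sums G gr"
  by (rule graded_sums_incl[of _ 0]) (rule gr_zero)

lemma is_grading_imp_graded_sums:
  assumes "is_grading G gr" "x \<in> carrier G"
  shows "x \<in> graded_sums G gr"
proof -
  obtain c where c: "\<And>i. c i \<in> gr i" "finite {i. c i \<noteq> \<zero>}" "x = (\<Oplus>i\<in>{i. c i \<noteq> \<zero>}. c i)"
    using assms unfolding is_grading_def by blast
  show ?thesis unfolding c(3)
    by (rule finsum_mem[OF graded_sums_zero graded_sums_add]) (use graded_sums_carrier graded_sums_incl c(1) in auto)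
qed

lemma is_grading_imp_independent:
  assumes "is_grading G gr"
  shows "graded_independent G gr"
  unfolding graded_independent_def
proof (intro allI impI)
  fix c n i assume c: "\<forall>i. c i \<in> gr i" and sum: "(\<Oplus>i\<in>{..<n}. c i) = \<zero>" and i: "i < n"
  define Q where "Q d \<longleftrightarrow> (\<forall>i. d i \<in> gr i) \<and> finite {i. d i \<noteq> \<zero>} \<and> \<zero> = (\<Oplus>i\<in>{i. d i \<noteq> \<zero>}. d i)" for d
  let ?c = "\<lambda>i. if i < n then c i else \<zero>"
  have ex: "\<exists>!d. Q d" using assms zero_closed unfolding is_grading_def Q_def by blast
  have fin: "finite {i. ?c i \<noteq> \<zero>}" by (rule finite_subset[of _ "{..<n}"]) auto
  have "(\<Oplus>i\<in>{i. ?c i \<noteq> \<zero>}. ?c i) = (\<Oplus>i\<in>{..<n}. c i)"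
    by (rule add.finprod_mono_neutral_cong_left) (use gr_carrier[OF spec[OF c]] in \<open>auto split: if_splits\<close>)
  then have "Q ?c" unfolding Q_def using c gr_zero sum fin by auto
  moreover have "Q (\<lambda>i. \<zero>)" unfolding Q_def using gr_zero by simp
  ultimately have "?c = (\<lambda>i. \<zero>)" using ex by blast
  then have "?c i = \<zero>" by (rule fun_cong)
  then show "c i = \<zero>" using i by simp
qed

lemma is_gradingI:
  assumes sums: "\<And>x. x \<in> carrier G \<Longrightarrow> x \<in> graded_sums G gr" and ind: "graded_independent G gr"
  shows "is_grading G gr"
  unfolding is_grading_def
proof (intro conjI allI ballI sub)
  fix x assume x: "x \<in> carrier G"
  obtain c n where c: "\<And>i. c i \<in> gr i" "x = (\<Oplus>i\<in>{..<n}. c i)" by (rule graded_sumsE[OF sums[OF x]]) (rule that)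
  let ?c = "\<lambda>i. if i < n then c i else \<zero>"
  have bound: "(\<Oplus>i\<in>{i. d i \<noteq> \<zero>}. d i) = (\<Oplus>i\<in>{..<m}. d i)"
    if "\<And>i. d i \<in> gr i" "{i. d i \<noteq> \<zero>} \<subseteq> {..<m}" for d m
    by (rule add.finprod_mono_neutral_cong_left) (use that(2) gr_carrier[OF that(1)] in auto)
  show "\<exists>!c. (\<forall>i. c i \<in> gr i) \<and> finite {i. c i \<noteq> \<zero>} \<and> x = (\<Oplus>i\<in>{i. c i \<noteq> \<zero>}. c i)"
  proof (rule ex_ex1I)
    have cc: "?c i \<in> gr i" for i using c(1) gr_zero by simp
    have s: "{i. ?c i \<noteq> \<zero>} \<subseteq> {..<n}" by auto
    have "x = (\<Oplus>i\<in>{i. ?c i \<noteq> \<zero>}. ?c i)"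
      unfolding bound[OF cc s] c(2) by (rule finsum_cong') (use gr_carrier[OF c(1)] in auto)
    then show "\<exists>c. (\<forall>i. c i \<in> gr i) \<and> finite {i. c i \<noteq> \<zero>} \<and> x = (\<Oplus>i\<in>{i. c i \<noteq> \<zero>}. c i)"
      using cc finite_subset[OF s] by (intro exI[of _ ?c]) auto
  next
    fix d e assume d: "(\<forall>i. d i \<in> gr i) \<and> finite {i. d i \<noteq> \<zero>} \<and> x = (\<Oplus>i\<in>{i. d i \<noteq> \<zero>}. d i)"
      and e: "(\<forall>i. e i \<in> gr i) \<and> finite {i. e i \<noteq> \<zero>} \<and> x = (\<Oplus>i\<in>{i. e i \<noteq> \<zero>}. e i)"
    have "finite ({i. d i \<noteq> \<zero>} \<union> {i. e i \<noteq> \<zero>})" using d e by simp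
    then obtain m where m: "{i. d i \<noteq> \<zero>} \<union> {i. e i \<noteq> \<zero>} \<subseteq> {..<m}"
      using finite_nat_iff_bounded by blast
    have dm: "x = (\<Oplus>i\<in>{..<m}. d i)" using bound[of d m] d m by simp
    have em: "x = (\<Oplus>i\<in>{..<m}. e i)" using bound[of e m] e m by simp
    have c: "d i \<in> carrier G" "e i \<in> carrier G" for i using d e gr_carrier by blast+
    have "(\<Oplus>i\<in>{..<m}. d i \<ominus> e i) \<oplus> (\<Oplus>i\<in>{..<m}. e i) = (\<Oplus>i\<in>{..<m}. (d i \<ominus> e i) \<oplus> e i)"
      by (rule finsum_addf[symmetric]) (use c in auto)
    also have "\<dots> = (\<Oplus>i\<in>{..<m}. d i)"
      by (rule finsum_cong') (use c in \<open>auto simp: minus_eq a_assoc l_neg\<close>)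
    finally have "(\<Oplus>i\<in>{..<m}. d i \<ominus> e i) \<oplus> x = x" unfolding dm[symmetric] em[symmetric] .
    moreover have "(\<Oplus>i\<in>{..<m}. d i \<ominus> e i) \<in> carrier G" by (rule finsum_closed) (use c in auto)
    ultimately have sum0: "(\<Oplus>i\<in>{..<m}. d i \<ominus> e i) = \<zero>" using x by simp
    have "d i \<ominus> e i \<in> gr i" for i using d e gr_minus[of "d i" i "e i"] by simp
    then have de: "d i \<ominus> e i = \<zero>" if "i < m" for i
      by (rule graded_independentD[OF ind _ sum0 that])
    show "d = e"
    proof
      fix i
      show "d i = e i"
      proof (cases "i < m")
        case True
        then show ?thesis using de[OF True] c by simp
      next
        case False
        then have "i \<notin> {..<m}" by simp
        then have "d i = \<zero>" "e i = \<zero>" using m by blast+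
        then show ?thesis by simp
      qed
    qed
  qed
qed

text \<open>A degree preserving additive map transforms the homogeneous decomposition of an element it fixes
  into a second one of the same element. By uniqueness the components are fixed as well.\<close>

lemma is_grading_fixed_points:
  fixes M' :: "('a, 'm) ring_scheme"
  assumes gr: "is_grading G gr" and M': "abelian_group M'"
    and same: "ring.add M' = ring.add G" "ring.zero M' = ring.zero G"
    and carrier': "carrier M' = {x \<in> carrier G. \<forall>\<phi> \<in> H. \<phi> x = x}"
    and closed: "\<And>\<phi> x. \<phi> \<in> H \<Longrightarrow> x \<in> carrier G \<Longrightarrow> \<phi> x \<in> carrier G"
    and add: "\<And>\<phi> x y. \<phi> \<in> H \<Longrightarrow> x \<in> carrier G \<Longrightarrow> y \<in> carrier G \<Longrightarrow> \<phi> (x \<oplus> y) = \<phi> x \<oplus> \<phi> y"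
    and deg: "\<And>\<phi> i x. \<phi> \<in> H \<Longrightarrow> x \<in> gr i \<Longrightarrow> \<phi> x \<in> gr i"
    and gr': "\<And>i. gr' i = {x \<in> gr i. \<forall>\<phi> \<in> H. \<phi> x = x}"
  shows "is_grading M' gr'"
proof -
  interpret M': abelian_group M' by fact
  have sub': "carrier M' \<subseteq> carrier G" unfolding carrier' by auto
  have gr'c: "x \<in> carrier M'" if "x \<in> gr' i" for x i
    using that gr_carrier unfolding gr' carrier' by auto
  have sum_eq: "finsum M' f F = (\<Oplus>i\<in>F. f i)" if "f \<in> F \<rightarrow> carrier M'" for f and F :: "nat set"
    by (rule finsum_substructure[OF _ _ sub' same that]) unfold_locales
  have \<phi>0: "\<phi> \<zero> = \<zero>" if "\<phi> \<in> H" for \<phi>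
    using add[OF that zero_closed zero_closed] closed[OF that zero_closed] by simp
  have \<phi>_sum: "\<phi> (\<Oplus>i\<in>F. f i) = (\<Oplus>i\<in>F. \<phi> (f i))" if "\<phi> \<in> H" "f \<in> F \<rightarrow> carrier G" for \<phi> f and F :: "nat set"
    using that(2)
  proof (induction F rule: infinite_finite_induct)
    case (insert i F)
    then have "f \<in> F \<rightarrow> carrier G" "f i \<in> carrier G" "(\<lambda>i. \<phi> (f i)) \<in> F \<rightarrow> carrier G" "\<phi> (f i) \<in> carrier G"
      using closed[OF that(1)] by auto
    then show ?case using insert by (simp add: add[OF that(1)])
  qed (use \<phi>0[OF that(1)] in auto)
  have subgr': "additive_subgroup (gr' i) M'" for i
  proof (rule M'.additive_subgroup_intro)
    show "gr' i \<subseteq> carrier M'" using gr'c by auto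
    show "\<zero>\<^bsub>M'\<^esub> \<in> gr' i" unfolding gr' same using gr_zero \<phi>0 by auto
    show "x \<oplus>\<^bsub>M'\<^esub> y \<in> gr' i" if "x \<in> gr' i" "y \<in> gr' i" for x y
    proof -
      have xy: "x \<in> gr i" "y \<in> gr i" "\<And>\<phi>. \<phi> \<in> H \<Longrightarrow> \<phi> x = x" "\<And>\<phi>. \<phi> \<in> H \<Longrightarrow> \<phi> y = y"
        using that unfolding gr' by auto
      have "\<phi> (x \<oplus> y) = x \<oplus> y" if "\<phi> \<in> H" for \<phi>
        using add[OF that gr_carrier[OF xy(1)] gr_carrier[OF xy(2)]] xy(3,4)[OF that] by simp
      then show ?thesis using gr_add[OF xy(1,2)] unfolding gr' same by simp
    qed
    show "\<ominus>\<^bsub>M'\<^esub> x \<in> gr' i" if x: "x \<in> gr' i" for x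
    proof -
      have "\<ominus>\<^bsub>M'\<^esub> x = \<ominus> x"
        by (rule a_inv_substructure[OF abelian_group_axioms M' sub' same gr'c[OF x]])
      moreover have "\<ominus> x \<in> gr i" using x additive_subgroup.a_inv_closed[OF sub] unfolding gr' by auto
      moreover have "\<ominus>\<^bsub>M'\<^esub> x \<in> carrier M'" using gr'c[OF x] by simp
      ultimately show ?thesis unfolding gr' carrier' by auto
    qed
  qed
  show ?thesis
  proof (rule M'.is_gradingI[OF subgr'])
    fix x assume x: "x \<in> carrier M'"
    then have xc: "x \<in> carrier G" and x_fix: "\<And>\<phi>. \<phi> \<in> H \<Longrightarrow> \<phi> x = x" unfolding carrier' by auto
    obtain c n where c: "\<And>i. c i \<in> gr i" "x = (\<Oplus>i\<in>{..<n}. c i)"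
      by (rule graded_sumsE[OF is_grading_imp_graded_sums[OF gr xc]]) (rule that)
    have cc: "c i \<in> carrier G" for i using c(1) gr_carrier by blast
    have c_fix: "\<phi> (c i) = c i" if \<phi>: "\<phi> \<in> H" and i: "i < n" for \<phi> i
    proof -
      have \<phi>c: "\<phi> (c i) \<in> carrier G" for i using closed[OF \<phi> cc] .
      have "(\<Oplus>i\<in>{..<n}. \<phi> (c i) \<ominus> c i) \<oplus> (\<Oplus>i\<in>{..<n}. c i) = (\<Oplus>i\<in>{..<n}. (\<phi> (c i) \<ominus> c i) \<oplus> c i)"
        by (rule finsum_addf[symmetric]) (use cc \<phi>c in auto)
      also have "\<dots> = (\<Oplus>i\<in>{..<n}. \<phi> (c i))"
        by (rule finsum_cong') (use cc \<phi>c in \<open>auto simp: minus_eq a_assoc l_neg\<close>)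
      also have "\<dots> = \<phi> x" unfolding c(2) by (rule \<phi>_sum[OF \<phi>, symmetric]) (use cc in auto)
      finally have "(\<Oplus>i\<in>{..<n}. \<phi> (c i) \<ominus> c i) \<oplus> x = x" unfolding c(2)[symmetric] x_fix[OF \<phi>] .
      moreover have "(\<Oplus>i\<in>{..<n}. \<phi> (c i) \<ominus> c i) \<in> carrier G" by (rule finsum_closed) (use cc \<phi>c in auto)
      ultimately have sum0: "(\<Oplus>i\<in>{..<n}. \<phi> (c i) \<ominus> c i) = \<zero>" using xc by simp
      have "\<phi> (c i) \<ominus> c i \<in> gr i" for i by (rule gr_minus[OF deg[OF \<phi> c(1)] c(1)])
      then have "\<phi> (c i) \<ominus> c i = \<zero>"
        by (rule graded_independentD[OF is_grading_imp_independent[OF gr] _ sum0 i])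
      then show ?thesis using cc \<phi>c by simp
    qed
    let ?c = "\<lambda>i. if i < n then c i else \<zero>"
    have c': "?c i \<in> gr' i" for i unfolding gr' using c(1) c_fix gr_zero \<phi>0 by auto
    have "x = (\<Oplus>i\<in>{..<n}. ?c i)" unfolding c(2) by (rule finsum_cong') (use cc in auto)
    also have "\<dots> = finsum M' ?c {..<n}" by (rule sum_eq[symmetric]) (use gr'c[OF c'] in auto)
    finally show "x \<in> graded_sums M' gr'" using M'.graded_sumsI[OF subgr' c'] by simp
  next
    show "graded_independent M' gr'"
      unfolding graded_independent_def
    proof (intro allI impI)
      fix c n i assume c: "\<forall>i. c i \<in> gr' i" and sum: "finsum M' c {..<n} = \<zero>\<^bsub>M'\<^esub>" and i: "i < n"
      have "c \<in> {..<n} \<rightarrow> carrier M'" using gr'c[OF spec[OF c]] by auto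
      then have sum0: "(\<Oplus>i\<in>{..<n}. c i) = \<zero>" using sum sum_eq[of c "{..<n}"] same by simp
      have "c i \<in> gr i" for i using spec[OF c, of i] unfolding gr' by simp
      then show "c i = \<zero>\<^bsub>M'\<^esub>"
        unfolding same by (rule graded_independentD[OF is_grading_imp_independent[OF gr] _ sum0 i])
    qed
  qed
qed

end

end

context tensor
begin

context
  fixes grS :: "nat \<Rightarrow> 's set" and grN :: "nat \<Rightarrow> 'n set"
  assumes grS: "\<And>i. grS i \<subseteq> carrier S" and grN: "\<And>i. grN i \<subseteq> carrier N"
begin

abbreviation TG :: "nat \<Rightarrow> ('s \<times> 'n \<Rightarrow>\<^sub>0 int) set set" where
  "TG \<equiv> tensor_grading R S grS N grN"

lemma tensor_grading_subgroup: "additive_subgroup (TG n) T"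
  unfolding tensor_grading_def
  by (rule additive_subgroup.intro, rule group.generate_is_subgroup[OF T.a_group]) (use subsetD[OF grS] subsetD[OF grN] in auto)

lemma pure_in_tensor_grading: "a \<in> grS i \<Longrightarrow> x \<in> grN j \<Longrightarrow> pure a x \<in> TG (i + j)"
  unfolding tensor_grading_def by (rule generate.incl) auto

lemma tensor_grading_induct [consumes 1, case_names zero pure add minus]:
  assumes "t \<in> TG n" and "P \<zero>\<^bsub>T\<^esub>"
    and "\<And>a x i j. a \<in> grS i \<Longrightarrow> x \<in> grN j \<Longrightarrow> i + j = n \<Longrightarrow> P (pure a x)"
    and "\<And>t u. t \<in> TG n \<Longrightarrow> u \<in> TG n \<Longrightarrow> P t \<Longrightarrow> P u \<Longrightarrow> P (t \<oplus>\<^bsub>T\<^esub> u)"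
    and "\<And>t. t \<in> TG n \<Longrightarrow> P t \<Longrightarrow> P (\<ominus>\<^bsub>T\<^esub> t)"
  shows "P t"
  using assms(1) unfolding tensor_grading_def
proof induction
  case one
  then show ?case using assms(2) by simp
next
  case (incl t)
  then show ?case using assms(3) by auto
next
  case (inv t)
  then obtain a x i j where t: "t = pure a x" "a \<in> grS i" "x \<in> grN j" "i + j = n" by auto
  have "t \<in> TG n" using t pure_in_tensor_grading by auto
  then have "P (\<ominus>\<^bsub>T\<^esub> t)" using assms(3,5) t by blast
  then show ?case unfolding a_inv_def .
next
  case (eng t u)
  then show ?case using assms(4) unfolding tensor_grading_def by simp
qed

text \<open>Decompose first the right and then the left factor of a pure tensor.\<close>

lemma tensor_graded_sums:
  assumes S: "\<And>a. a \<in> carrier S \<Longrightarrow> a \<in> graded_sums S grS"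
    and N: "\<And>x. x \<in> carrier N \<Longrightarrow> x \<in> graded_sums N grN"
    and t: "t \<in> carrier T"
  shows "t \<in> graded_sums T TG"
proof -
  have sub: "additive_subgroup (TG n) T" for n by (rule tensor_grading_subgroup)
  let ?D = "graded_sums T TG"
  have D: "\<zero>\<^bsub>T\<^esub> \<in> ?D" "\<And>t u. t \<in> ?D \<Longrightarrow> u \<in> ?D \<Longrightarrow> t \<oplus>\<^bsub>T\<^esub> u \<in> ?D" "?D \<subseteq> carrier T"
    using T.graded_sums_zero[where gr = TG, OF sub] T.graded_sums_add[where gr = TG, OF sub] T.graded_sums_carrier[where gr = TG, OF sub] by auto
  have hom: "pure a x \<in> ?D" if a: "a \<in> grS i" and x: "x \<in> carrier N" for a x i
  proof -
    let ?H = "{x \<in> carrier N. pure a x \<in> ?D}"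
    have ac: "a \<in> carrier S" using a grS by auto
    obtain c n where c: "\<And>j. c j \<in> grN j" "x = finsum N c {..<n}"
      using N[OF x] unfolding graded_sums_def by auto
    have "c j \<in> ?H" for j
      using T.graded_sums_incl[where gr = TG, OF sub pure_in_tensor_grading[OF a c(1)]] c(1) grN by auto
    then have "finsum N c {..<n} \<in> ?H"
      by (intro N.M.finsum_mem[of ?H]) (use D pure_add_right[OF ac] pure_zero_right[OF ac] in auto)
    then show ?thesis using c(2) by simp
  qed
  have "pure a x \<in> ?D" if a: "a \<in> carrier S" and x: "x \<in> carrier N" for a x
  proof -
    let ?H = "{a \<in> carrier S. pure a x \<in> ?D}"
    obtain c n where c: "\<And>j. c j \<in> grS j" "a = finsum S c {..<n}"
      using S[OF a] unfolding graded_sums_def by auto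
    have "c j \<in> ?H" for j using hom[OF c(1) x] c(1) grS by auto
    then have "finsum S c {..<n} \<in> ?H"
      by (intro S.finsum_mem[of ?H]) (use D pure_add_left[OF _ _ x] pure_zero_left[OF x] in auto)
    then show ?thesis using c(2) by simp
  qed
  with t show ?thesis by (induction rule: tensor_induct) (use D in auto)
qed

end

text \<open>The coordinates of \<open>S \<otimes> N\<close> with respect to a basis \<open>Y\<close> of \<open>N\<close> over a field: the map \<open>\<Phi> b\<close> sends
  \<open>a \<otimes> x\<close> to \<open>a\<close> multiplied by the \<open>b\<close>-coordinate of \<open>x\<close>. Of this coordinate only its membership in \<open>R\<close> is
  recorded, which ensures that \<open>\<Phi> b\<close> respects degrees when \<open>N\<close> is in degree zero.\<close>

definition coordinate_system :: "'n set \<Rightarrow> ('n \<Rightarrow> ('s \<times> 'n \<Rightarrow>\<^sub>0 int) set \<Rightarrow> 's) \<Rightarrow> bool" where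
  "coordinate_system Y \<Phi> \<longleftrightarrow> (\<forall>b \<in> Y. (\<forall>t \<in> carrier T. \<Phi> b t \<in> carrier S) \<and>
      (\<forall>t \<in> carrier T. \<forall>u \<in> carrier T. \<Phi> b (t \<oplus>\<^bsub>T\<^esub> u) = \<Phi> b t \<oplus>\<^bsub>S\<^esub> \<Phi> b u) \<and>
      (\<forall>a \<in> carrier S. \<forall>x \<in> carrier N. \<exists>r \<in> carrier R. \<Phi> b (pure a x) = r \<odot>\<^bsub>S\<^esub> a) \<and>
      (\<forall>s \<in> carrier S. \<forall>t \<in> carrier T. \<Phi> b (s \<odot>\<^bsub>T\<^esub> t) = s \<otimes>\<^bsub>S\<^esub> \<Phi> b t)) \<and>
      (\<forall>t \<in> carrier T. (\<forall>b \<in> Y. \<Phi> b t = \<zero>\<^bsub>S\<^esub>) \<longrightarrow> t = \<zero>\<^bsub>T\<^esub>)"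

text \<open>The coordinate maps come from the universal property. They vanish simultaneously only at zero because
  of the expansion \<open>t = \<Sum> \<Phi> b t \<otimes> b\<close>.\<close>

lemma exists_coordinates:
  assumes vs: "vectorspace R N" and fd: "vectorspace.fin_dim R N"
  shows "\<exists>Y \<Phi>. coordinate_system Y \<Phi>"
proof -
  interpret VS: vectorspace R N by fact
  obtain Y where Y: "finite Y" "VS.basis Y" using VS.finite_basis_exists[OF fd] by blast
  have Yc: "Y \<subseteq> carrier N" using Y(2) VS.basis_def by auto
  have ex1: "\<exists>!a. a \<in> Y \<rightarrow>\<^sub>E carrier R \<and> N.lincomb a Y = x" if "x \<in> carrier N" for x
    using VS.basis_criterion[OF Y(1) Yc] Y(2) that by blast
  define co where "co x = (THE a. a \<in> Y \<rightarrow>\<^sub>E carrier R \<and> N.lincomb a Y = x)" for x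
  have co: "co x \<in> Y \<rightarrow>\<^sub>E carrier R" "N.lincomb (co x) Y = x" if "x \<in> carrier N" for x
    using theI'[OF ex1[OF that]] unfolding co_def by auto
  have coc: "co x b \<in> carrier R" if "x \<in> carrier N" "b \<in> Y" for x b using co(1)[OF that(1)] that(2) by auto
  have uniq: "co x b = a b" if x: "x \<in> carrier N" and a: "a \<in> Y \<rightarrow> carrier R" "N.lincomb a Y = x" and b: "b \<in> Y" for x a b
  proof -
    have "N.lincomb (restrict a Y) Y = x"
      unfolding a(2)[symmetric] by (rule N.lincomb_cong) (use Yc a in auto)
    moreover have "restrict a Y \<in> Y \<rightarrow>\<^sub>E carrier R" using a by auto
    ultimately have "co x = restrict a Y" using ex1[OF x] co[OF x] by blast
    then show ?thesis using b by simp
  qed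
  have terms: "co x b \<odot>\<^bsub>N\<^esub> b \<in> carrier N" if "x \<in> carrier N" "b \<in> Y" for x b using coc that Yc by auto
  have co_add: "co (x \<oplus>\<^bsub>N\<^esub> y) b = co x b \<oplus>\<^bsub>R\<^esub> co y b" if x: "x \<in> carrier N" and y: "y \<in> carrier N" and b: "b \<in> Y" for x y b
  proof (rule uniq[OF _ _ _ b])
    show "x \<oplus>\<^bsub>N\<^esub> y \<in> carrier N" using x y by simp
    show "(\<lambda>b. co x b \<oplus>\<^bsub>R\<^esub> co y b) \<in> Y \<rightarrow> carrier R" using coc x y by auto
    have "N.lincomb (\<lambda>b. co x b \<oplus>\<^bsub>R\<^esub> co y b) Y = (\<Oplus>\<^bsub>N\<^esub>b\<in>Y. co x b \<odot>\<^bsub>N\<^esub> b \<oplus>\<^bsub>N\<^esub> co y b \<odot>\<^bsub>N\<^esub> b)"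
      unfolding N.lincomb_def
      by (rule N.M.finsum_cong') (use terms x y coc Yc in \<open>auto simp: N.smult_l_distr subset_iff\<close>)
    also have "\<dots> = N.lincomb (co x) Y \<oplus>\<^bsub>N\<^esub> N.lincomb (co y) Y"
      unfolding N.lincomb_def by (rule N.M.finsum_addf) (use terms x y in auto)
    finally show "N.lincomb (\<lambda>b. co x b \<oplus>\<^bsub>R\<^esub> co y b) Y = x \<oplus>\<^bsub>N\<^esub> y" using co(2) x y by simp
  qed
  have co_smult: "co (r \<odot>\<^bsub>N\<^esub> x) b = r \<otimes>\<^bsub>R\<^esub> co x b" if r: "r \<in> carrier R" and x: "x \<in> carrier N" and b: "b \<in> Y" for r x b
  proof (rule uniq[OF _ _ _ b])
    show "r \<odot>\<^bsub>N\<^esub> x \<in> carrier N" using r x by simp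
    show c: "(\<lambda>b. r \<otimes>\<^bsub>R\<^esub> co x b) \<in> Y \<rightarrow> carrier R" using coc r x by auto
    show "N.lincomb (\<lambda>b. r \<otimes>\<^bsub>R\<^esub> co x b) Y = r \<odot>\<^bsub>N\<^esub> x"
      using N.lincomb_smult[OF Yc _ r, of "co x"] co[OF x] coc x by auto
  qed
  define Q where "Q b h \<longleftrightarrow> (\<forall>t \<in> carrier T. h t \<in> carrier S) \<and>
      (\<forall>t \<in> carrier T. \<forall>u \<in> carrier T. h (t \<oplus>\<^bsub>T\<^esub> u) = h t \<oplus>\<^bsub>S\<^esub> h u) \<and>
      (\<forall>a \<in> carrier S. \<forall>x \<in> carrier N. h (pure a x) = co x b \<odot>\<^bsub>S\<^esub> a)" for b h
  have ex_Q: "\<exists>h. Q b h" if b: "b \<in> Y" for b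
    unfolding Q_def
  proof (rule universal)
    show "abelian_group S" by (rule S.is_abelian_group)
    show "co x b \<odot>\<^bsub>S\<^esub> a \<in> carrier S" if "a \<in> carrier S" "x \<in> carrier N" for a x using coc b that by simp
    show "co x b \<odot>\<^bsub>S\<^esub> (a \<oplus>\<^bsub>S\<^esub> a') = co x b \<odot>\<^bsub>S\<^esub> a \<oplus>\<^bsub>S\<^esub> co x b \<odot>\<^bsub>S\<^esub> a'"
      if "a \<in> carrier S" "a' \<in> carrier S" "x \<in> carrier N" for a a' x
      using coc b that by (simp add: S.smult_r_distr)
    show "co (x \<oplus>\<^bsub>N\<^esub> y) b \<odot>\<^bsub>S\<^esub> a = co x b \<odot>\<^bsub>S\<^esub> a \<oplus>\<^bsub>S\<^esub> co y b \<odot>\<^bsub>S\<^esub> a"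
      if "a \<in> carrier S" "x \<in> carrier N" "y \<in> carrier N" for a x y
      using coc b that by (simp add: S.smult_l_distr co_add)
    show "co x b \<odot>\<^bsub>S\<^esub> (r \<odot>\<^bsub>S\<^esub> a) = co (r \<odot>\<^bsub>N\<^esub> x) b \<odot>\<^bsub>S\<^esub> a"
      if "r \<in> carrier R" "a \<in> carrier S" "x \<in> carrier N" for r a x
      using coc b that S.smult_assoc1[of r "co x b" a] S.smult_assoc1[of "co x b" r a]
      by (simp add: co_smult S.R.m_comm)
  qed
  define \<Phi> where "\<Phi> b = (SOME h. Q b h)" for b
  have Q: "Q b (\<Phi> b)" if "b \<in> Y" for b unfolding \<Phi>_def using ex_Q[OF that] by (rule someI_ex)
  have \<Phi>: "\<And>b t. b \<in> Y \<Longrightarrow> t \<in> carrier T \<Longrightarrow> \<Phi> b t \<in> carrier S"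
    "\<And>b t u. b \<in> Y \<Longrightarrow> t \<in> carrier T \<Longrightarrow> u \<in> carrier T \<Longrightarrow> \<Phi> b (t \<oplus>\<^bsub>T\<^esub> u) = \<Phi> b t \<oplus>\<^bsub>S\<^esub> \<Phi> b u"
    "\<And>b a x. b \<in> Y \<Longrightarrow> a \<in> carrier S \<Longrightarrow> x \<in> carrier N \<Longrightarrow> \<Phi> b (pure a x) = co x b \<odot>\<^bsub>S\<^esub> a"
    using Q unfolding Q_def by simp_all
  have \<Phi>0: "\<Phi> b \<zero>\<^bsub>T\<^esub> = \<zero>\<^bsub>S\<^esub>" if "b \<in> Y" for b
    using \<Phi>(2)[OF that, of "\<zero>\<^bsub>T\<^esub>" "\<zero>\<^bsub>T\<^esub>"] \<Phi>(1)[OF that, of "\<zero>\<^bsub>T\<^esub>"] by simp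
  have \<Phi>_smult: "\<Phi> b (s \<odot>\<^bsub>T\<^esub> t) = s \<otimes>\<^bsub>S\<^esub> \<Phi> b t" if b: "b \<in> Y" and s: "s \<in> carrier S" and t: "t \<in> carrier T" for b s t
    using t
  proof (induction rule: tensor_induct)
    case zero
    then show ?case using smult_zero_T[OF s] \<Phi>0[OF b] s by simp
  next
    case (add t a x)
    have c: "co x b \<in> carrier R" using coc b add by simp
    have "co x b \<odot>\<^bsub>S\<^esub> (s \<otimes>\<^bsub>S\<^esub> a) = s \<otimes>\<^bsub>S\<^esub> (co x b \<odot>\<^bsub>S\<^esub> a)"
      using mult_linear(3)[OF s c add.hyps(2)] by simp
    then show ?case
      using add b s c smult_closed_T[OF s] by (simp add: smult_add_T smult_pure \<Phi> S.r_distr)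
  qed
  have lin: "(\<forall>b \<in> Y. (\<forall>t \<in> carrier T. \<Phi> b t \<in> carrier S) \<and>
      (\<forall>t \<in> carrier T. \<forall>u \<in> carrier T. \<Phi> b (t \<oplus>\<^bsub>T\<^esub> u) = \<Phi> b t \<oplus>\<^bsub>S\<^esub> \<Phi> b u) \<and>
      (\<forall>a \<in> carrier S. \<forall>x \<in> carrier N. \<exists>r \<in> carrier R. \<Phi> b (pure a x) = r \<odot>\<^bsub>S\<^esub> a) \<and>
      (\<forall>s \<in> carrier S. \<forall>t \<in> carrier T. \<Phi> b (s \<odot>\<^bsub>T\<^esub> t) = s \<otimes>\<^bsub>S\<^esub> \<Phi> b t))"
  proof (intro ballI conjI)
    fix b assume b: "b \<in> Y"
    show "\<Phi> b t \<in> carrier S" if "t \<in> carrier T" for t using \<Phi>(1)[OF b that] .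
    show "\<Phi> b (t \<oplus>\<^bsub>T\<^esub> u) = \<Phi> b t \<oplus>\<^bsub>S\<^esub> \<Phi> b u" if "t \<in> carrier T" "u \<in> carrier T" for t u
      using \<Phi>(2)[OF b that] .
    show "\<exists>r \<in> carrier R. \<Phi> b (pure a x) = r \<odot>\<^bsub>S\<^esub> a" if "a \<in> carrier S" "x \<in> carrier N" for a x
      by (rule bexI[of _ "co x b"]) (rule \<Phi>(3)[OF b that], rule coc[OF that(2) b])
    show "\<Phi> b (s \<odot>\<^bsub>T\<^esub> t) = s \<otimes>\<^bsub>S\<^esub> \<Phi> b t" if "s \<in> carrier S" "t \<in> carrier T" for s t
      using \<Phi>_smult[OF b that] .
  qed
  have expand: "t = (\<Oplus>\<^bsub>T\<^esub>b\<in>Y. pure (\<Phi> b t) b)" if t: "t \<in> carrier T" for t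
    using t
  proof (induction rule: tensor_induct)
    case zero
    have "(\<Oplus>\<^bsub>T\<^esub>b\<in>Y. pure (\<Phi> b \<zero>\<^bsub>T\<^esub>) b) = (\<Oplus>\<^bsub>T\<^esub>b\<in>Y. \<zero>\<^bsub>T\<^esub>)"
      by (rule T.finsum_cong') (use \<Phi>0 pure_zero_left Yc in auto)
    then show ?case by simp
  next
    case (add t a x)
    have pc: "pure (\<Phi> b t) b \<in> carrier T" "pure (co x b \<odot>\<^bsub>S\<^esub> a) b \<in> carrier T" if "b \<in> Y" for b
      using that \<Phi>(1)[OF that add.hyps(1)] Yc coc[OF add.hyps(3) that] add.hyps(2) by auto
    have pa: "pure a (\<Oplus>\<^bsub>N\<^esub>b\<in>F. f b) = (\<Oplus>\<^bsub>T\<^esub>b\<in>F. pure a (f b))" if "f \<in> F \<rightarrow> carrier N" for f and F :: "'n set"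
      using that
    proof (induction F rule: infinite_finite_induct)
      case (insert b F)
      then have "f \<in> F \<rightarrow> carrier N" "f b \<in> carrier N" "(\<lambda>b. pure a (f b)) \<in> F \<rightarrow> carrier T"
        using add.hyps(2) by auto
      then show ?case using insert add.hyps(2) by (simp add: pure_add_right)
    qed (use add.hyps(2) pure_zero_right in auto)
    have "pure a x = pure a (\<Oplus>\<^bsub>N\<^esub>b\<in>Y. co x b \<odot>\<^bsub>N\<^esub> b)"
      using co(2)[OF add.hyps(3)] unfolding N.lincomb_def by simp
    also have "\<dots> = (\<Oplus>\<^bsub>T\<^esub>b\<in>Y. pure a (co x b \<odot>\<^bsub>N\<^esub> b))"
      by (rule pa) (use terms[OF add.hyps(3)] in auto)
    also have "\<dots> = (\<Oplus>\<^bsub>T\<^esub>b\<in>Y. pure (co x b \<odot>\<^bsub>S\<^esub> a) b)"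
      by (rule T.finsum_cong') (use pc pure_balanced coc[OF add.hyps(3)] add.hyps(2) Yc in auto)
    finally have "t \<oplus>\<^bsub>T\<^esub> pure a x = (\<Oplus>\<^bsub>T\<^esub>b\<in>Y. pure (\<Phi> b t) b) \<oplus>\<^bsub>T\<^esub> (\<Oplus>\<^bsub>T\<^esub>b\<in>Y. pure (co x b \<odot>\<^bsub>S\<^esub> a) b)"
      using add.IH by simp
    also have "\<dots> = (\<Oplus>\<^bsub>T\<^esub>b\<in>Y. pure (\<Phi> b t) b \<oplus>\<^bsub>T\<^esub> pure (co x b \<odot>\<^bsub>S\<^esub> a) b)"
      by (rule T.finsum_addf[symmetric]) (use pc in auto)
    also have "\<dots> = (\<Oplus>\<^bsub>T\<^esub>b\<in>Y. pure (\<Phi> b (t \<oplus>\<^bsub>T\<^esub> pure a x)) b)"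
    proof (rule T.finsum_cong')
      fix b assume b: "b \<in> Y"
      have "\<Phi> b (t \<oplus>\<^bsub>T\<^esub> pure a x) = \<Phi> b t \<oplus>\<^bsub>S\<^esub> co x b \<odot>\<^bsub>S\<^esub> a" using \<Phi>(2,3) b add.hyps by simp
      moreover have "b \<in> carrier N" "co x b \<odot>\<^bsub>S\<^esub> a \<in> carrier S" "\<Phi> b t \<in> carrier S"
        using b Yc coc[OF add.hyps(3) b] add.hyps \<Phi>(1) by auto
      ultimately show "pure (\<Phi> b t) b \<oplus>\<^bsub>T\<^esub> pure (co x b \<odot>\<^bsub>S\<^esub> a) b = pure (\<Phi> b (t \<oplus>\<^bsub>T\<^esub> pure a x)) b"
        by (simp add: pure_add_left)
    qed (use \<Phi>(1) add.hyps Yc in auto)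
    finally show ?case .
  qed
  have zero: "t = \<zero>\<^bsub>T\<^esub>" if t: "t \<in> carrier T" and 0: "\<forall>b \<in> Y. \<Phi> b t = \<zero>\<^bsub>S\<^esub>" for t
  proof -
    have "(\<Oplus>\<^bsub>T\<^esub>b\<in>Y. pure (\<Phi> b t) b) = (\<Oplus>\<^bsub>T\<^esub>b\<in>Y. \<zero>\<^bsub>T\<^esub>)"
      by (rule T.finsum_cong') (use 0 pure_zero_left Yc in auto)
    then show ?thesis using expand[OF t] by simp
  qed
  show ?thesis unfolding coordinate_system_def by (intro exI[of _ Y] exI[of _ \<Phi>] conjI lin) (use zero in simp)
qed

end

lemma additive_map_zero:
  assumes "abelian_group M" "abelian_group N"
    and "\<And>x. x \<in> carrier M \<Longrightarrow> h x \<in> carrier N"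
    and "\<And>x y. x \<in> carrier M \<Longrightarrow> y \<in> carrier M \<Longrightarrow> h (x \<oplus>\<^bsub>M\<^esub> y) = h x \<oplus>\<^bsub>N\<^esub> h y"
  shows "h \<zero>\<^bsub>M\<^esub> = \<zero>\<^bsub>N\<^esub>"
proof -
  interpret M: abelian_group M by fact
  interpret N: abelian_group N by fact
  show ?thesis using assms(4)[of "\<zero>\<^bsub>M\<^esub>" "\<zero>\<^bsub>M\<^esub>"] assms(3)[of "\<zero>\<^bsub>M\<^esub>"] by simp
qed

lemma additive_map_finsum:
  assumes "abelian_group M" "abelian_group N"
    and "\<And>x. x \<in> carrier M \<Longrightarrow> h x \<in> carrier N"
    and "\<And>x y. x \<in> carrier M \<Longrightarrow> y \<in> carrier M \<Longrightarrow> h (x \<oplus>\<^bsub>M\<^esub> y) = h x \<oplus>\<^bsub>N\<^esub> h y"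
    and "\<And>i. i \<in> F \<Longrightarrow> f i \<in> carrier M"
  shows "h (finsum M f F) = finsum N (\<lambda>i. h (f i)) F"
proof -
  interpret M: abelian_group M by fact
  interpret N: abelian_group N by fact
  note zero = additive_map_zero[of M N h, OF assms(1-4)]
  show ?thesis
    using assms(5)
  proof (induction F rule: infinite_finite_induct)
    case (insert i F)
    then have f: "f \<in> F \<rightarrow> carrier M" "f i \<in> carrier M" "(\<lambda>i. h (f i)) \<in> F \<rightarrow> carrier N" "h (f i) \<in> carrier N"
      using assms(3) by auto
    then show ?case using insert by (simp add: assms(4))
  qed (use zero in auto)
qed

text \<open>The element \<open>x\<close> also has the decomposition with the single component \<open>x\<close> in degree \<open>n\<close>; the two are
  compared after extending both to a common range of degrees.\<close>

lemma (in abelian_group) homogeneous_component: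
  assumes sub: "\<And>i. additive_subgroup (gr i) G" and ind: "graded_independent G gr"
    and x: "x \<in> gr n" and c: "\<And>i. c i \<in> gr i" "x = (\<Oplus>i\<in>{..<m}. c i)"
  shows "x = (if n < m then c n else \<zero>)"
proof -
  note grc = gr_carrier[where gr = gr, OF sub] and gr0 = gr_zero[where gr = gr, OF sub]
  let ?c = "\<lambda>i. if i \<in> {..<m} then c i else \<zero>" and ?d = "\<lambda>i. if n = i then x else \<zero>"
  let ?N = "max m (Suc n)"
  have cc: "?c i \<in> gr i" "?d i \<in> gr i" for i using c(1) x gr0 by auto
  have car: "?c i \<in> carrier G" "?d i \<in> carrier G" for i using grc[OF cc(1)] grc[OF cc(2)] by auto
  have xc: "x \<in> carrier G" by (rule grc[OF x])
  have "(\<Oplus>i\<in>{..<?N}. ?c i) = x"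
    unfolding c(2) by (rule finsum_extend[where gr = gr, OF sub c(1), symmetric]) auto
  moreover have "(\<Oplus>i\<in>{..<?N}. ?d i) = x" by (rule finsum_singleton) (use xc in auto)
  moreover have "(\<Oplus>i\<in>{..<?N}. ?c i \<ominus> ?d i) \<oplus> (\<Oplus>i\<in>{..<?N}. ?d i) = (\<Oplus>i\<in>{..<?N}. (?c i \<ominus> ?d i) \<oplus> ?d i)"
    by (rule finsum_addf[symmetric]) (use car in \<open>auto intro!: minus_closed\<close>)
  moreover have "(\<Oplus>i\<in>{..<?N}. (?c i \<ominus> ?d i) \<oplus> ?d i) = (\<Oplus>i\<in>{..<?N}. ?c i)"
  proof (rule finsum_cong')
    fix i
    show "(?c i \<ominus> ?d i) \<oplus> ?d i = ?c i" using car[of i] by (simp only: minus_eq a_assoc a_inv_closed l_neg r_zero)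
  qed (use car in auto)
  moreover have sc: "(\<Oplus>i\<in>{..<?N}. ?c i \<ominus> ?d i) \<in> carrier G"
    by (rule finsum_closed) (use car in \<open>auto intro!: minus_closed\<close>)
  ultimately have "(\<Oplus>i\<in>{..<?N}. ?c i \<ominus> ?d i) \<oplus> x = x" by simp
  then have sum0: "(\<Oplus>i\<in>{..<?N}. ?c i \<ominus> ?d i) = \<zero>" using xc sc by simp
  have "?c i \<ominus> ?d i \<in> gr i" for i by (rule gr_minus[where gr = gr, OF sub cc(1) cc(2)])
  then have "?c n \<ominus> ?d n = \<zero>" by (rule graded_independentD[OF ind _ sum0]) simp
  then have "?c n = ?d n" using car[of n] by simp
  then show ?thesis by (auto split: if_splits)
qed

context tensor
begin

context
  fixes Y \<Phi> assumes Y: "coordinate_system Y \<Phi>"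
begin

lemma coordinate_closed: "b \<in> Y \<Longrightarrow> t \<in> carrier T \<Longrightarrow> \<Phi> b t \<in> carrier S"
  using Y unfolding coordinate_system_def by simp

lemma coordinate_add:
  "b \<in> Y \<Longrightarrow> t \<in> carrier T \<Longrightarrow> u \<in> carrier T \<Longrightarrow> \<Phi> b (t \<oplus>\<^bsub>T\<^esub> u) = \<Phi> b t \<oplus>\<^bsub>S\<^esub> \<Phi> b u"
  using Y unfolding coordinate_system_def by simp

lemma coordinate_pure:
  "b \<in> Y \<Longrightarrow> a \<in> carrier S \<Longrightarrow> x \<in> carrier N \<Longrightarrow> \<exists>r \<in> carrier R. \<Phi> b (pure a x) = r \<odot>\<^bsub>S\<^esub> a"
  using Y unfolding coordinate_system_def by simp

lemma coordinate_smult: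
  "b \<in> Y \<Longrightarrow> s \<in> carrier S \<Longrightarrow> t \<in> carrier T \<Longrightarrow> \<Phi> b (s \<odot>\<^bsub>T\<^esub> t) = s \<otimes>\<^bsub>S\<^esub> \<Phi> b t"
  using Y unfolding coordinate_system_def by simp

lemma coordinates_zero:
  "t \<in> carrier T \<Longrightarrow> (\<And>b. b \<in> Y \<Longrightarrow> \<Phi> b t = \<zero>\<^bsub>S\<^esub>) \<Longrightarrow> t = \<zero>\<^bsub>T\<^esub>"
  using Y unfolding coordinate_system_def by simp

lemma coordinate_zero: "b \<in> Y \<Longrightarrow> \<Phi> b \<zero>\<^bsub>T\<^esub> = \<zero>\<^bsub>S\<^esub>"
  by (rule additive_map_zero[OF abelian_group_T S.is_abelian_group coordinate_closed coordinate_add])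

text \<open>The absence of zero divisors in \<open>S\<close> passes to each coordinate.\<close>

lemma tensor_torsion_free:
  assumes dom: "domain S" and s: "s \<in> carrier S" and t: "t \<in> carrier T" and st: "s \<odot>\<^bsub>T\<^esub> t = \<zero>\<^bsub>T\<^esub>"
  shows "s = \<zero>\<^bsub>S\<^esub> \<or> t = \<zero>\<^bsub>T\<^esub>"
proof (rule disjCI)
  assume tn: "t \<noteq> \<zero>\<^bsub>T\<^esub>"
  obtain b where b: "b \<in> Y" "\<Phi> b t \<noteq> \<zero>\<^bsub>S\<^esub>" using coordinates_zero[OF t] tn by blast
  have "s \<otimes>\<^bsub>S\<^esub> \<Phi> b t = \<zero>\<^bsub>S\<^esub>" using coordinate_smult[OF b(1) s t] coordinate_zero[OF b(1)] st by simp
  then show "s = \<zero>\<^bsub>S\<^esub>" using domain.integral[OF dom _ s coordinate_closed[OF b(1) t]] b(2) by simp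
qed

text \<open>With \<open>N\<close> in degree zero the coordinates respect degrees, so a sum of homogeneous elements that
  vanishes does so in each coordinate, and there the grading of \<open>S\<close> applies.\<close>

lemma tensor_is_grading:
  assumes gr: "is_grading S grS" "\<And>i r a. r \<in> carrier R \<Longrightarrow> a \<in> grS i \<Longrightarrow> r \<odot>\<^bsub>S\<^esub> a \<in> grS i"
  shows "is_grading T (tensor_grading R S grS N (trivial_grading N))"
proof -
  let ?T = "tensor_grading R S grS N (trivial_grading N)"
  have grS: "additive_subgroup (grS i) S" for i using gr(1) unfolding is_grading_def by simp
  have grSc: "grS i \<subseteq> carrier S" for i by (rule additive_subgroup.a_subset[OF grS])
  have grN: "trivial_grading N i \<subseteq> carrier N" for i unfolding trivial_grading_def by auto
  have sub: "additive_subgroup (?T n) T" for n by (rule tensor_grading_subgroup[OF grSc grN])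
  show ?thesis
  proof (rule T.is_gradingI[OF sub])
    fix t assume t: "t \<in> carrier T"
    show "t \<in> graded_sums T ?T"
    proof (rule tensor_graded_sums[OF grSc grN _ _ t])
      show "a \<in> graded_sums S grS" if "a \<in> carrier S" for a
        by (rule S.is_grading_imp_graded_sums[OF grS gr(1) that])
      show "x \<in> graded_sums N (trivial_grading N)" if "x \<in> carrier N" for x
      proof -
        have "additive_subgroup (trivial_grading N i) N" for i
          unfolding trivial_grading_def by (auto intro!: N.M.additive_subgroup_intro)
        moreover have "x \<in> trivial_grading N 0" using that unfolding trivial_grading_def by simp
        ultimately show ?thesis by (rule N.M.graded_sums_incl)
      qed
    qed
  next
    have deg: "\<Phi> b t \<in> grS n" if b: "b \<in> Y" and t: "t \<in> ?T n" for b t n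
      using t
    proof (induction rule: tensor_grading_induct[OF grSc grN, consumes 1])
      case 1
      then show ?case using coordinate_zero[OF b] additive_subgroup.zero_closed[OF grS] by simp
    next
      case (2 a x i j)
      have ac: "a \<in> carrier S" "x \<in> carrier N" using 2 grSc grN by blast+
      show ?case
      proof (cases "j = 0")
        case True
        then show ?thesis using coordinate_pure[OF b ac] gr(2)[OF _ 2(1)] 2(3) by auto
      next
        case False
        then have "x = \<zero>\<^bsub>N\<^esub>" using 2(2) unfolding trivial_grading_def by simp
        then show ?thesis
          using pure_zero_right[OF ac(1)] coordinate_zero[OF b] additive_subgroup.zero_closed[OF grS] by simp
      qed
    next
      case (3 t u)
      have "t \<in> carrier T" "u \<in> carrier T" using 3(1,2) additive_subgroup.a_subset[OF sub] by blast+
      then show ?case using 3 coordinate_add[OF b] additive_subgroup.a_closed[OF grS] by simp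
    next
      case (4 t)
      have tc: "t \<in> carrier T" using 4(1) additive_subgroup.a_subset[OF sub] by blast
      have "\<Phi> b (\<ominus>\<^bsub>T\<^esub> t) \<oplus>\<^bsub>S\<^esub> \<Phi> b t = \<zero>\<^bsub>S\<^esub>"
        using coordinate_add[OF b, of "\<ominus>\<^bsub>T\<^esub> t" t] tc coordinate_zero[OF b] by (simp add: T.l_neg)
      then have "\<ominus>\<^bsub>S\<^esub> \<Phi> b t = \<Phi> b (\<ominus>\<^bsub>T\<^esub> t)"
        by (rule S.minus_equality) (use coordinate_closed[OF b] tc in auto)
      then show ?case using additive_subgroup.a_inv_closed[OF grS 4(2)] by simp
    qed
    show "graded_independent T ?T"
      unfolding graded_independent_def
    proof (intro allI impI)
      fix c n i assume c: "\<forall>i. c i \<in> ?T i" and sum: "finsum T c {..<n} = \<zero>\<^bsub>T\<^esub>" and i: "i < n"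
      have cc: "c i \<in> carrier T" for i using spec[OF c, of i] additive_subgroup.a_subset[OF sub] by blast
      show "c i = \<zero>\<^bsub>T\<^esub>"
      proof (rule coordinates_zero[OF cc])
        fix b assume b: "b \<in> Y"
        have "finsum S (\<lambda>i. \<Phi> b (c i)) {..<n} = \<Phi> b (finsum T c {..<n})"
          by (rule additive_map_finsum[symmetric, OF abelian_group_T S.is_abelian_group
                coordinate_closed[OF b] coordinate_add[OF b] cc])
        also have "\<dots> = \<zero>\<^bsub>S\<^esub>" unfolding sum by (rule coordinate_zero[OF b])
        finally have sum0: "finsum S (\<lambda>i. \<Phi> b (c i)) {..<n} = \<zero>\<^bsub>S\<^esub>" .
        show "\<Phi> b (c i) = \<zero>\<^bsub>S\<^esub>"
          by (rule graded_independentD[OF S.is_grading_imp_independent[OF grS gr(1)] _ sum0 i])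
            (rule deg[OF b spec[OF c]])
      qed
    qed
  qed
qed

end

lemma tensor_grading_smult:
  assumes grS: "\<And>i. grS i \<subseteq> carrier S" and grN: "\<And>i. grN i \<subseteq> carrier N"
    and mult: "\<And>i j a b. a \<in> grS i \<Longrightarrow> b \<in> grS j \<Longrightarrow> a \<otimes>\<^bsub>S\<^esub> b \<in> grS (i + j)"
    and s: "s \<in> grS i" and t: "t \<in> tensor_grading R S grS N grN j"
  shows "s \<odot>\<^bsub>T\<^esub> t \<in> tensor_grading R S grS N grN (i + j)"
  using t
proof (induction rule: tensor_grading_induct[OF grS grN, consumes 1])
  have sc: "s \<in> carrier S" using s grS by blast
  have sub: "additive_subgroup (tensor_grading R S grS N grN n) T" for n
    by (rule tensor_grading_subgroup[OF grS grN])
  interpret TM: module S T by (rule module_T)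
  { case 1
    then show ?case using smult_zero_T[OF sc] additive_subgroup.zero_closed[OF sub] by simp }
  { case (2 a x i' j')
    have "s \<otimes>\<^bsub>S\<^esub> a \<in> grS (i + i')" by (rule mult[OF s 2(1)])
    then have "pure (s \<otimes>\<^bsub>S\<^esub> a) x \<in> tensor_grading R S grS N grN ((i + i') + j')"
      by (rule pure_in_tensor_grading[where grS = grS and grN = grN, OF grS grN _ 2(2)])
    moreover have "a \<in> carrier S" "x \<in> carrier N" using 2(1,2) grS grN by blast+
    ultimately show ?case using smult_pure[OF sc] 2(3) by (simp add: add.assoc) }
  { case (3 t u)
    have "t \<in> carrier T" "u \<in> carrier T" using 3(1,2) additive_subgroup.a_subset[OF sub] by blast+
    then show ?case using 3(3,4) smult_add_T[OF sc] additive_subgroup.a_closed[OF sub] by simp }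
  { case (4 t)
    have "t \<in> carrier T" using 4(1) additive_subgroup.a_subset[OF sub] by blast
    then show ?case using additive_subgroup.a_inv_closed[OF sub 4(2)] TM.smult_r_minus[OF sc] by simp }
qed

end

section \<open>Modules of covariants\<close>

locale covariant_setting =
  fixes k :: "('k, 'l) ring_scheme"
    and A :: "('k, 'a, 'n) module_scheme" and gr :: "nat \<Rightarrow> 'a set"
    and G :: "('a \<Rightarrow> 'a) set"
    and M :: "('k, 'm, 'p) module_scheme" and \<rho> :: "('a \<Rightarrow> 'a) \<Rightarrow> 'm \<Rightarrow> 'm"
  assumes A: "normal_graded_algebra k A gr"
    and G: "subgroup G (BijGroup (carrier A))" "finite G" "G \<subseteq> graded_algebra_auts k A gr"
    and M: "linear_representation k (BijGroup (carrier A)\<lparr>carrier := G\<rparr>) M \<rho>"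
           "vectorspace.fin_dim k M"
begin

abbreviation \<Gamma> where "\<Gamma> \<equiv> BijGroup (carrier A)\<lparr>carrier := G\<rparr>"

abbreviation V where "V \<equiv> tensor_product k A M"

abbreviation \<beta> where "\<beta> \<sigma> \<equiv> tensor_map k A M \<sigma> (\<rho> \<sigma>)"

lemma field_k: "field k" and algebra_A: "algebra k A" and domain_A: "domain A"
  and graded_A: "graded_ring A gr" and gr_0: "gr 0 = (\<lambda>c. c \<odot>\<^bsub>A\<^esub> \<one>\<^bsub>A\<^esub>) ` carrier k"
  and normal_A: "integrally_closed_in_quotient_field A"
  using A unfolding normal_graded_algebra_def by auto

lemma vectorspace_M: "vectorspace k M" using M(1) unfolding linear_representation_def by simp

lemma module_M: "module k M" using vectorspace_M unfolding vectorspace_def by simp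

sublocale A: domain A by (rule domain_A)

sublocale TM: tensor k A M by (rule tensor.intro[OF algebra_A module_M])

lemma is_grading_A: "is_grading A gr" using graded_A unfolding graded_ring_def by simp

lemma gr_mult: "a \<in> gr i \<Longrightarrow> b \<in> gr j \<Longrightarrow> a \<otimes>\<^bsub>A\<^esub> b \<in> gr (i + j)"
  using graded_A unfolding graded_ring_def by blast

lemma gr_subgroup: "additive_subgroup (gr i) A" using is_grading_A unfolding is_grading_def by simp

lemma gr_closed: "gr i \<subseteq> carrier A" by (rule additive_subgroup.a_subset[OF gr_subgroup])

lemma gr_smult: "r \<in> carrier k \<Longrightarrow> a \<in> gr i \<Longrightarrow> r \<odot>\<^bsub>A\<^esub> a \<in> gr i"
proof -
  assume r: "r \<in> carrier k" and a: "a \<in> gr i"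
  have ac: "a \<in> carrier A" using a gr_closed by blast
  have "(r \<odot>\<^bsub>A\<^esub> \<one>\<^bsub>A\<^esub>) \<otimes>\<^bsub>A\<^esub> a \<in> gr (0 + i)" by (rule gr_mult[OF _ a]) (use gr_0 r in simp)
  then show ?thesis using TM.S.smult_assoc2[OF r A.one_closed ac] ac by simp
qed

text \<open>\<open>A\<close> is generated by finitely many elements over \<open>gr 0\<close>, which is a copy of the field \<open>k\<close>.\<close>

lemma noetherian_A: "noetherian_on A (carrier A)"
proof -
  obtain S where S: "S \<subseteq> carrier A" "finite S" "generate_ring A (gr 0 \<union> S) = carrier A"
    using A unfolding normal_graded_algebra_def by blast
  interpret k: field k by (rule field_k)
  let ?i = "\<lambda>c. c \<odot>\<^bsub>A\<^esub> \<one>\<^bsub>A\<^esub>"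
  have i: "?i c \<in> carrier A" if "c \<in> carrier k" for c using that by simp
  have i_mult: "?i c \<otimes>\<^bsub>A\<^esub> ?i d = ?i (c \<otimes>\<^bsub>k\<^esub> d)" if "c \<in> carrier k" "d \<in> carrier k" for c d
    using TM.S.smult_assoc2[OF that(1) A.one_closed i[OF that(2)]] TM.S.smult_assoc1[OF that A.one_closed] i[OF that(2)]
    by simp
  have sub: "subring (gr 0) A"
  proof (rule A.subringI)
    show "gr 0 \<subseteq> carrier A" by (rule gr_closed)
    show "\<one>\<^bsub>A\<^esub> \<in> gr 0" unfolding gr_0 by (rule image_eqI[of _ _ "\<one>\<^bsub>k\<^esub>"]) simp_all
    show "\<ominus>\<^bsub>A\<^esub> h \<in> gr 0" if "h \<in> gr 0" for h by (rule additive_subgroup.a_inv_closed[OF gr_subgroup that])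
    show "h \<otimes>\<^bsub>A\<^esub> h' \<in> gr 0" if "h \<in> gr 0" "h' \<in> gr 0" for h h' using gr_mult[OF that] by simp
    show "h \<oplus>\<^bsub>A\<^esub> h' \<in> gr 0" if "h \<in> gr 0" "h' \<in> gr 0" for h h'
      by (rule additive_subgroup.a_closed[OF gr_subgroup that])
  qed
  have "\<exists>d \<in> gr 0. d \<otimes>\<^bsub>A\<^esub> c \<in> {\<one>\<^bsub>A\<^esub>}" if c: "c \<in> gr 0" "c \<noteq> \<zero>\<^bsub>A\<^esub>" for c
  proof -
    obtain x where x: "x \<in> carrier k" "c = ?i x" using c gr_0 by auto
    have "x \<noteq> \<zero>\<^bsub>k\<^esub>" using x c(2) by auto
    then have "x \<in> Units k" using x k.field_Units by simp
    then have inv: "inv\<^bsub>k\<^esub> x \<in> carrier k" "inv\<^bsub>k\<^esub> x \<otimes>\<^bsub>k\<^esub> x = \<one>\<^bsub>k\<^esub>" by auto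
    have "?i (inv\<^bsub>k\<^esub> x) \<otimes>\<^bsub>A\<^esub> c = \<one>\<^bsub>A\<^esub>" unfolding x(2) using i_mult[OF inv(1) x(1)] inv(2) by simp
    then show ?thesis using inv(1) gr_0 by blast
  qed
  then have "noetherian_on A (gr 0)" by (intro A.noetherian_on_field[OF sub]) auto
  then obtain D where D: "subring D A" "noetherian_on A D" "gr 0 \<union> S \<subseteq> D"
    using A.noetherian_on_generate_ring[OF sub _ S(2,1)] by blast
  have "gr 0 \<union> S \<subseteq> carrier A" using S gr_closed by blast
  then have "carrier A \<subseteq> D" using A.generate_ring_min_subring1[OF _ D(1,3)] S(3) by simp
  then have "D = carrier A" using subringE(1)[OF D(1)] by simp
  then show ?thesis using D(2) by simp
qed

lemma G_Bij: "\<sigma> \<in> G \<Longrightarrow> \<sigma> \<in> Bij (carrier A)"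
  and G_hom: "\<sigma> \<in> G \<Longrightarrow> \<sigma> \<in> ring_hom A A"
  and G_linear: "\<sigma> \<in> G \<Longrightarrow> \<sigma> \<in> module_hom k A A"
  and G_degree: "\<sigma> \<in> G \<Longrightarrow> a \<in> gr i \<Longrightarrow> \<sigma> a \<in> gr i"
  using G(3) unfolding graded_algebra_auts_def by blast+

lemma G_closed: "\<sigma> \<in> G \<Longrightarrow> a \<in> carrier A \<Longrightarrow> \<sigma> a \<in> carrier A"
  by (rule ring_hom_closed[OF G_hom])

lemma group_\<Gamma>: "group \<Gamma>"
  by (rule subgroup.subgroup_is_group[OF G(1) group_BijGroup])

lemma \<Gamma>_mult: "\<sigma> \<in> G \<Longrightarrow> \<tau> \<in> G \<Longrightarrow> a \<in> carrier A \<Longrightarrow> (\<sigma> \<otimes>\<^bsub>\<Gamma>\<^esub> \<tau>) a = \<sigma> (\<tau> a)"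
  using G_Bij[of \<sigma>] G_Bij[of \<tau>] by (simp add: BijGroup_def compose_def)

lemma \<Gamma>_one: "\<one>\<^bsub>\<Gamma>\<^esub> = (\<lambda>x\<in>carrier A. x)"
  by (simp add: BijGroup_def)

lemma action_\<rho>: "group_action \<Gamma> (carrier M) \<rho>"
  using M(1) unfolding linear_representation_def by simp

lemma \<rho>_hom: "\<sigma> \<in> G \<Longrightarrow> \<rho> \<sigma> \<in> module_hom k M M"
  using M(1) unfolding linear_representation_def by simp

lemma \<rho>_closed: "\<sigma> \<in> G \<Longrightarrow> x \<in> carrier M \<Longrightarrow> \<rho> \<sigma> x \<in> carrier M"
  using module_hom_closed[OF \<rho>_hom] by blast

lemma \<rho>_mult: "\<sigma> \<in> G \<Longrightarrow> \<tau> \<in> G \<Longrightarrow> x \<in> carrier M \<Longrightarrow> \<rho> (\<sigma> \<otimes>\<^bsub>\<Gamma>\<^esub> \<tau>) x = \<rho> \<sigma> (\<rho> \<tau> x)"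
  using group_action.composition_rule[OF action_\<rho>, of x \<sigma> \<tau>] by simp

lemma \<rho>_one: "x \<in> carrier M \<Longrightarrow> \<rho> \<one>\<^bsub>\<Gamma>\<^esub> x = x"
  using group_action.id_eq_one[OF action_\<rho>] by (metis restrict_apply')

lemmas linear_maps =
  G_closed ring_hom_add[OF G_hom] module_hom_smult[OF G_linear]
  \<rho>_closed module_hom_add[OF \<rho>_hom] module_hom_smult[OF \<rho>_hom]

lemma \<beta>_closed: "\<sigma> \<in> G \<Longrightarrow> t \<in> carrier V \<Longrightarrow> \<beta> \<sigma> t \<in> carrier V"
  by (rule TM.tensor_map_closed) (simp_all add: linear_maps)

lemma \<beta>_add: "\<sigma> \<in> G \<Longrightarrow> t \<in> carrier V \<Longrightarrow> u \<in> carrier V \<Longrightarrow> \<beta> \<sigma> (t \<oplus>\<^bsub>V\<^esub> u) = \<beta> \<sigma> t \<oplus>\<^bsub>V\<^esub> \<beta> \<sigma> u"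
  by (rule TM.tensor_map_add) (simp_all add: linear_maps)

lemma \<beta>_zero: "\<sigma> \<in> G \<Longrightarrow> \<beta> \<sigma> \<zero>\<^bsub>V\<^esub> = \<zero>\<^bsub>V\<^esub>"
  by (rule TM.tensor_map_zero) (simp_all add: linear_maps)

lemma \<beta>_pure:
  "\<sigma> \<in> G \<Longrightarrow> a \<in> carrier A \<Longrightarrow> x \<in> carrier M \<Longrightarrow> \<beta> \<sigma> (TM.pure a x) = TM.pure (\<sigma> a) (\<rho> \<sigma> x)"
  by (rule TM.tensor_map_pure) (simp_all add: linear_maps)

sublocale V: module A V by (rule TM.module_T)

text \<open>The identities are checked on pure tensors and extended by additivity; torsion-freeness is seen in
  coordinates.\<close>

lemma semilinear: "semilinear_action A V \<Gamma> (\<lambda>\<sigma>. \<sigma>) \<beta>"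
proof -
  interpret \<Gamma>: group \<Gamma> by (rule group_\<Gamma>)
  obtain Y \<Phi> where Y: "TM.coordinate_system Y \<Phi>"
    using TM.exists_coordinates[OF vectorspace_M M(2)] by blast
  show ?thesis
  proof (unfold_locales, goal_cases)
    case 1 then show ?case using G(2) by simp
  next
    case (2 \<sigma>) then show ?case using G_hom by simp
  next
    case (3 \<sigma> \<tau> a) then show ?case using \<Gamma>_mult by simp
  next
    case (4 a) then show ?case by (simp add: BijGroup_def)
  next
    case (5 \<sigma>)
    then have \<sigma>: "\<sigma> \<in> Bij (carrier A)" "\<And>a. a \<in> carrier A \<Longrightarrow> \<sigma> a = a" using G_Bij by simp_all
    have "\<sigma> = (\<lambda>x\<in>carrier A. x)"
      by (rule extensionalityI[OF Bij_imp_extensional[OF \<sigma>(1)]]) (use \<sigma>(2) in auto)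
    then show ?case unfolding \<Gamma>_one .
  next
    case (6 \<sigma> v) then show ?case using \<beta>_closed by simp
  next
    case (7 \<sigma> v w) then show ?case using \<beta>_add by simp
  next
    case (8 \<sigma> a v)
    then have \<sigma>: "\<sigma> \<in> G" by simp
    have a: "a \<in> carrier A" by fact
    show ?case
      using 8(3)
    proof (induction rule: TM.tensor_induct)
      case zero
      then show ?case using V.smult_r_null[OF a] V.smult_r_null[OF G_closed[OF \<sigma> a]] \<beta>_zero[OF \<sigma>] by simp
    next
      case (add t b x)
      have c: "\<sigma> b \<in> carrier A" "\<sigma> a \<in> carrier A" "\<rho> \<sigma> x \<in> carrier M" "a \<otimes>\<^bsub>A\<^esub> b \<in> carrier A"
        using G_closed[OF \<sigma>] \<rho>_closed[OF \<sigma>] a add.hyps by auto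
      have "\<beta> \<sigma> (a \<odot>\<^bsub>V\<^esub> (t \<oplus>\<^bsub>V\<^esub> TM.pure b x)) = \<beta> \<sigma> (a \<odot>\<^bsub>V\<^esub> t) \<oplus>\<^bsub>V\<^esub> TM.pure (\<sigma> (a \<otimes>\<^bsub>A\<^esub> b)) (\<rho> \<sigma> x)"
        using add.hyps a \<sigma> c by (simp add: V.smult_r_distr TM.smult_pure \<beta>_add \<beta>_pure)
      also have "\<sigma> (a \<otimes>\<^bsub>A\<^esub> b) = \<sigma> a \<otimes>\<^bsub>A\<^esub> \<sigma> b" by (rule ring_hom_mult[OF G_hom[OF \<sigma>] a add.hyps(2)])
      also have "\<beta> \<sigma> (a \<odot>\<^bsub>V\<^esub> t) \<oplus>\<^bsub>V\<^esub> TM.pure (\<sigma> a \<otimes>\<^bsub>A\<^esub> \<sigma> b) (\<rho> \<sigma> x)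
          = \<sigma> a \<odot>\<^bsub>V\<^esub> \<beta> \<sigma> (t \<oplus>\<^bsub>V\<^esub> TM.pure b x)"
        using add c \<sigma> by (simp add: V.smult_r_distr TM.smult_pure \<beta>_add \<beta>_pure \<beta>_closed)
      finally show ?case .
    qed
  next
    case (9 \<sigma> \<tau> v)
    then have s: "\<sigma> \<in> G" "\<tau> \<in> G" "\<sigma> \<otimes>\<^bsub>\<Gamma>\<^esub> \<tau> \<in> G" using \<Gamma>.m_closed[of \<sigma> \<tau>] by simp_all
    show ?case
      using 9(3)
    proof (induction rule: TM.tensor_induct)
      case zero
      then show ?case using s by (simp add: \<beta>_zero)
    next
      case (add t b x)
      have p: "\<beta> (\<sigma> \<otimes>\<^bsub>\<Gamma>\<^esub> \<tau>) (TM.pure b x) = \<beta> \<sigma> (\<beta> \<tau> (TM.pure b x))"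
        using \<beta>_pure[OF s(3) add.hyps(2,3)] \<beta>_pure[OF s(2) add.hyps(2,3)]
          \<beta>_pure[OF s(1) G_closed[OF s(2) add.hyps(2)] \<rho>_closed[OF s(2) add.hyps(3)]]
          \<Gamma>_mult[OF s(1,2) add.hyps(2)] \<rho>_mult[OF s(1,2) add.hyps(3)] by simp
      have pc: "TM.pure b x \<in> carrier V" using add.hyps by simp
      show ?case
        unfolding \<beta>_add[OF s(3) add.hyps(1) pc] \<beta>_add[OF s(2) add.hyps(1) pc]
          \<beta>_add[OF s(1) \<beta>_closed[OF s(2) add.hyps(1)] \<beta>_closed[OF s(2) pc]] p add.IH ..
    qed
  next
    case (10 v)
    have s: "\<one>\<^bsub>\<Gamma>\<^esub> \<in> G" using \<Gamma>.one_closed by simp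
    show ?case
      using 10
    proof (induction rule: TM.tensor_induct)
      case zero
      then show ?case by (rule \<beta>_zero[OF s])
    next
      case (add t b x)
      have "\<one>\<^bsub>\<Gamma>\<^esub> b = b" unfolding \<Gamma>_one using add.hyps by simp
      then show ?case using \<beta>_add[OF s, of t "TM.pure b x"] \<beta>_pure[OF s, of b x] \<rho>_one[of x] add by simp
    qed
  next
    case (11 a v)
    then show ?case using TM.tensor_torsion_free[OF Y domain_A] by simp
  qed
qed

sublocale act: semilinear_action A V \<Gamma> "\<lambda>\<sigma>. \<sigma>" \<beta> by (rule semilinear)

text \<open>The ring \<open>A\<^sup>H\<close> and the module \<open>A\<^sup>H(M)\<close>, for a subset \<open>H\<close> of \<open>G\<close>.\<close>

abbreviation AH where "AH H \<equiv> invariant_ring A H"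

abbreviation W where "W H \<equiv> covariants k A M \<rho> H"

lemma carrier_AH: "carrier (AH H) = act.fixed_ring H"
  unfolding invariant_ring_def act.fixed_ring_def by simp

lemma AH_simps:
  "\<zero>\<^bsub>AH H\<^esub> = \<zero>\<^bsub>A\<^esub>" "\<one>\<^bsub>AH H\<^esub> = \<one>\<^bsub>A\<^esub>" "a \<oplus>\<^bsub>AH H\<^esub> b = a \<oplus>\<^bsub>A\<^esub> b" "a \<otimes>\<^bsub>AH H\<^esub> b = a \<otimes>\<^bsub>A\<^esub> b"
  "a \<odot>\<^bsub>AH H\<^esub> b = a \<otimes>\<^bsub>A\<^esub> b"
  unfolding invariant_ring_def by simp_all

lemma carrier_W: "carrier (W H) = act.fixed_vectors H"
  unfolding covariants_def act.fixed_vectors_def by simp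

lemma W_simps:
  "\<zero>\<^bsub>W H\<^esub> = \<zero>\<^bsub>V\<^esub>" "v \<oplus>\<^bsub>W H\<^esub> w = v \<oplus>\<^bsub>V\<^esub> w" "a \<odot>\<^bsub>W H\<^esub> v = a \<odot>\<^bsub>V\<^esub> v"
  unfolding covariants_def by simp_all

lemma fixed_ringD: "a \<in> act.fixed_ring H \<Longrightarrow> a \<in> carrier A"
  unfolding act.fixed_ring_def by simp

lemma fixed_vectorsD: "v \<in> act.fixed_vectors H \<Longrightarrow> v \<in> carrier V"
  unfolding act.fixed_vectors_def by simp

context
  fixes H assumes H: "H \<subseteq> G"
begin

lemma fixed_ring_closed:
  "\<zero>\<^bsub>A\<^esub> \<in> act.fixed_ring H" "\<one>\<^bsub>A\<^esub> \<in> act.fixed_ring H"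
  "a \<in> act.fixed_ring H \<Longrightarrow> b \<in> act.fixed_ring H \<Longrightarrow> a \<oplus>\<^bsub>A\<^esub> b \<in> act.fixed_ring H"
  "a \<in> act.fixed_ring H \<Longrightarrow> b \<in> act.fixed_ring H \<Longrightarrow> a \<otimes>\<^bsub>A\<^esub> b \<in> act.fixed_ring H"
  "a \<in> act.fixed_ring H \<Longrightarrow> \<ominus>\<^bsub>A\<^esub> a \<in> act.fixed_ring H"
proof -
  have hom: "ring_hom_cring A A \<sigma>" if "\<sigma> \<in> H" for \<sigma> using act.act_ring_hom[of \<sigma>] that H by auto
  show "\<zero>\<^bsub>A\<^esub> \<in> act.fixed_ring H"
    unfolding act.fixed_ring_def mem_Collect_eq
    by (intro conjI ballI A.zero_closed) (rule ring_hom_cring.hom_zero[OF hom])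
  show "\<one>\<^bsub>A\<^esub> \<in> act.fixed_ring H"
    unfolding act.fixed_ring_def mem_Collect_eq
    by (intro conjI ballI A.one_closed) (rule ring_hom_one[OF G_hom], rule subsetD[OF H])
  have mem: "c \<in> act.fixed_ring H \<longleftrightarrow> c \<in> carrier A \<and> (\<forall>\<sigma> \<in> H. \<sigma> c = c)" for c
    unfolding act.fixed_ring_def by simp
  have memD: "c \<in> carrier A" "\<sigma> \<in> H \<Longrightarrow> \<sigma> c = c" if "c \<in> act.fixed_ring H" for c \<sigma>
    using that unfolding mem by blast+
  show "\<ominus>\<^bsub>A\<^esub> a \<in> act.fixed_ring H" if a: "a \<in> act.fixed_ring H"
    unfolding mem
  proof (intro conjI ballI)
    fix \<sigma> assume \<sigma>: "\<sigma> \<in> H"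
    show "\<sigma> (\<ominus>\<^bsub>A\<^esub> a) = \<ominus>\<^bsub>A\<^esub> a" using ring_hom_cring.hom_a_inv[OF hom[OF \<sigma>], of a] memD(1)[OF a] memD(2)[OF a \<sigma>] by simp
  qed (use a in \<open>simp add: mem\<close>)
  assume a: "a \<in> act.fixed_ring H" and b: "b \<in> act.fixed_ring H"
  show "a \<oplus>\<^bsub>A\<^esub> b \<in> act.fixed_ring H"
    unfolding mem
  proof (intro conjI ballI)
    fix \<sigma> assume \<sigma>: "\<sigma> \<in> H"
    show "\<sigma> (a \<oplus>\<^bsub>A\<^esub> b) = a \<oplus>\<^bsub>A\<^esub> b"
      using ring_hom_add[OF G_hom[OF subsetD[OF H \<sigma>]] memD(1)[OF a] memD(1)[OF b]] memD(1)[OF a] memD(1)[OF b] memD(2)[OF a \<sigma>] memD(2)[OF b \<sigma>] by simp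
  qed (use a b in \<open>simp add: mem\<close>)
  show "a \<otimes>\<^bsub>A\<^esub> b \<in> act.fixed_ring H"
    unfolding mem
  proof (intro conjI ballI)
    fix \<sigma> assume \<sigma>: "\<sigma> \<in> H"
    show "\<sigma> (a \<otimes>\<^bsub>A\<^esub> b) = a \<otimes>\<^bsub>A\<^esub> b"
      using ring_hom_mult[OF G_hom[OF subsetD[OF H \<sigma>]] memD(1)[OF a] memD(1)[OF b]] memD(1)[OF a] memD(1)[OF b] memD(2)[OF a \<sigma>] memD(2)[OF b \<sigma>] by simp
  qed (use a b in \<open>simp add: mem\<close>)
qed

lemma fixed_vectors_closed:
  "\<zero>\<^bsub>V\<^esub> \<in> act.fixed_vectors H"
  "v \<in> act.fixed_vectors H \<Longrightarrow> w \<in> act.fixed_vectors H \<Longrightarrow> v \<oplus>\<^bsub>V\<^esub> w \<in> act.fixed_vectors H"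
  "a \<in> act.fixed_ring H \<Longrightarrow> v \<in> act.fixed_vectors H \<Longrightarrow> a \<odot>\<^bsub>V\<^esub> v \<in> act.fixed_vectors H"
proof -
  have HG: "\<sigma> \<in> G" if "\<sigma> \<in> H" for \<sigma> using that H by blast
  show "\<zero>\<^bsub>V\<^esub> \<in> act.fixed_vectors H" unfolding act.fixed_vectors_def using \<beta>_zero[OF HG] by simp
  show "v \<oplus>\<^bsub>V\<^esub> w \<in> act.fixed_vectors H" if "v \<in> act.fixed_vectors H" "w \<in> act.fixed_vectors H"
    using that \<beta>_add[OF HG, of _ v w] unfolding act.fixed_vectors_def by simp
  show "a \<odot>\<^bsub>V\<^esub> v \<in> act.fixed_vectors H" if "a \<in> act.fixed_ring H" "v \<in> act.fixed_vectors H"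
    by (rule act.fixed_vectors_smult[OF _ that]) (use H in simp)
qed

lemma cring_AH: "cring (AH H)"
proof (rule cringI)
  note c = fixed_ringD fixed_ring_closed
  show "abelian_group (AH H)"
  proof (rule abelian_groupI, unfold carrier_AH AH_simps)
    fix x assume x: "x \<in> act.fixed_ring H"
    show "\<exists>y\<in>act.fixed_ring H. y \<oplus>\<^bsub>A\<^esub> x = \<zero>\<^bsub>A\<^esub>"
      by (rule bexI[of _ "\<ominus>\<^bsub>A\<^esub> x"]) (use c x in \<open>auto simp: A.l_neg\<close>)
  qed (use c in \<open>auto simp: A.a_ac\<close>)
  show "comm_monoid (AH H)"
    by (rule comm_monoidI, unfold carrier_AH AH_simps) (use c in \<open>auto simp: A.m_ac\<close>)
  show "(x \<oplus>\<^bsub>AH H\<^esub> y) \<otimes>\<^bsub>AH H\<^esub> z = x \<otimes>\<^bsub>AH H\<^esub> z \<oplus>\<^bsub>AH H\<^esub> y \<otimes>\<^bsub>AH H\<^esub> z"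
    if "x \<in> carrier (AH H)" "y \<in> carrier (AH H)" "z \<in> carrier (AH H)" for x y z
    using that unfolding carrier_AH AH_simps by (intro A.l_distr fixed_ringD)
qed

lemma abelian_group_W: "abelian_group (W H)"
proof (rule abelian_groupI, unfold carrier_W W_simps)
  note c = fixed_vectorsD fixed_vectors_closed
  fix v assume v: "v \<in> act.fixed_vectors H"
  have vc: "v \<in> carrier V" by (rule fixed_vectorsD[OF v])
  have "(\<ominus>\<^bsub>A\<^esub> \<one>\<^bsub>A\<^esub>) \<odot>\<^bsub>V\<^esub> v \<oplus>\<^bsub>V\<^esub> v = \<zero>\<^bsub>V\<^esub>"
    using vc V.smult_l_minus[OF A.one_closed vc] by (simp add: TM.T.l_neg)
  moreover have "(\<ominus>\<^bsub>A\<^esub> \<one>\<^bsub>A\<^esub>) \<odot>\<^bsub>V\<^esub> v \<in> act.fixed_vectors H"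
    by (rule fixed_vectors_closed(3)[OF fixed_ring_closed(5)[OF fixed_ring_closed(2)] v])
  ultimately show "\<exists>w\<in>act.fixed_vectors H. w \<oplus>\<^bsub>V\<^esub> v = \<zero>\<^bsub>V\<^esub>" by (rule bexI)
  show "\<zero>\<^bsub>V\<^esub> \<oplus>\<^bsub>V\<^esub> v = v" using vc by simp
  fix w assume w: "w \<in> act.fixed_vectors H"
  show "v \<oplus>\<^bsub>V\<^esub> w \<in> act.fixed_vectors H" by (rule fixed_vectors_closed(2)[OF v w])
  show "v \<oplus>\<^bsub>V\<^esub> w = w \<oplus>\<^bsub>V\<^esub> v" by (rule TM.T.a_comm[OF vc fixed_vectorsD[OF w]])
  fix u assume u: "u \<in> act.fixed_vectors H"
  show "v \<oplus>\<^bsub>V\<^esub> w \<oplus>\<^bsub>V\<^esub> u = v \<oplus>\<^bsub>V\<^esub> (w \<oplus>\<^bsub>V\<^esub> u)"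
    by (rule TM.T.a_assoc[OF vc fixed_vectorsD[OF w] fixed_vectorsD[OF u]])
qed (rule fixed_vectors_closed(1))

lemma module_W: "module (AH H) (W H)"
  by (rule moduleI[OF cring_AH abelian_group_W], unfold carrier_AH carrier_W AH_simps W_simps)
    (simp_all add: fixed_vectors_closed fixed_ringD fixed_vectorsD V.smult_l_distr V.smult_r_distr V.smult_assoc1)

lemma finsum_W: "(\<And>i. i \<in> F \<Longrightarrow> f i \<in> act.fixed_vectors H) \<Longrightarrow> finsum (W H) f F = finsum V f F"
  by (rule finsum_substructure)
    (use abelian_group_W TM.T.abelian_group_axioms in \<open>auto simp: carrier_W W_simps fun_eq_iff fixed_vectorsD
      dest: abelian_group.axioms(1)\<close>)

lemma lincomb_W:
  assumes "F \<subseteq> act.fixed_vectors H" "c \<in> F \<rightarrow> act.fixed_ring H"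
  shows "module.lincomb (W H) c F = (\<Oplus>\<^bsub>V\<^esub>v\<in>F. c v \<odot>\<^bsub>V\<^esub> v)"
  unfolding module.lincomb_def[OF module_W] W_simps
  by (rule finsum_W) (use assms fixed_vectors_closed(3) in blast)

text \<open>The sums in \<open>A\<^sup>H(M)\<close> are sums in \<open>V\<close>, so that bases over different rings of invariants can be compared
  inside \<open>V\<close>.\<close>

lemma module_basis_W:
  "module_basis (AH H) (W H) B \<longleftrightarrow> B \<subseteq> act.fixed_vectors H \<and>
     act.independent_over (act.fixed_ring H) B \<and>
     act.spans_over (act.fixed_ring H) B (act.fixed_vectors H)"
proof (cases "B \<subseteq> act.fixed_vectors H")
  case True
  interpret W: module "AH H" "W H" by (rule module_W)
  have comb: "W.lincomb c F = (\<Oplus>\<^bsub>V\<^esub>v\<in>F. c v \<odot>\<^bsub>V\<^esub> v)" if "F \<subseteq> B" "c \<in> F \<rightarrow> act.fixed_ring H" for c F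
    by (rule lincomb_W) (use that True in auto)
  have "\<not> W.lin_dep B \<longleftrightarrow> act.independent_over (act.fixed_ring H) B"
    unfolding W.lin_dep_def act.independent_over_def carrier_AH AH_simps W_simps
    using comb by (smt (verit, best))
  moreover have "W.span B = act.fixed_vectors H \<longleftrightarrow> act.spans_over (act.fixed_ring H) B (act.fixed_vectors H)"
  proof
    assume span: "W.span B = act.fixed_vectors H"
    show "act.spans_over (act.fixed_ring H) B (act.fixed_vectors H)"
      unfolding act.spans_over_def
    proof
      fix w assume "w \<in> act.fixed_vectors H"
      then obtain F c where F: "finite F" "F \<subseteq> B" "c \<in> F \<rightarrow> act.fixed_ring H" "w = W.lincomb c F"
        unfolding span[symmetric] W.span_def carrier_AH by blast
      show "\<exists>F c. finite F \<and> F \<subseteq> B \<and> c \<in> F \<rightarrow> act.fixed_ring H \<and> w = (\<Oplus>\<^bsub>V\<^esub>v\<in>F. c v \<odot>\<^bsub>V\<^esub> v)"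
        by (intro exI[of _ F] exI[of _ c] conjI F(1-3)) (simp only: F(4) comb[OF F(2,3)])
    qed
  next
    assume span: "act.spans_over (act.fixed_ring H) B (act.fixed_vectors H)"
    show "W.span B = act.fixed_vectors H"
    proof
      show "W.span B \<subseteq> act.fixed_vectors H"
        using W.span_is_subset2[of B] True unfolding carrier_W by simp
      show "act.fixed_vectors H \<subseteq> W.span B"
      proof
        fix w assume "w \<in> act.fixed_vectors H"
        then obtain F c where F: "finite F" "F \<subseteq> B" "c \<in> F \<rightarrow> act.fixed_ring H"
          "w = (\<Oplus>\<^bsub>V\<^esub>v\<in>F. c v \<odot>\<^bsub>V\<^esub> v)"
          using span unfolding act.spans_over_def by meson
        then have "w = W.lincomb c F" using comb by simp
        then show "w \<in> W.span B" unfolding W.span_def carrier_AH using F(1-3) by blast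
      qed
    qed
  qed
  ultimately show ?thesis unfolding module_basis_def carrier_W using True by simp
next
  case False
  then show ?thesis unfolding module_basis_def carrier_W by simp
qed

abbreviation grA where "grA \<equiv> invariant_grading gr H"

abbreviation grW where "grW \<equiv> covariant_grading k A gr M \<rho> H"

abbreviation grV where "grV \<equiv> tensor_grading k A gr M (trivial_grading M)"

lemma trivial_grading_closed: "trivial_grading M i \<subseteq> carrier M"
  unfolding trivial_grading_def by auto

lemma grV_subgroup: "additive_subgroup (grV n) V"
  by (rule TM.tensor_grading_subgroup[OF gr_closed trivial_grading_closed])

lemma is_grading_V: "is_grading V grV"
proof -
  obtain Y \<Phi> where "TM.coordinate_system Y \<Phi>"
    using TM.exists_coordinates[OF vectorspace_M M(2)] by blast
  then show ?thesis by (rule TM.tensor_is_grading[OF _ is_grading_A gr_smult])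
qed

lemma \<rho>_trivial: "\<sigma> \<in> G \<Longrightarrow> x \<in> trivial_grading M i \<Longrightarrow> \<rho> \<sigma> x \<in> trivial_grading M i"
proof -
  assume \<sigma>: "\<sigma> \<in> G" and x: "x \<in> trivial_grading M i"
  have "\<rho> \<sigma> \<zero>\<^bsub>M\<^esub> = \<zero>\<^bsub>M\<^esub>"
    by (rule additive_map_zero[OF TM.N.M.abelian_group_axioms TM.N.M.abelian_group_axioms])
      (use \<rho>_closed[OF \<sigma>] module_hom_add[OF \<rho>_hom[OF \<sigma>]] in auto)
  then show ?thesis using x \<rho>_closed[OF \<sigma>] unfolding trivial_grading_def by (auto split: if_splits)
qed

text \<open>The elements of \<open>G\<close> preserve the degrees of \<open>A\<close>, and \<open>M\<close> lies in a single degree.\<close>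

lemma \<beta>_degree:
  assumes \<sigma>: "\<sigma> \<in> G" and t: "t \<in> grV n"
  shows "\<beta> \<sigma> t \<in> grV n"
  using t
proof (induction rule: TM.tensor_grading_induct[OF gr_closed trivial_grading_closed, consumes 1])
  { case 1
    then show ?case using \<beta>_zero[OF \<sigma>] additive_subgroup.zero_closed[OF grV_subgroup] by simp }
  { case (2 a x i j)
    have "a \<in> carrier A" "x \<in> carrier M" using 2(1,2) gr_closed trivial_grading_closed by blast+
    then have "\<beta> \<sigma> (TM.pure a x) = TM.pure (\<sigma> a) (\<rho> \<sigma> x)" by (rule \<beta>_pure[OF \<sigma>])
    moreover have "TM.pure (\<sigma> a) (\<rho> \<sigma> x) \<in> grV (i + j)"
      by (rule TM.pure_in_tensor_grading[where grS = gr and grN = "trivial_grading M",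
            OF gr_closed trivial_grading_closed G_degree[OF \<sigma> 2(1)] \<rho>_trivial[OF \<sigma> 2(2)]])
    ultimately show ?case using 2(3) by simp }
  { case (3 t u)
    have "t \<in> carrier V" "u \<in> carrier V" using 3(1,2) additive_subgroup.a_subset[OF grV_subgroup] by blast+
    then show ?case using 3(3,4) \<beta>_add[OF \<sigma>] additive_subgroup.a_closed[OF grV_subgroup] by simp }
  { case (4 t)
    have tc: "t \<in> carrier V" using 4(1) additive_subgroup.a_subset[OF grV_subgroup] by blast
    have "\<beta> \<sigma> (\<ominus>\<^bsub>V\<^esub> t) \<oplus>\<^bsub>V\<^esub> \<beta> \<sigma> t = \<zero>\<^bsub>V\<^esub>"
      using \<beta>_add[OF \<sigma>, of "\<ominus>\<^bsub>V\<^esub> t" t] tc \<beta>_zero[OF \<sigma>] by (simp add: TM.T.l_neg)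
    then have "\<ominus>\<^bsub>V\<^esub> \<beta> \<sigma> t = \<beta> \<sigma> (\<ominus>\<^bsub>V\<^esub> t)"
      by (rule TM.T.minus_equality) (use \<beta>_closed[OF \<sigma>] tc in auto)
    then show ?case using additive_subgroup.a_inv_closed[OF grV_subgroup 4(2)] by simp }
qed

lemma is_grading_AH: "is_grading (AH H) grA"
proof (rule A.is_grading_fixed_points[OF gr_subgroup is_grading_A])
  show "abelian_group (AH H)" using cring_AH by (simp add: cring_def ring_def)
  show "carrier (AH H) = {x \<in> carrier A. \<forall>\<sigma> \<in> H. \<sigma> x = x}" unfolding invariant_ring_def by simp
  show "invariant_grading gr H i = {x \<in> gr i. \<forall>\<sigma> \<in> H. \<sigma> x = x}" for i unfolding invariant_grading_def ..
qed (use H G_closed G_degree ring_hom_add[OF G_hom] in \<open>auto simp: AH_simps fun_eq_iff\<close>)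

lemma is_grading_W: "is_grading (W H) grW"
proof (rule TM.T.is_grading_fixed_points[OF grV_subgroup is_grading_V abelian_group_W, where H = "\<beta> ` H"])
  show "carrier (W H) = {x \<in> carrier V. \<forall>\<phi> \<in> \<beta> ` H. \<phi> x = x}" unfolding covariants_def by simp
  show "grW i = {x \<in> grV i. \<forall>\<phi> \<in> \<beta> ` H. \<phi> x = x}" for i
    using additive_subgroup.a_subset[OF grV_subgroup, of i]
    unfolding covariant_grading_def carrier_W act.fixed_vectors_def by auto
qed (use H \<beta>_closed \<beta>_add \<beta>_degree in \<open>auto simp: W_simps fun_eq_iff\<close>)

lemma graded_ring_AH: "graded_ring (AH H) grA"
  unfolding graded_ring_def
proof (intro conjI allI ballI is_grading_AH)
  show "ring (AH H)" using cring_AH by (simp add: cring_def)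
  fix i j a b assume a: "a \<in> grA i" and b: "b \<in> grA j"
  then have "a \<in> act.fixed_ring H" "b \<in> act.fixed_ring H"
    using gr_closed unfolding invariant_grading_def act.fixed_ring_def by auto
  then have "a \<otimes>\<^bsub>A\<^esub> b \<in> act.fixed_ring H" by (rule fixed_ring_closed(4))
  moreover have "a \<otimes>\<^bsub>A\<^esub> b \<in> gr (i + j)"
    by (rule gr_mult) (use a b in \<open>simp_all add: invariant_grading_def\<close>)
  ultimately show "a \<otimes>\<^bsub>AH H\<^esub> b \<in> grA (i + j)"
    unfolding invariant_grading_def act.fixed_ring_def AH_simps by simp
qed

lemma grW_smult: "a \<in> grA i \<Longrightarrow> v \<in> grW j \<Longrightarrow> a \<odot>\<^bsub>V\<^esub> v \<in> grW (i + j)"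
proof -
  assume a: "a \<in> grA i" and v: "v \<in> grW j"
  have "a \<odot>\<^bsub>V\<^esub> v \<in> grV (i + j)"
    by (rule TM.tensor_grading_smult[where grS = gr and grN = "trivial_grading M",
          OF gr_closed trivial_grading_closed gr_mult])
      (use a v in \<open>auto simp: invariant_grading_def covariant_grading_def\<close>)
  moreover have "a \<in> act.fixed_ring H" using a gr_closed unfolding invariant_grading_def act.fixed_ring_def by auto
  moreover have "v \<in> act.fixed_vectors H" using v unfolding covariant_grading_def carrier_W by simp
  ultimately show ?thesis
    unfolding covariant_grading_def carrier_W using fixed_vectors_closed(3) by simp
qed

lemma graded_module_W: "graded_module (AH H) grA (W H) grW"
  unfolding graded_module_def
  by (intro conjI allI ballI graded_ring_AH module_W is_grading_W) (unfold W_simps, rule grW_smult)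

end

end

section \<open>The multiplication map\<close>

context covariant_setting
begin

context
  fixes K
  assumes K: "subgroup K (BijGroup (carrier A))" "reflection_subgroup A G \<subseteq> K" "K \<subseteq> G"
begin

text \<open>The inertia group of a prime ideal of height one consists of reflections by definition, and \<open>K\<close>
  contains all reflections; so the descent theorem applies.\<close>

lemma basis_descends:
  assumes "module_basis (AH G) (W G) B"
  shows "module_basis (AH K) (W K) B"
proof -
  have B: "B \<subseteq> act.fixed_vectors (carrier \<Gamma>)"
    "act.independent_over (act.fixed_ring (carrier \<Gamma>)) B"
    "act.spans_over (act.fixed_ring (carrier \<Gamma>)) B (act.fixed_vectors (carrier \<Gamma>))"
    using assms module_basis_W[of G B] by simp_all
  have KG: "subgroup K \<Gamma>"
    by (rule group.subgroup_incl[OF group_BijGroup K(1) G(1) K(3)])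
  have refl: "act.inertia P \<subseteq> K" if P: "primeideal P A" "prime_height A P = 1" for P
  proof
    fix \<sigma> assume "\<sigma> \<in> act.inertia P"
    then have "\<sigma> \<in> inertia_subgroup A G P" unfolding act.inertia_def inertia_subgroup_def by simp
    then have "\<sigma> \<in> reflections A G" unfolding reflections_def using P by blast
    then have "\<sigma> \<in> reflection_subgroup A G" unfolding reflection_subgroup_def by (rule generate.incl)
    then show "\<sigma> \<in> K" using K(2) by blast
  qed
  have "act.fixed_vectors (carrier \<Gamma>) \<subseteq> act.fixed_vectors K"
    using K(3) unfolding act.fixed_vectors_def by auto
  then show ?thesis
    unfolding module_basis_W[OF K(3)]
    using act.fixed_basis_descends[OF noetherian_A normal_A B KG refl] B(1) by blast
qed

lemma tensor_setting: "tensor (AH G) (AH K) (W G)"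
proof (rule tensor.intro)
  have GG: "G \<subseteq> G" by simp
  show "module (AH G) (W G)" by (rule module_W[OF GG])
  have sub: "act.fixed_ring G \<subseteq> act.fixed_ring K" using K(3) unfolding act.fixed_ring_def by auto
  show "algebra (AH G) (AH K)"
  proof (rule algebraI[OF cring_AH[OF GG] cring_AH[OF K(3)]], unfold carrier_AH AH_simps)
    show "a \<otimes>\<^bsub>A\<^esub> x \<in> act.fixed_ring K" if "a \<in> act.fixed_ring G" "x \<in> act.fixed_ring K" for a x
      using fixed_ring_closed(4)[OF K(3)] that sub by blast
    show "(a \<oplus>\<^bsub>A\<^esub> b) \<otimes>\<^bsub>A\<^esub> x = a \<otimes>\<^bsub>A\<^esub> x \<oplus>\<^bsub>A\<^esub> b \<otimes>\<^bsub>A\<^esub> x"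
      if "a \<in> act.fixed_ring G" "b \<in> act.fixed_ring G" "x \<in> act.fixed_ring K" for a b x
      using that[THEN fixed_ringD] by (rule A.l_distr)
    show "a \<otimes>\<^bsub>A\<^esub> (x \<oplus>\<^bsub>A\<^esub> y) = a \<otimes>\<^bsub>A\<^esub> x \<oplus>\<^bsub>A\<^esub> a \<otimes>\<^bsub>A\<^esub> y"
      if "a \<in> act.fixed_ring G" "x \<in> act.fixed_ring K" "y \<in> act.fixed_ring K" for a x y
      using that[THEN fixed_ringD] by (simp add: A.r_distr)
    show "a \<otimes>\<^bsub>A\<^esub> b \<otimes>\<^bsub>A\<^esub> x = a \<otimes>\<^bsub>A\<^esub> (b \<otimes>\<^bsub>A\<^esub> x)"
      if "a \<in> act.fixed_ring G" "b \<in> act.fixed_ring G" "x \<in> act.fixed_ring K" for a b x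
      using that[THEN fixed_ringD] by (rule A.m_assoc)
    show "a \<otimes>\<^bsub>A\<^esub> x \<otimes>\<^bsub>A\<^esub> y = a \<otimes>\<^bsub>A\<^esub> (x \<otimes>\<^bsub>A\<^esub> y)"
      if "a \<in> act.fixed_ring G" "x \<in> act.fixed_ring K" "y \<in> act.fixed_ring K" for a x y
      using that[THEN fixed_ringD] by (rule A.m_assoc)
    show "\<one>\<^bsub>A\<^esub> \<otimes>\<^bsub>A\<^esub> x = x" if "x \<in> act.fixed_ring K" for x
      using fixed_ringD[OF that] by simp
  qed
qed

interpretation TT: tensor "AH G" "AH K" "W G" by (rule tensor_setting)

lemma fixed_mono:
  "act.fixed_ring G \<subseteq> act.fixed_ring K" "act.fixed_vectors G \<subseteq> act.fixed_vectors K"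
  using K(3) unfolding act.fixed_ring_def act.fixed_vectors_def by auto

text \<open>Multiplication is balanced over \<open>A\<^sup>G\<close> because \<open>A\<close> is commutative.\<close>

lemma exists_multiplication_map:
  "\<exists>\<mu>. (\<forall>t \<in> carrier TT.T. \<mu> t \<in> carrier (W K)) \<and>
     (\<forall>t \<in> carrier TT.T. \<forall>u \<in> carrier TT.T. \<mu> (t \<oplus>\<^bsub>TT.T\<^esub> u) = \<mu> t \<oplus>\<^bsub>W K\<^esub> \<mu> u) \<and>
     (\<forall>a \<in> carrier (AH K). \<forall>w \<in> carrier (W G). \<mu> (TT.pure a w) = a \<odot>\<^bsub>W K\<^esub> w)"
proof (rule TT.universal[OF abelian_group_W[OF K(3)]], unfold carrier_AH carrier_W AH_simps W_simps)
  show "a \<odot>\<^bsub>V\<^esub> v \<in> act.fixed_vectors K" if "a \<in> act.fixed_ring K" "v \<in> act.fixed_vectors G" for a v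
    using fixed_vectors_closed(3)[OF K(3) that(1)] that(2) fixed_mono(2) by blast
  show "(a \<oplus>\<^bsub>A\<^esub> b) \<odot>\<^bsub>V\<^esub> v = a \<odot>\<^bsub>V\<^esub> v \<oplus>\<^bsub>V\<^esub> b \<odot>\<^bsub>V\<^esub> v"
    if "a \<in> act.fixed_ring K" "b \<in> act.fixed_ring K" "v \<in> act.fixed_vectors G" for a b v
    by (rule V.smult_l_distr[OF fixed_ringD[OF that(1)] fixed_ringD[OF that(2)] fixed_vectorsD[OF that(3)]])
  show "a \<odot>\<^bsub>V\<^esub> (v \<oplus>\<^bsub>V\<^esub> w) = a \<odot>\<^bsub>V\<^esub> v \<oplus>\<^bsub>V\<^esub> a \<odot>\<^bsub>V\<^esub> w"
    if "a \<in> act.fixed_ring K" "v \<in> act.fixed_vectors G" "w \<in> act.fixed_vectors G" for a v w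
    by (rule V.smult_r_distr[OF fixed_ringD[OF that(1)] fixed_vectorsD[OF that(2)] fixed_vectorsD[OF that(3)]])
  show "r \<otimes>\<^bsub>A\<^esub> a \<odot>\<^bsub>V\<^esub> v = a \<odot>\<^bsub>V\<^esub> (r \<odot>\<^bsub>V\<^esub> v)"
    if "r \<in> act.fixed_ring G" "a \<in> act.fixed_ring K" "v \<in> act.fixed_vectors G" for r a v
    using V.smult_assoc1[OF fixed_ringD[OF that(2)] fixed_ringD[OF that(1)] fixed_vectorsD[OF that(3)]]
      A.m_comm[OF fixed_ringD[OF that(1)] fixed_ringD[OF that(2)]] by simp
qed

context
  fixes B \<mu>
  assumes B: "module_basis (AH G) (W G) B"
    and \<mu>_closed: "\<And>t. t \<in> carrier TT.T \<Longrightarrow> \<mu> t \<in> carrier (W K)"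
    and \<mu>_add: "\<And>t u. t \<in> carrier TT.T \<Longrightarrow> u \<in> carrier TT.T \<Longrightarrow> \<mu> (t \<oplus>\<^bsub>TT.T\<^esub> u) = \<mu> t \<oplus>\<^bsub>W K\<^esub> \<mu> u"
    and \<mu>_pure: "\<And>a w. a \<in> carrier (AH K) \<Longrightarrow> w \<in> carrier (W G) \<Longrightarrow> \<mu> (TT.pure a w) = a \<odot>\<^bsub>W K\<^esub> w"
begin

lemma B_fixed: "B \<subseteq> act.fixed_vectors G"
  and B_indep: "act.independent_over (act.fixed_ring K) B"
  and B_span_G: "act.spans_over (act.fixed_ring G) B (act.fixed_vectors G)"
  and B_span_K: "act.spans_over (act.fixed_ring K) B (act.fixed_vectors K)"
  using B basis_descends[OF B] module_basis_W[of G B] module_basis_W[OF K(3), of B] by simp_all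

lemma WK_group: "abelian_group (W K)" by (rule abelian_group_W[OF K(3)])

lemma \<mu>_zero: "\<mu> \<zero>\<^bsub>TT.T\<^esub> = \<zero>\<^bsub>W K\<^esub>"
  by (rule additive_map_zero[OF TT.abelian_group_T WK_group \<mu>_closed \<mu>_add])

lemma \<mu>_finsum:
  "(\<And>i. i \<in> F \<Longrightarrow> f i \<in> carrier TT.T) \<Longrightarrow> \<mu> (finsum TT.T f F) = finsum (W K) (\<lambda>i. \<mu> (f i)) F"
  by (rule additive_map_finsum[OF TT.abelian_group_T WK_group \<mu>_closed \<mu>_add])

lemma \<mu>_basis_sum:
  assumes F: "F \<subseteq> B" and c: "c \<in> F \<rightarrow> act.fixed_ring K"
  shows "\<mu> (\<Oplus>\<^bsub>TT.T\<^esub>v\<in>F. TT.pure (c v) v) = (\<Oplus>\<^bsub>V\<^esub>v\<in>F. c v \<odot>\<^bsub>V\<^esub> v)"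
proof -
  have cv: "c v \<in> carrier (AH K)" "v \<in> carrier (W G)" if "v \<in> F" for v
    using that c F B_fixed unfolding carrier_AH carrier_W by auto
  have cw: "c v \<odot>\<^bsub>V\<^esub> v \<in> act.fixed_vectors K" if "v \<in> F" for v
    using fixed_vectors_closed(3)[OF K(3)] cv[OF that] fixed_mono(2) unfolding carrier_AH carrier_W by blast
  have "\<mu> (\<Oplus>\<^bsub>TT.T\<^esub>v\<in>F. TT.pure (c v) v) = (\<Oplus>\<^bsub>W K\<^esub>v\<in>F. \<mu> (TT.pure (c v) v))"
    by (rule \<mu>_finsum) (use cv in auto)
  also have "\<dots> = (\<Oplus>\<^bsub>W K\<^esub>v\<in>F. c v \<odot>\<^bsub>V\<^esub> v)"
    by (rule abelian_monoid.finsum_cong'[OF abelian_group.axioms(1)[OF WK_group]])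
      (use \<mu>_pure[OF cv] cw in \<open>simp_all add: W_simps carrier_W\<close>)
  also have "\<dots> = (\<Oplus>\<^bsub>V\<^esub>v\<in>F. c v \<odot>\<^bsub>V\<^esub> v)" by (rule finsum_W[OF K(3) cw])
  finally show ?thesis .
qed

text \<open>Moving the coefficients of \<open>A\<^sup>G(M)\<close> to the left factor brings every tensor into the form
  \<open>\<Sum> c\<^sub>v \<otimes> v\<close> over basis elements \<open>v\<close>.\<close>

lemma tensor_basis_form:
  assumes "t \<in> carrier TT.T"
  shows "\<exists>F c. finite F \<and> F \<subseteq> B \<and> c \<in> F \<rightarrow> act.fixed_ring K \<and> t = (\<Oplus>\<^bsub>TT.T\<^esub>v\<in>F. TT.pure (c v) v)"
  using assms
proof (induction rule: TT.tensor_induct)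
  case zero
  show ?case by (intro exI[of _ "{}"] exI[of _ "\<lambda>_. undefined"]) simp
next
  case (add t a w)
  obtain F c where F: "finite F" "F \<subseteq> B" "c \<in> F \<rightarrow> act.fixed_ring K"
    and t: "t = (\<Oplus>\<^bsub>TT.T\<^esub>v\<in>F. TT.pure (c v) v)"
    using add.IH by (elim exE conjE) (rule that)
  have a: "a \<in> act.fixed_ring K" and w: "w \<in> act.fixed_vectors G"
    using add.hyps(2,3) unfolding carrier_AH carrier_W by auto
  obtain F' d where F': "finite F'" "F' \<subseteq> B" "d \<in> F' \<rightarrow> act.fixed_ring G"
    and wd: "w = (\<Oplus>\<^bsub>V\<^esub>v\<in>F'. d v \<odot>\<^bsub>V\<^esub> v)"
    using bspec[OF B_span_G[unfolded act.spans_over_def] w] by (elim exE conjE) (rule that)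
  have Bc: "v \<in> carrier (W G)" if "v \<in> B" for v using that B_fixed unfolding carrier_W by auto
  have dv: "d v \<in> carrier (AH G)" "d v \<odot>\<^bsub>W G\<^esub> v \<in> carrier (W G)" if "v \<in> F'" for v
    using funcset_mem[OF F'(3) that] Bc[of v] that F'(2) TT.N.smult_closed[of "d v" v]
    unfolding carrier_AH by blast+
  have ad: "a \<otimes>\<^bsub>A\<^esub> d v \<in> act.fixed_ring K" if "v \<in> F'" for v
    using fixed_ring_closed(4)[OF K(3) a] dv[OF that] fixed_mono(1) unfolding carrier_AH by blast
  have "TT.pure a w = TT.pure a (\<Oplus>\<^bsub>W G\<^esub>v\<in>F'. d v \<odot>\<^bsub>W G\<^esub> v)"
  proof -
    have "(\<Oplus>\<^bsub>W G\<^esub>v\<in>F'. d v \<odot>\<^bsub>W G\<^esub> v) = w"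
      unfolding wd W_simps by (rule finsum_W[of G]) (use dv in \<open>simp_all add: carrier_W W_simps\<close>)
    then show ?thesis by simp
  qed
  also have "\<dots> = (\<Oplus>\<^bsub>TT.T\<^esub>v\<in>F'. TT.pure a (d v \<odot>\<^bsub>W G\<^esub> v))"
    by (rule additive_map_finsum[OF TT.N.M.abelian_group_axioms TT.abelian_group_T])
      (use TT.pure_closed[OF add.hyps(2)] TT.pure_add_right[OF add.hyps(2)] dv in auto)
  also have "\<dots> = (\<Oplus>\<^bsub>TT.T\<^esub>v\<in>F'. TT.pure (a \<otimes>\<^bsub>A\<^esub> d v) v)"
  proof (rule TT.T.finsum_cong')
    fix v assume v: "v \<in> F'"
    have "TT.pure (d v \<odot>\<^bsub>AH K\<^esub> a) v = TT.pure a (d v \<odot>\<^bsub>W G\<^esub> v)"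
      by (rule TT.pure_balanced[OF dv(1)[OF v] add.hyps(2)]) (use Bc F'(2) v in blast)
    moreover have "d v \<odot>\<^bsub>AH K\<^esub> a = a \<otimes>\<^bsub>A\<^esub> d v"
      using A.m_comm[of a "d v"] fixed_ringD[OF a] dv(1)[OF v] unfolding carrier_AH AH_simps
      by (simp add: fixed_ringD)
    ultimately show "TT.pure a (d v \<odot>\<^bsub>W G\<^esub> v) = TT.pure (a \<otimes>\<^bsub>A\<^esub> d v) v" by simp
  next
    show "(\<lambda>v. TT.pure (a \<otimes>\<^bsub>A\<^esub> d v) v) \<in> F' \<rightarrow> carrier TT.T"
      using ad Bc F'(2) by (intro Pi_I TT.pure_closed) (auto simp: carrier_AH)
  qed simp
  finally have aw: "TT.pure a w = (\<Oplus>\<^bsub>TT.T\<^esub>v\<in>F'. TT.pure (a \<otimes>\<^bsub>A\<^esub> d v) v)" .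
  let ?E = "F \<union> F'"
  define c1 where "c1 v = (if v \<in> F then c v else \<zero>\<^bsub>A\<^esub>)" for v
  define c2 where "c2 v = (if v \<in> F' then a \<otimes>\<^bsub>A\<^esub> d v else \<zero>\<^bsub>A\<^esub>)" for v
  have zK: "\<zero>\<^bsub>A\<^esub> \<in> act.fixed_ring K" by (rule fixed_ring_closed(1)[OF K(3)])
  have c12: "c1 v \<in> carrier (AH K)" "c2 v \<in> carrier (AH K)" for v
    unfolding c1_def c2_def carrier_AH using funcset_mem[OF F(3)] ad zK by auto
  have Ec: "v \<in> carrier (W G)" if "v \<in> ?E" for v using that F(2) F'(2) Bc by blast
  have p0: "TT.pure \<zero>\<^bsub>A\<^esub> v = \<zero>\<^bsub>TT.T\<^esub>" if "v \<in> ?E" for v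
    using TT.pure_zero_left[OF Ec[OF that]] unfolding AH_simps .
  have pc: "TT.pure (c1 v) v \<in> carrier TT.T" "TT.pure (c2 v) v \<in> carrier TT.T" if "v \<in> ?E" for v
    using TT.pure_closed[OF c12(1) Ec[OF that]] TT.pure_closed[OF c12(2) Ec[OF that]] .
  have "t = (\<Oplus>\<^bsub>TT.T\<^esub>v\<in>?E. TT.pure (c1 v) v)"
    unfolding t
  proof (rule TT.T.add.finprod_mono_neutral_cong_left)
    show "TT.pure (c1 v) v = \<zero>\<^bsub>TT.T\<^esub>" if "v \<in> ?E - F" for v using that p0 by (auto simp: c1_def)
    show "TT.pure (c v) v = TT.pure (c1 v) v" if "v \<in> F" for v using that by (simp add: c1_def)
    show "(\<lambda>v. TT.pure (c1 v) v) \<in> ?E \<rightarrow> carrier TT.T" using pc by blast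
  qed (use F F' in auto)
  moreover have "TT.pure a w = (\<Oplus>\<^bsub>TT.T\<^esub>v\<in>?E. TT.pure (c2 v) v)"
    unfolding aw
  proof (rule TT.T.add.finprod_mono_neutral_cong_left)
    show "TT.pure (c2 v) v = \<zero>\<^bsub>TT.T\<^esub>" if "v \<in> ?E - F'" for v using that p0 by (auto simp: c2_def)
    show "TT.pure (a \<otimes>\<^bsub>A\<^esub> d v) v = TT.pure (c2 v) v" if "v \<in> F'" for v using that by (simp add: c2_def)
    show "(\<lambda>v. TT.pure (c2 v) v) \<in> ?E \<rightarrow> carrier TT.T" using pc by blast
  qed (use F F' in auto)
  moreover have "(\<Oplus>\<^bsub>TT.T\<^esub>v\<in>?E. TT.pure (c1 v) v) \<oplus>\<^bsub>TT.T\<^esub> (\<Oplus>\<^bsub>TT.T\<^esub>v\<in>?E. TT.pure (c2 v) v)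
      = (\<Oplus>\<^bsub>TT.T\<^esub>v\<in>?E. TT.pure (c1 v) v \<oplus>\<^bsub>TT.T\<^esub> TT.pure (c2 v) v)"
    by (rule TT.T.finsum_addf[symmetric]) (use pc in auto)
  moreover have "\<dots> = (\<Oplus>\<^bsub>TT.T\<^esub>v\<in>?E. TT.pure (c1 v \<oplus>\<^bsub>A\<^esub> c2 v) v)"
  proof (rule TT.T.finsum_cong')
    fix v assume v: "v \<in> ?E"
    show "TT.pure (c1 v) v \<oplus>\<^bsub>TT.T\<^esub> TT.pure (c2 v) v = TT.pure (c1 v \<oplus>\<^bsub>A\<^esub> c2 v) v"
      using TT.pure_add_left[OF c12(1) c12(2) Ec[OF v]] unfolding AH_simps by (rule sym)
  next
    show "(\<lambda>v. TT.pure (c1 v \<oplus>\<^bsub>A\<^esub> c2 v) v) \<in> ?E \<rightarrow> carrier TT.T"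
      using TT.pure_closed[OF TT.S.a_closed[OF c12] Ec] unfolding AH_simps by blast
  qed simp
  ultimately have "t \<oplus>\<^bsub>TT.T\<^esub> TT.pure a w = (\<Oplus>\<^bsub>TT.T\<^esub>v\<in>?E. TT.pure (c1 v \<oplus>\<^bsub>A\<^esub> c2 v) v)" by simp
  moreover have "(\<lambda>v. c1 v \<oplus>\<^bsub>A\<^esub> c2 v) \<in> ?E \<rightarrow> act.fixed_ring K"
    using fixed_ring_closed(3)[OF K(3)] c12 unfolding carrier_AH by blast
  ultimately show ?case
    using F F' by (intro exI[of _ ?E] exI[of _ "\<lambda>v. c1 v \<oplus>\<^bsub>A\<^esub> c2 v"] conjI) auto
qed

text \<open>The coefficients of a basis form of \<open>t\<close> are those of a relation between elements of \<open>B\<close>, which are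
  independent over \<open>A\<^sup>K\<close>.\<close>

lemma \<mu>_kernel:
  assumes t: "t \<in> carrier TT.T" and 0: "\<mu> t = \<zero>\<^bsub>W K\<^esub>"
  shows "t = \<zero>\<^bsub>TT.T\<^esub>"
proof -
  obtain F c where F: "finite F" "F \<subseteq> B" "c \<in> F \<rightarrow> act.fixed_ring K"
    and tF: "t = (\<Oplus>\<^bsub>TT.T\<^esub>v\<in>F. TT.pure (c v) v)"
    using tensor_basis_form[OF t] by (elim exE conjE) (rule that)
  have "(\<Oplus>\<^bsub>V\<^esub>v\<in>F. c v \<odot>\<^bsub>V\<^esub> v) = \<zero>\<^bsub>V\<^esub>"
    using 0 \<mu>_basis_sum[OF F(2,3)] unfolding tF W_simps by simp
  then have c0: "\<forall>v \<in> F. c v = \<zero>\<^bsub>A\<^esub>"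
    using B_indep[unfolded act.independent_over_def, rule_format, OF F] by blast
  have "(\<Oplus>\<^bsub>TT.T\<^esub>v\<in>F. TT.pure (c v) v) = (\<Oplus>\<^bsub>TT.T\<^esub>v\<in>F. \<zero>\<^bsub>TT.T\<^esub>)"
  proof (rule TT.T.finsum_cong')
    fix v assume v: "v \<in> F"
    then have "v \<in> carrier (W G)" using F(2) B_fixed unfolding carrier_W by blast
    then show "TT.pure (c v) v = \<zero>\<^bsub>TT.T\<^esub>" using TT.pure_zero_left c0 v unfolding AH_simps by simp
  qed auto
  then show ?thesis unfolding tF by simp
qed

lemma \<mu>_bij: "bij_betw \<mu> (carrier TT.T) (carrier (W K))"
proof (rule bij_betw_imageI)
  interpret WK: abelian_group "W K" by (rule WK_group)
  have \<mu>_minus: "\<mu> (t \<ominus>\<^bsub>TT.T\<^esub> u) \<oplus>\<^bsub>W K\<^esub> \<mu> u = \<mu> t" if "t \<in> carrier TT.T" "u \<in> carrier TT.T" for t u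
  proof -
    have "(t \<ominus>\<^bsub>TT.T\<^esub> u) \<oplus>\<^bsub>TT.T\<^esub> u = t" using that by (simp add: TT.T.minus_eq TT.T.a_assoc TT.T.l_neg)
    then show ?thesis using \<mu>_add[of "t \<ominus>\<^bsub>TT.T\<^esub> u" u] that by simp
  qed
  show "inj_on \<mu> (carrier TT.T)"
  proof (rule inj_onI)
    fix t u assume tu: "t \<in> carrier TT.T" "u \<in> carrier TT.T" "\<mu> t = \<mu> u"
    have "\<mu> (t \<ominus>\<^bsub>TT.T\<^esub> u) = \<zero>\<^bsub>W K\<^esub>"
      using \<mu>_minus[OF tu(1,2)] tu(3) \<mu>_closed[of "t \<ominus>\<^bsub>TT.T\<^esub> u"] \<mu>_closed[OF tu(2)] tu(1,2) by simp
    then have "t \<ominus>\<^bsub>TT.T\<^esub> u = \<zero>\<^bsub>TT.T\<^esub>" by (rule \<mu>_kernel[rotated]) (use tu in simp)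
    then show "t = u" using tu(1,2) by simp
  qed
  show "\<mu> ` carrier TT.T = carrier (W K)"
  proof
    show "\<mu> ` carrier TT.T \<subseteq> carrier (W K)" using \<mu>_closed by blast
    show "carrier (W K) \<subseteq> \<mu> ` carrier TT.T"
    proof
      fix w assume "w \<in> carrier (W K)"
      then have w: "w \<in> act.fixed_vectors K" unfolding carrier_W .
      obtain F c where F: "finite F" "F \<subseteq> B" "c \<in> F \<rightarrow> act.fixed_ring K"
        and wF: "w = (\<Oplus>\<^bsub>V\<^esub>v\<in>F. c v \<odot>\<^bsub>V\<^esub> v)"
        using bspec[OF B_span_K[unfolded act.spans_over_def] w] by (elim exE conjE) (rule that)
      have "(\<Oplus>\<^bsub>TT.T\<^esub>v\<in>F. TT.pure (c v) v) \<in> carrier TT.T"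
      proof (rule TT.T.finsum_closed, rule Pi_I)
        fix v assume "v \<in> F"
        then show "TT.pure (c v) v \<in> carrier TT.T"
          using F(2) B_fixed funcset_mem[OF F(3)] by (intro TT.pure_closed) (auto simp: carrier_AH carrier_W)
      qed
      then show "w \<in> \<mu> ` carrier TT.T" using \<mu>_basis_sum[OF F(2,3)] wF by (intro image_eqI) auto
    qed
  qed
qed

lemma \<mu>_smult:
  assumes s: "s \<in> carrier (AH K)" and t: "t \<in> carrier TT.T"
  shows "\<mu> (s \<odot>\<^bsub>TT.T\<^esub> t) = s \<odot>\<^bsub>W K\<^esub> \<mu> t"
  using t
proof (induction rule: TT.tensor_induct)
  interpret WK: module "AH K" "W K" by (rule module_W[OF K(3)])
  { case zero
    then show ?case using s TT.smult_zero_T[OF s] \<mu>_zero by simp }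
  { case (add t a w)
    have wK: "w \<in> carrier (W K)" using add.hyps(3) fixed_mono(2) unfolding carrier_W by blast
    have "\<mu> (s \<odot>\<^bsub>TT.T\<^esub> (t \<oplus>\<^bsub>TT.T\<^esub> TT.pure a w)) = s \<odot>\<^bsub>W K\<^esub> \<mu> t \<oplus>\<^bsub>W K\<^esub> (s \<otimes>\<^bsub>AH K\<^esub> a) \<odot>\<^bsub>W K\<^esub> w"
      using add s TT.smult_closed_T[OF s]
      by (simp add: TT.smult_add_T TT.smult_pure \<mu>_add \<mu>_pure)
    also have "\<dots> = s \<odot>\<^bsub>W K\<^esub> (\<mu> t \<oplus>\<^bsub>W K\<^esub> a \<odot>\<^bsub>W K\<^esub> w)"
      using WK.smult_r_distr[OF s \<mu>_closed[OF add.hyps(1)], of "a \<odot>\<^bsub>W K\<^esub> w"]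
        WK.smult_assoc1[OF s add.hyps(2) wK] WK.smult_closed[OF add.hyps(2) wK] by simp
    also have "\<dots> = s \<odot>\<^bsub>W K\<^esub> \<mu> (t \<oplus>\<^bsub>TT.T\<^esub> TT.pure a w)"
      using \<mu>_add[of t "TT.pure a w"] \<mu>_pure[OF add.hyps(2,3)] add.hyps by simp
    finally show ?case . }
qed

abbreviation TTG where
  "TTG \<equiv> tensor_grading (AH G) (AH K) (invariant_grading gr K) (W G) (covariant_grading k A gr M \<rho> G)"

lemma grAK_closed: "invariant_grading gr K i \<subseteq> carrier (AH K)"
  using is_grading_AH[OF K(3)] additive_subgroup.a_subset unfolding is_grading_def by blast

lemma grWG_closed: "covariant_grading k A gr M \<rho> G i \<subseteq> carrier (W G)"
  unfolding covariant_grading_def by blast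

lemma grWK_subgroup: "additive_subgroup (covariant_grading k A gr M \<rho> K i) (W K)"
  using is_grading_W[OF K(3)] unfolding is_grading_def by simp

lemma TTG_subgroup: "additive_subgroup (TTG n) TT.T"
  by (rule TT.tensor_grading_subgroup[OF grAK_closed grWG_closed])

lemma \<mu>_degree: "t \<in> TTG n \<Longrightarrow> \<mu> t \<in> covariant_grading k A gr M \<rho> K n"
proof (induction rule: TT.tensor_grading_induct[OF grAK_closed grWG_closed, consumes 1])
  interpret WK: abelian_group "W K" by (rule WK_group)
  { case 1
    then show ?case using \<mu>_zero additive_subgroup.zero_closed[OF grWK_subgroup] by simp }
  { case (2 a w i j)
    have "w \<in> covariant_grading k A gr M \<rho> K j"
      using 2(2) fixed_mono(2) unfolding covariant_grading_def carrier_W by blast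
    then have "a \<odot>\<^bsub>V\<^esub> w \<in> covariant_grading k A gr M \<rho> K (i + j)" by (rule grW_smult[OF K(3) 2(1)])
    moreover have "a \<in> carrier (AH K)" "w \<in> carrier (W G)" using 2(1,2) grAK_closed grWG_closed by blast+
    ultimately show ?case using \<mu>_pure 2(3) unfolding W_simps by simp }
  { case (3 t u)
    have "t \<in> carrier TT.T" "u \<in> carrier TT.T" using 3(1,2) additive_subgroup.a_subset[OF TTG_subgroup] by blast+
    then show ?case using 3(3,4) \<mu>_add additive_subgroup.a_closed[OF grWK_subgroup] by simp }
  { case (4 t)
    have tc: "t \<in> carrier TT.T" using 4(1) additive_subgroup.a_subset[OF TTG_subgroup] by blast
    have "\<mu> (\<ominus>\<^bsub>TT.T\<^esub> t) \<oplus>\<^bsub>W K\<^esub> \<mu> t = \<zero>\<^bsub>W K\<^esub>"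
      using \<mu>_add[of "\<ominus>\<^bsub>TT.T\<^esub> t" t] tc \<mu>_zero by (simp add: TT.T.l_neg)
    then have "\<ominus>\<^bsub>W K\<^esub> \<mu> t = \<mu> (\<ominus>\<^bsub>TT.T\<^esub> t)"
      by (rule WK.minus_equality) (use \<mu>_closed tc in auto)
    then show ?case using additive_subgroup.a_inv_closed[OF grWK_subgroup 4(2)] by simp }
qed

lemma WK_independent: "graded_independent (W K) (covariant_grading k A gr M \<rho> K)"
  by (rule abelian_group.is_grading_imp_independent[OF WK_group grWK_subgroup is_grading_W[OF K(3)]])

lemma TT_graded_sums:
  assumes "t \<in> carrier TT.T"
  shows "t \<in> graded_sums TT.T TTG"
proof (rule TT.tensor_graded_sums[OF grAK_closed grWG_closed _ _ assms])
  have GG: "G \<subseteq> G" by simp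
  show "a \<in> graded_sums (AH K) (invariant_grading gr K)" if "a \<in> carrier (AH K)" for a
    by (rule abelian_group.is_grading_imp_graded_sums[OF TT.S.is_abelian_group _ is_grading_AH[OF K(3)] that])
      (use is_grading_AH[OF K(3)] in \<open>simp add: is_grading_def\<close>)
  show "w \<in> graded_sums (W G) (covariant_grading k A gr M \<rho> G)" if "w \<in> carrier (W G)" for w
    by (rule abelian_group.is_grading_imp_graded_sums[OF TT.N.M.abelian_group_axioms _ is_grading_W[OF GG] that])
      (use is_grading_W[OF GG] in \<open>simp add: is_grading_def\<close>)
qed

text \<open>The homogeneous parts of the tensor product span it. Their sum is direct since their images under
  the injective map \<open>\<mu>\<close> lie in distinct degrees of \<open>A\<^sup>K(M)\<close>.\<close>

lemma is_grading_TT: "is_grading TT.T TTG"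
proof (rule TT.T.is_gradingI[OF TTG_subgroup TT_graded_sums])
  show "graded_independent TT.T TTG"
    unfolding graded_independent_def
  proof (intro allI impI)
    fix c n i assume c: "\<forall>i. c i \<in> TTG i" and sum: "finsum TT.T c {..<n} = \<zero>\<^bsub>TT.T\<^esub>" and i: "i < n"
    have cc: "c i \<in> carrier TT.T" for i
      using spec[OF c, of i] additive_subgroup.a_subset[OF TTG_subgroup] by blast
    have "finsum (W K) (\<lambda>i. \<mu> (c i)) {..<n} = \<mu> (finsum TT.T c {..<n})" by (rule \<mu>_finsum[OF cc, symmetric])
    then have sum0: "finsum (W K) (\<lambda>i. \<mu> (c i)) {..<n} = \<zero>\<^bsub>W K\<^esub>" unfolding sum using \<mu>_zero by simp
    have "\<mu> (c i) = \<zero>\<^bsub>W K\<^esub>"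
      by (rule graded_independentD[OF WK_independent _ sum0 i]) (rule \<mu>_degree[OF spec[OF c]])
    then show "c i = \<zero>\<^bsub>TT.T\<^esub>" by (rule \<mu>_kernel[OF cc])
  qed
qed

text \<open>Of the homogeneous components of a preimage of \<open>w\<close>, the one in the degree of \<open>w\<close> is itself a
  preimage.\<close>

lemma \<mu>_image_degree: "\<mu> ` TTG n = covariant_grading k A gr M \<rho> K n"
proof
  interpret WK: abelian_group "W K" by (rule WK_group)
  show "\<mu> ` TTG n \<subseteq> covariant_grading k A gr M \<rho> K n" using \<mu>_degree by blast
  show "covariant_grading k A gr M \<rho> K n \<subseteq> \<mu> ` TTG n"
  proof
    fix w assume w: "w \<in> covariant_grading k A gr M \<rho> K n"
    then have "w \<in> carrier (W K)" unfolding covariant_grading_def by simp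
    then obtain t where t: "t \<in> carrier TT.T" "w = \<mu> t" using \<mu>_bij unfolding bij_betw_def by blast
    obtain c m where c: "\<And>i. c i \<in> TTG i" "t = finsum TT.T c {..<m}"
      by (rule TT.T.graded_sumsE[OF TTG_subgroup TT_graded_sums[OF t(1)]]) (rule that)
    have cc: "c i \<in> carrier TT.T" for i
      using c(1)[of i] additive_subgroup.a_subset[OF TTG_subgroup] by blast
    have "w = finsum (W K) (\<lambda>i. \<mu> (c i)) {..<m}" unfolding t(2) c(2) by (rule \<mu>_finsum[OF cc])
    then have "w = (if n < m then \<mu> (c n) else \<zero>\<^bsub>W K\<^esub>)"
      by (rule WK.homogeneous_component[OF grWK_subgroup WK_independent w \<mu>_degree[OF c(1)]])
    then show "w \<in> \<mu> ` TTG n"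
      using c(1) additive_subgroup.zero_closed[OF TTG_subgroup] \<mu>_zero by (auto split: if_splits)
  qed
qed

lemma graded_module_TT: "graded_module (AH K) (invariant_grading gr K) TT.T TTG"
  unfolding graded_module_def
proof (intro conjI allI ballI graded_ring_AH[OF K(3)] TT.module_T is_grading_TT)
  fix i j a t assume a: "a \<in> invariant_grading gr K i" and t: "t \<in> TTG j"
  show "a \<odot>\<^bsub>TT.T\<^esub> t \<in> TTG (i + j)"
  proof (rule TT.tensor_grading_smult[OF grAK_closed grWG_closed _ a t])
    fix i j a b assume "a \<in> invariant_grading gr K i" "b \<in> invariant_grading gr K j"
    then show "a \<otimes>\<^bsub>AH K\<^esub> b \<in> invariant_grading gr K (i + j)"
      using graded_ring_AH[OF K(3)] unfolding graded_ring_def by blast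
  qed
qed

lemma \<mu>_iso:
  "\<mu> \<in> graded_module_iso (AH K) (invariant_grading gr K) TT.T TTG (W K) (covariant_grading k A gr M \<rho> K)"
  unfolding graded_module_iso_def module_hom_def
  using graded_module_TT graded_module_W[OF K(3)] \<mu>_bij \<mu>_image_degree \<mu>_closed \<mu>_add \<mu>_smult
  by simp

end

end

end

theorem theorem2:
  fixes k :: "('k, 'l) ring_scheme"
    and A :: "('k, 'a, 'n) module_scheme" and gr :: "nat \<Rightarrow> 'a set"
    and G K :: "('a \<Rightarrow> 'a) set"
    and M :: "('k, 'm, 'p) module_scheme" and \<rho> :: "('a \<Rightarrow> 'a) \<Rightarrow> 'm \<Rightarrow> 'm"
  defines "AG \<equiv> invariant_ring A G" and "AK \<equiv> invariant_ring A K"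
    and "AGM \<equiv> covariants k A M \<rho> G" and "AKM \<equiv> covariants k A M \<rho> K"
  assumes A: "normal_graded_algebra k A gr"
    and G: "subgroup G (BijGroup (carrier A))" "finite G" "G \<subseteq> graded_algebra_auts k A gr"
    and M: "linear_representation k (BijGroup (carrier A)\<lparr>carrier := G\<rparr>) M \<rho>"
           "vectorspace.fin_dim k M"
    and K: "subgroup K (BijGroup (carrier A))" "reflection_subgroup A G \<subseteq> K" "K \<subseteq> G"
    and free: "free_module AG AGM"
  shows "(\<exists>\<mu>. \<mu> \<in> graded_module_iso
                   AK (invariant_grading gr K)
                   (tensor_product AG AK AGM)
                   (tensor_grading AG AK (invariant_grading gr K)
                      AGM (covariant_grading k A gr M \<rho> G))
                   AKM (covariant_grading k A gr M \<rho> K) \<and>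
              (\<forall>a \<in> carrier AK. \<forall>\<omega> \<in> carrier AGM.
                 \<mu> (pure_tensor AG AK AGM a \<omega>) = a \<odot>\<^bsub>AKM\<^esub> \<omega>)) \<and>
         free_module AK AKM \<and>
         carrier AGM \<subseteq> carrier AKM \<and>
         (\<forall>B. module_basis AG AGM B \<longrightarrow> module_basis AK AKM B)"
proof -
  interpret covariant_setting k A gr G M \<rho> by (rule covariant_setting.intro[OF A G M])
  note defs = AG_def AK_def AGM_def AKM_def
  obtain B where B: "module_basis (AH G) (W G) B" using free unfolding free_module_def defs by blast
  have desc: "module_basis (AH G) (W G) B \<Longrightarrow> module_basis (AH K) (W K) B" for B
    by (rule basis_descends[OF K])
  obtain \<mu> where \<mu>: "\<forall>t \<in> carrier (tensor_product (AH G) (AH K) (W G)). \<mu> t \<in> carrier (W K)"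
    "\<forall>t \<in> carrier (tensor_product (AH G) (AH K) (W G)).
       \<forall>u \<in> carrier (tensor_product (AH G) (AH K) (W G)).
         \<mu> (t \<oplus>\<^bsub>tensor_product (AH G) (AH K) (W G)\<^esub> u) = \<mu> t \<oplus>\<^bsub>W K\<^esub> \<mu> u"
    "\<forall>a \<in> carrier (AH K). \<forall>w \<in> carrier (W G).
       \<mu> (pure_tensor (AH G) (AH K) (W G) a w) = a \<odot>\<^bsub>W K\<^esub> w"
    using exists_multiplication_map[OF K] by (elim exE conjE) (rule that)
  have "\<mu> \<in> graded_module_iso (AH K) (invariant_grading gr K) (tensor_product (AH G) (AH K) (W G))
      (tensor_grading (AH G) (AH K) (invariant_grading gr K) (W G) (covariant_grading k A gr M \<rho> G))
      (W K) (covariant_grading k A gr M \<rho> K)"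
    by (rule \<mu>_iso[OF K B]) (use \<mu> in simp_all)
  moreover have "carrier (W G) \<subseteq> carrier (W K)" using fixed_mono(2)[OF K] unfolding carrier_W .
  moreover have "free_module (AH K) (W K)" using desc[OF B] unfolding free_module_def by blast
  ultimately show ?thesis unfolding defs using \<mu>(3) desc by blast
qed

end
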